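(* Let $n\ge2$ and let $V$ be an irreducible $J\oplus D$-module which is a weight module with respect to $\mathfrak h_0$ with finite dimensional weight spaces. Assume that there exist non-zero central operators $z_1,\dots,z_{n-1}$ on $V$ of degrees $(k_1,0,\dots,0),\ (0,k_2,0,\dots,0),\ \dots,\ (0,\dots,0,k_{n-1},0)\in\mathbb Z^n$ respectively, where each $k_i$ is a positive integer. Then there exists a maximal $J\oplus D_{n-1}$-submodule $W$ of $V$ such that $V/W$ is an irreducible $J\oplus D_{n-1}$-module and has finite dimensional weight spaces with respect to $\mathfrak h_{n-1}$. Further, $W$ can be chosen such that $W$ contains $\{z_iv-v\mid v\in V,\ i=1,\dots,n-1\}$.
   Context: $\mathfrak g$ is a finite dimensional simple Lie algebra over $\mathbb C$ with non-degenerate invariant symmetric bilinear form $(\cdot,\cdot)$ and Cartan subalgebra $\mathfrak h$. $\mathfrak g_{\rm aff}=\mathfrak g\otimes\mathbb C[t_n^{\pm1}]\oplus\mathbb C K_n$ with $[x\otimes t_n^a,y\otimes t_n^b]=[x,y]\otimes t_n^{a+b}+a\,\delta_{a+b,0}(x,y)K_n$ and $K_n$ central. $A_{n-1}=\mathbb C[t_1^{\pm1},\dots,t_{n-1}^{\pm1}]$ and $J=\mathfrak g_{\rm aff}\otimes A_{n-1}$ with bracket $[X\otimes f,Y\otimes g]=[X,Y]\otimes fg$. $D$ is the span of commuting elements $d_1,\dots,d_n$, and $J\oplus D$ is the semidirect product in which $d_i$ acts on $J$ as the degree derivation $t_i\frac{\partial}{\partial t_i}$ ($K_n$ having degree $0$).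 $D_k$ is the span of $d_{k+1},\dots,d_n$, so $D_0=D$ and $D_{n-1}=\mathbb C d_n$, and $\mathfrak h_k=\mathfrak h\oplus\mathbb C K_n\oplus D_k$. A weight module with respect to $\mathfrak h_k$ is the direct sum of its simultaneous eigenspaces (weight spaces) for $\mathfrak h_k$. Central operators: on an irreducible $J\oplus D$-module $V$ with finite dimensional weight spaces, every element $K_n\otimes t^{\overline m}$ ($\overline m\in\mathbb Z^{n-1}$) that acts as a non-zero operator on $V$ acts invertibly. A central operator on $V$ is a scalar multiple of a finite product of operators by which such elements $K_n\otimes t^{\overline m}$ act, and inverses of such operators; it commutes with the action of $J$, and it has degree $\underline m\in\mathbb Z^n$ if $d_iz-zd_i=m_iz$ for $1\le i\le n$. *)

theory Defs
  imports
    "HOL-Algebra.QuotRing"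
    "HOL-Algebra.Module"
    "HOL-Algebra.Algebraic_Closure_Type"
    "HOL-Library.Poly_Mapping"
    "HOL-Library.Product_Plus"
    Complex_Main
begin

section \<open>Complex Lie algebras\<close>

locale lie_algebra = vector_space scale
  for scale :: "complex \<Rightarrow> 'g::ab_group_add \<Rightarrow> 'g" +
  fixes br :: "'g \<Rightarrow> 'g \<Rightarrow> 'g"
  assumes linear_right: "Vector_Spaces.linear scale scale (br x)"
    and linear_left: "Vector_Spaces.linear scale scale (\<lambda>x. br x y)"
    and alternating: "br x x = 0"
    and jacobi: "br x (br y z) + br y (br z x) + br z (br x y) = 0"
begin

definition finite_dimensional :: bool
  where "finite_dimensional \<longleftrightarrow> (\<exists>B. finite_dimensional_vector_space scale B)"

definition lie_ideal :: "'g set \<Rightarrow> bool"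
  where "lie_ideal I \<longleftrightarrow> subspace I \<and> (\<forall>x. \<forall>y\<in>I. br x y \<in> I)"

definition simple :: bool
  where "simple \<longleftrightarrow> (\<exists>x y. br x y \<noteq> 0) \<and> (\<forall>I. lie_ideal I \<longrightarrow> I = {0} \<or> I = UNIV)"

definition subalgebra :: "'g set \<Rightarrow> bool"
  where "subalgebra H \<longleftrightarrow> subspace H \<and> (\<forall>x\<in>H. \<forall>y\<in>H. br x y \<in> H)"

primrec lower_central :: "'g set \<Rightarrow> nat \<Rightarrow> 'g set"
  where
    "lower_central H 0 = H"
  | "lower_central H (Suc k) = span {br x y | x y. x \<in> H \<and> y \<in> lower_central H k}"

definition normalizer :: "'g set \<Rightarrow> 'g set"
  where "normalizer H = {x. \<forall>y\<in>H. br x y \<in> H}"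

definition cartan_subalgebra :: "'g set \<Rightarrow> bool"
  where "cartan_subalgebra H \<longleftrightarrow>
    subalgebra H \<and> (\<exists>k. lower_central H k = {0}) \<and> normalizer H = H"

definition nondeg_invariant_form :: "('g \<Rightarrow> 'g \<Rightarrow> complex) \<Rightarrow> bool"
  where "nondeg_invariant_form form \<longleftrightarrow>
    (\<forall>x. Vector_Spaces.linear scale (*) (form x)) \<and>
    (\<forall>x y. form x y = form y x) \<and>
    (\<forall>x y z. form (br x y) z = form x (br y z)) \<and>
    (\<forall>x. (\<forall>y. form x y = 0) \<longrightarrow> x = 0)"

end


section \<open>The Lie algebra \<open>J \<oplus> D\<close>\<close>

text \<open>
  A finitely supported function on exponents is a Laurent polynomial with coefficients in its
  range. So \<open>'g aff\<close> is \<open>g \<otimes> C[t\<^sub>n, t\<^sub>n\<^sup>-\<^sup>1] \<oplus> C K\<^sub>n\<close>, with \<open>(x, c)\<close> standing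
  for \<open>x + c K\<^sub>n\<close>, and \<open>'g loop\<close> is \<open>g\<^sub>a\<^sub>f\<^sub>f \<otimes> A\<close>, where \<open>single m F\<close> stands for
  \<open>F \<otimes> t\<^sup>m\<close>. Exponents \<open>m\<close> of the variables \<open>t\<^sub>1, t\<^sub>2, \<dots>\<close> are finitely supported
  functions on \<open>nat\<close>; the restriction to \<open>t\<^sub>1, \<dots>, t\<^sub>n\<^sub>-\<^sub>1\<close> and to \<open>d\<^sub>1, \<dots>, d\<^sub>n\<close> is made by
  the carrier set \<open>JD n k\<close> below. In \<open>'g loopD\<close> the pair \<open>(F, d)\<close> stands for
  \<open>F + (\<Sum>i. lookup d i \<cdot> d\<^sub>i)\<close>.
\<close>

type_synonym 'g aff = "(int \<Rightarrow>\<^sub>0 'g) \<times> complex"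
type_synonym expo = "nat \<Rightarrow>\<^sub>0 int"
type_synonym 'g loop = "expo \<Rightarrow>\<^sub>0 'g aff"
type_synonym 'g loopD = "'g loop \<times> (nat \<Rightarrow>\<^sub>0 complex)"

definition aff_scale ::
    "(complex \<Rightarrow> 'g \<Rightarrow> 'g) \<Rightarrow> complex \<Rightarrow> 'g::ab_group_add aff \<Rightarrow> 'g aff"
  where "aff_scale sc c F = (Poly_Mapping.map (sc c) (fst F), c * snd F)"

definition aff_bracket ::
    "('g \<Rightarrow> 'g \<Rightarrow> 'g) \<Rightarrow> ('g \<Rightarrow> 'g \<Rightarrow> complex) \<Rightarrow> 'g::ab_group_add aff \<Rightarrow> 'g aff \<Rightarrow> 'g aff"
  where "aff_bracket br form F G =
    (\<Sum>a\<in>Poly_Mapping.keys (fst F). \<Sum>b\<in>Poly_Mapping.keys (fst G).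
      (Poly_Mapping.single (a + b) (br (Poly_Mapping.lookup (fst F) a) (Poly_Mapping.lookup (fst G) b)),
       if a + b = 0 then of_int a * form (Poly_Mapping.lookup (fst F) a) (Poly_Mapping.lookup (fst G) b) else 0))"

definition aff_deriv ::
    "(complex \<Rightarrow> 'g \<Rightarrow> 'g) \<Rightarrow> 'g::ab_group_add aff \<Rightarrow> 'g aff"
  where "aff_deriv sc F =
    (\<Sum>a\<in>Poly_Mapping.keys (fst F). Poly_Mapping.single a (sc (of_int a) (Poly_Mapping.lookup (fst F) a)), 0)"

definition loop_scale ::
    "(complex \<Rightarrow> 'g \<Rightarrow> 'g) \<Rightarrow> complex \<Rightarrow> 'g::ab_group_add loop \<Rightarrow> 'g loop"
  where "loop_scale sc c F = Poly_Mapping.map (aff_scale sc c) F"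

definition loop_bracket ::
    "('g \<Rightarrow> 'g \<Rightarrow> 'g) \<Rightarrow> ('g \<Rightarrow> 'g \<Rightarrow> complex) \<Rightarrow> 'g::ab_group_add loop \<Rightarrow> 'g loop \<Rightarrow> 'g loop"
  where "loop_bracket br form F G =
    (\<Sum>m\<in>Poly_Mapping.keys F. \<Sum>l\<in>Poly_Mapping.keys G.
      Poly_Mapping.single (m + l) (aff_bracket br form (Poly_Mapping.lookup F m) (Poly_Mapping.lookup G l)))"

text \<open>The derivation \<open>t\<^sub>i \<partial>/\<partial>t\<^sub>i\<close>; for \<open>i = n\<close> the variable lives in the affine factor.\<close>

definition loop_deriv ::
    "nat \<Rightarrow> (complex \<Rightarrow> 'g \<Rightarrow> 'g) \<Rightarrow> nat \<Rightarrow> 'g::ab_group_add loop \<Rightarrow> 'g loop"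
  where "loop_deriv n sc i F =
    (\<Sum>m\<in>Poly_Mapping.keys F. Poly_Mapping.single m
      (if i = n then aff_deriv sc (Poly_Mapping.lookup F m)
       else aff_scale sc (of_int (Poly_Mapping.lookup m i)) (Poly_Mapping.lookup F m)))"

definition D_action ::
    "nat \<Rightarrow> (complex \<Rightarrow> 'g \<Rightarrow> 'g) \<Rightarrow> (nat \<Rightarrow>\<^sub>0 complex) \<Rightarrow> 'g::ab_group_add loop \<Rightarrow> 'g loop"
  where "D_action n sc d F = (\<Sum>i\<in>Poly_Mapping.keys d. loop_scale sc (Poly_Mapping.lookup d i) (loop_deriv n sc i F))"

definition JD_scale ::
    "(complex \<Rightarrow> 'g \<Rightarrow> 'g) \<Rightarrow> complex \<Rightarrow> 'g::ab_group_add loopD \<Rightarrow> 'g loopD"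
  where "JD_scale sc c P = (loop_scale sc c (fst P), Poly_Mapping.map ((*) c) (snd P))"

definition JD_bracket ::
    "nat \<Rightarrow> (complex \<Rightarrow> 'g \<Rightarrow> 'g) \<Rightarrow> ('g \<Rightarrow> 'g \<Rightarrow> 'g) \<Rightarrow> ('g \<Rightarrow> 'g \<Rightarrow> complex) \<Rightarrow>
      'g::ab_group_add loopD \<Rightarrow> 'g loopD \<Rightarrow> 'g loopD"
  where "JD_bracket n sc br form P Q =
    (loop_bracket br form (fst P) (fst Q) + D_action n sc (snd P) (fst Q)
       - D_action n sc (snd Q) (fst P), 0)"

text \<open>\<open>JD n k\<close> is \<open>J \<oplus> D\<^sub>k\<close>, and \<open>cartan_part n k H\<close> is \<open>h\<^sub>k\<close>.\<close>

definition A_expo :: "nat \<Rightarrow> expo set"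
  where "A_expo n = {m. Poly_Mapping.keys m \<subseteq> {1..<n}}"

definition D_part :: "nat \<Rightarrow> nat \<Rightarrow> (nat \<Rightarrow>\<^sub>0 complex) set"
  where "D_part n k = {d. Poly_Mapping.keys d \<subseteq> {k+1..n}}"

definition JD :: "nat \<Rightarrow> nat \<Rightarrow> 'g::ab_group_add loopD set"
  where "JD n k = {F. Poly_Mapping.keys F \<subseteq> A_expo n} \<times> D_part n k"

definition cartan_part :: "nat \<Rightarrow> nat \<Rightarrow> 'g set \<Rightarrow> 'g::ab_group_add loopD set"
  where "cartan_part n k H =
    {(Poly_Mapping.single 0 (Poly_Mapping.single 0 h, c), d) | h c d. h \<in> H \<and> d \<in> D_part n k}"

definition d_elt :: "nat \<Rightarrow> 'g::ab_group_add loopD"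
  where "d_elt i = (0, Poly_Mapping.single i 1)"

definition K_elt :: "expo \<Rightarrow> 'g::ab_group_add loopD"
  where "K_elt m = (Poly_Mapping.single m (0, 1), 0)"


subsection \<open>Values on monomials\<close>

lemma aff_bracket_monomial:
  assumes "lie_algebra sc br" "lie_algebra.nondeg_invariant_form sc br form"
  shows "aff_bracket br form (Poly_Mapping.single a x, c) (Poly_Mapping.single b y, e) =
    (Poly_Mapping.single (a + b) (br x y), if a + b = 0 then of_int a * form x y else 0)"
proof -
  interpret lie_algebra sc br by fact
  have l: "br 0 v = 0" "br u 0 = 0" for u v
    using linear_left linear_right
    by (metis module_hom.zero module_hom_iff_linear)+
  have f: "form u 0 = 0" for u
    using assms(2) unfolding nondeg_invariant_form_def
    by (metis module_hom.zero module_hom_iff_linear)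
  then have f': "form 0 u = 0" for u
    using assms(2) unfolding nondeg_invariant_form_def by metis
  show ?thesis
    by (cases "x = 0"; cases "y = 0") (auto simp: aff_bracket_def l f f' zero_prod_def)
qed

lemma loop_bracket_monomial:
  "loop_bracket br form (Poly_Mapping.single m F) (Poly_Mapping.single l G) =
    Poly_Mapping.single (m + l) (aff_bracket br form F G)"
  by (cases "F = 0"; cases "G = 0") (auto simp: loop_bracket_def aff_bracket_def)

lemma loop_deriv_monomial:
  assumes "lie_algebra sc br"
  shows "loop_deriv n sc i (Poly_Mapping.single m (Poly_Mapping.single a x, c)) =
    Poly_Mapping.single m
      (if i = n then (Poly_Mapping.single a (sc (of_int a) x), 0)
       else (Poly_Mapping.single a (sc (of_int (Poly_Mapping.lookup m i)) x),
             of_int (Poly_Mapping.lookup m i) * c))"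
proof -
  interpret lie_algebra sc br by fact
  have map_single: "Poly_Mapping.map (sc r) (Poly_Mapping.single a x) =
      Poly_Mapping.single a (sc r x)" for r
    by (rule poly_mapping_eqI) (auto simp: map.rep_eq lookup_single when_def)
  have map_zero: "Poly_Mapping.map (sc r) 0 = 0" for r
    by (rule poly_mapping_eqI) (simp add: map.rep_eq)
  have "Poly_Mapping.single a x = 0 \<longleftrightarrow> x = 0"
    by (metis lookup_single_eq lookup_zero single_zero)
  then have pair_eq0: "(Poly_Mapping.single a x, e) = 0 \<longleftrightarrow> x = 0 \<and> e = 0"
    "(0, e) = 0 \<longleftrightarrow> e = 0" for e :: complex
    by (auto simp: zero_prod_def)
  show ?thesis
    using map_single
    by (cases "x = 0"; cases "c = 0")
      (auto simp: loop_deriv_def aff_deriv_def aff_scale_def map_zero pair_eq0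
        simp flip: zero_prod_def)
qed


section \<open>Lie modules\<close>

abbreviation complex_field :: "complex ring"
  where "complex_field \<equiv> ring_of_type_algebra"

text \<open>The multiplicative fields inherited from the library's module record are not used.\<close>

record ('l, 'v) lie_mod = "(complex, 'v) module" +
  act :: "'l \<Rightarrow> 'v \<Rightarrow> 'v"

text \<open>\<open>L\<close> is (the carrier of) a Lie subalgebra of the type \<open>'l\<close> with operations \<open>sc\<close> and \<open>br\<close>.\<close>

definition lie_module ::
    "(complex \<Rightarrow> 'l \<Rightarrow> 'l) \<Rightarrow> ('l \<Rightarrow> 'l \<Rightarrow> 'l) \<Rightarrow> 'l::ab_group_add set \<Rightarrow> ('l, 'v) lie_mod \<Rightarrow> bool"
  where "lie_module sc br L V \<longleftrightarrow>
    module complex_field V \<and>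
    (\<forall>x\<in>L. \<forall>v\<in>carrier V. act V x v \<in> carrier V) \<and>
    (\<forall>x\<in>L. \<forall>v\<in>carrier V. \<forall>w\<in>carrier V.
      act V x (v \<oplus>\<^bsub>V\<^esub> w) = act V x v \<oplus>\<^bsub>V\<^esub> act V x w) \<and>
    (\<forall>x\<in>L. \<forall>c. \<forall>v\<in>carrier V. act V x (c \<odot>\<^bsub>V\<^esub> v) = c \<odot>\<^bsub>V\<^esub> act V x v) \<and>
    (\<forall>x\<in>L. \<forall>y\<in>L. \<forall>v\<in>carrier V. act V (x + y) v = act V x v \<oplus>\<^bsub>V\<^esub> act V y v) \<and>
    (\<forall>x\<in>L. \<forall>c. \<forall>v\<in>carrier V. act V (sc c x) v = c \<odot>\<^bsub>V\<^esub> act V x v) \<and>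
    (\<forall>x\<in>L. \<forall>y\<in>L. \<forall>v\<in>carrier V.
      act V (br x y) v = act V x (act V y v) \<ominus>\<^bsub>V\<^esub> act V y (act V x v))"

definition lie_submodule :: "'l set \<Rightarrow> 'v set \<Rightarrow> ('l, 'v) lie_mod \<Rightarrow> bool"
  where "lie_submodule L W V \<longleftrightarrow>
    submodule W complex_field V \<and> (\<forall>x\<in>L. \<forall>w\<in>W. act V x w \<in> W)"

definition maximal_lie_submodule :: "'l set \<Rightarrow> 'v set \<Rightarrow> ('l, 'v) lie_mod \<Rightarrow> bool"
  where "maximal_lie_submodule L W V \<longleftrightarrow>
    lie_submodule L W V \<and> W \<noteq> carrier V \<and>
    (\<forall>U. lie_submodule L U V \<and> W \<subseteq> U \<longrightarrow> U = W \<or> U = carrier V)"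

definition irreducible_lie_module ::
    "(complex \<Rightarrow> 'l \<Rightarrow> 'l) \<Rightarrow> ('l \<Rightarrow> 'l \<Rightarrow> 'l) \<Rightarrow> 'l::ab_group_add set \<Rightarrow> ('l, 'v) lie_mod \<Rightarrow> bool"
  where "irreducible_lie_module sc br L V \<longleftrightarrow>
    lie_module sc br L V \<and> carrier V \<noteq> {\<zero>\<^bsub>V\<^esub>} \<and>
    (\<forall>W. lie_submodule L W V \<longrightarrow> W = {\<zero>\<^bsub>V\<^esub>} \<or> W = carrier V)"

text \<open>Scalars and Lie algebra elements act on a coset through its representatives.\<close>

definition quotient_lie_mod :: "('l, 'v) lie_mod \<Rightarrow> 'v set \<Rightarrow> ('l, 'v set) lie_mod"
  where "quotient_lie_mod V W =
    \<lparr>carrier = a_rcosets\<^bsub>V\<^esub> W, monoid.mult = undefined, one = undefined,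
     zero = W, add = set_add V,
     module.smult = (\<lambda>c C. \<Union>v\<in>C. W +>\<^bsub>V\<^esub> (c \<odot>\<^bsub>V\<^esub> v)),
     act = (\<lambda>x C. \<Union>v\<in>C. W +>\<^bsub>V\<^esub> act V x v)\<rparr>"


subsection \<open>Weight spaces\<close>

text \<open>
  Linear functionals on the subspace \<open>H\<close>; extensionality makes functionals on \<open>H\<close> equal when they
  agree on \<open>H\<close>.
\<close>

definition dual_space :: "(complex \<Rightarrow> 'l \<Rightarrow> 'l) \<Rightarrow> 'l::ab_group_add set \<Rightarrow> ('l \<Rightarrow> complex) set"
  where "dual_space sc H =
    {\<mu> \<in> extensional H. (\<forall>x\<in>H. \<forall>y\<in>H. \<mu> (x + y) = \<mu> x + \<mu> y) \<and> (\<forall>x\<in>H. \<forall>c. \<mu> (sc c x) = c * \<mu> x)}"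

definition weight_space :: "'l set \<Rightarrow> ('l, 'v) lie_mod \<Rightarrow> ('l \<Rightarrow> complex) \<Rightarrow> 'v set"
  where "weight_space H V \<mu> = {v \<in> carrier V. \<forall>h\<in>H. act V h v = \<mu> h \<odot>\<^bsub>V\<^esub> v}"

text \<open>\<open>V\<close> is the direct sum of its weight spaces: every vector is, in a unique way, a finite sum of
  components in the weight spaces.\<close>

definition weight_module ::
    "(complex \<Rightarrow> 'l \<Rightarrow> 'l) \<Rightarrow> 'l::ab_group_add set \<Rightarrow> ('l, 'v) lie_mod \<Rightarrow> bool"
  where "weight_module sc H V \<longleftrightarrow>
    (\<forall>v\<in>carrier V. \<exists>!f.
      (\<forall>\<mu>\<in>dual_space sc H. f \<mu> \<in> weight_space H V \<mu>) \<and>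
      (\<forall>\<mu>. \<mu> \<notin> dual_space sc H \<longrightarrow> f \<mu> = \<zero>\<^bsub>V\<^esub>) \<and>
      finite {\<mu>. f \<mu> \<noteq> \<zero>\<^bsub>V\<^esub>} \<and>
      v = (\<Oplus>\<^bsub>V\<^esub>\<mu>\<in>{\<mu>. f \<mu> \<noteq> \<zero>\<^bsub>V\<^esub>}. f \<mu>))"

definition finite_dim_subspace :: "('l, 'v) lie_mod \<Rightarrow> 'v set \<Rightarrow> bool"
  where "finite_dim_subspace V S \<longleftrightarrow>
    (\<exists>B. finite B \<and> B \<subseteq> S \<and> (\<forall>v\<in>S. \<exists>c. v = (\<Oplus>\<^bsub>V\<^esub>b\<in>B. c b \<odot>\<^bsub>V\<^esub> b)))"

definition finite_dim_weight_spaces ::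
    "(complex \<Rightarrow> 'l \<Rightarrow> 'l) \<Rightarrow> 'l::ab_group_add set \<Rightarrow> ('l, 'v) lie_mod \<Rightarrow> bool"
  where "finite_dim_weight_spaces sc H V \<longleftrightarrow>
    (\<forall>\<mu>\<in>dual_space sc H. finite_dim_subspace V (weight_space H V \<mu>))"


subsection \<open>Central operators\<close>

text \<open>
  Operators on \<open>V\<close> are functions whose values matter on \<open>carrier V\<close> only. On the modules considered,
  a non-zero \<open>K\<^sub>n \<otimes> t\<^sup>m\<close> is bijective on the carrier, so that \<open>inv_into\<close> is its inverse there.
\<close>

definition central_generators :: "nat \<Rightarrow> ('g::ab_group_add loopD, 'v) lie_mod \<Rightarrow> ('v \<Rightarrow> 'v) set"
  where "central_generators n V =
    (\<Union>m\<in>{m \<in> A_expo n. \<exists>v\<in>carrier V. act V (K_elt m) v \<noteq> \<zero>\<^bsub>V\<^esub>}.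
      {act V (K_elt m), inv_into (carrier V) (act V (K_elt m))})"

definition central_operator ::
    "nat \<Rightarrow> ('g::ab_group_add loopD, 'v) lie_mod \<Rightarrow> ('v \<Rightarrow> 'v) \<Rightarrow> bool"
  where "central_operator n V z \<longleftrightarrow>
    (\<exists>c fs. set fs \<subseteq> central_generators n V \<and>
      (\<forall>v\<in>carrier V. z v = c \<odot>\<^bsub>V\<^esub> foldr (\<circ>) fs id v))"

definition nonzero_operator :: "('l, 'v) lie_mod \<Rightarrow> ('v \<Rightarrow> 'v) \<Rightarrow> bool"
  where "nonzero_operator V z \<longleftrightarrow> (\<exists>v\<in>carrier V. z v \<noteq> \<zero>\<^bsub>V\<^esub>)"

definition has_degree ::
    "nat \<Rightarrow> ('g::ab_group_add loopD, 'v) lie_mod \<Rightarrow> ('v \<Rightarrow> 'v) \<Rightarrow> (nat \<Rightarrow> int) \<Rightarrow> bool"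
  where "has_degree n V z m \<longleftrightarrow>
    (\<forall>i\<in>{1..n}. \<forall>v\<in>carrier V.
      act V (d_elt i) (z v) \<ominus>\<^bsub>V\<^esub> z (act V (d_elt i) v) = of_int (m i) \<odot>\<^bsub>V\<^esub> z v)"

end

theory Submission
  imports Defs
begin

text \<open>
  A non-zero \<open>K\<^sub>n \<otimes> t\<^sup>m\<close> commutes with \<open>J\<close> and is homogeneous, so its kernel and its image are
  submodules and it is bijective. Hence the \<open>z\<^sub>i\<close> are bijective, commute with each other, with \<open>J\<close>
  and with \<open>d\<^sub>n\<close>, and \<open>W\<^sub>0 = \<Sum>\<^sub>i (z\<^sub>i - 1) V\<close> is a \<open>J \<oplus> C d\<^sub>n\<close>-submodule. It contains no common
  eigenvector of \<open>d\<^sub>1, \<dots>, d\<^sub>n\<^sub>-\<^sub>1\<close> because \<open>z\<^sub>i\<close> shifts the eigenvalues of \<open>d\<^sub>i\<close>. A weight vector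
  generates \<open>V\<close> already over \<open>J\<close>, so Zorn's lemma for the submodules that contain \<open>W\<^sub>0\<close> but not a
  fixed weight vector yields a maximal submodule \<open>W\<close>.

  The eigenvalues of \<open>d\<^sub>i\<close> on \<open>V\<close> lie in a single coset of the integers, by irreducibility. Modulo \<open>W\<close>
  the operators \<open>z\<^sub>i\<close> act as the identity, so every weight vector of \<open>V\<close> is congruent to one whose
  \<open>d\<^sub>i\<close>-eigenvalue lies in a fixed set of \<open>k\<^sub>i\<close> elements, for \<open>i < n\<close>. So each weight space of \<open>V/W\<close> is
  spanned by the images of finitely many weight spaces of \<open>V\<close>.
\<close>

section \<open>Complex vector spaces with a carrier\<close>

text \<open>The submodule \<open>W\<close> is proper and contains the non-zero vectors
  \<open>z i v \<ominus> v\<close> for weight vectors \<open>v \<noteq> \<zero>\<close>, so by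
  irreducibility it cannot be stable under all of \<open>D\<close>. Hence the decomposition of
  \<open>V\<close> under \<open>cartan_part n 0 H\<close> does not descend to the quotient, and a
  decomposition under the smaller Cartan part has to be rebuilt there; weights of \<open>V\<close>
  that differ only in the first n-1 degree coordinates merge in it.

  The sum of the images of the \<open>z i\<close> minus the identity is built one operator at a
  time. Comparing extreme eigenvalues for one more \<open>z i\<close> takes place modulo the
  previous partial sum, which must therefore be stable under the new degree operator, the new
  \<open>z i\<close> and its inverse. For this reason independence of eigenvectors is proved
  relative to a stable subspace \<open>U\<close>, and the commutation properties of central
  operators are phrased so that they pass to inverses.\<close>

locale cspace = module complex_field V
  for V :: "(complex, 'v, 'm) module_scheme" (structure)
begin

lemma complex_field_simps [simp]:
  "carrier complex_field = UNIV" "zero complex_field = 0" "one complex_field = 1"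
  "add complex_field = (+)" "monoid.mult complex_field = (*)"
  by (simp_all add: ring_of_type_algebra_def)

lemma
  assumes "v \<in> carrier V"
  shows scale_closed [simp, intro]: "c \<odot> v \<in> carrier V"
    and scale_add: "(a + b) \<odot> v = a \<odot> v \<oplus> b \<odot> v"
    and scale_scale [simp]: "a \<odot> (b \<odot> v) = (a * b) \<odot> v"
    and scale_one [simp]: "1 \<odot> v = v"
    and scale_zero [simp]: "0 \<odot> v = \<zero>"
    and scale_minus_one: "(- 1) \<odot> v = \<ominus> v"
proof -
  show "c \<odot> v \<in> carrier V" "(a + b) \<odot> v = a \<odot> v \<oplus> b \<odot> v" "1 \<odot> v = v" "0 \<odot> v = \<zero>"
    and "a \<odot> (b \<odot> v) = (a * b) \<odot> v"
    using smult_closed[of c v] smult_l_distr[of a b v] smult_one[of v] smult_l_null[of v]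
      smult_assoc1[of a b v] assms by auto
  have "(- 1) \<odot> v \<oplus> v = ((- 1) + 1) \<odot> v"
    using smult_l_distr[of "-1" 1 v] smult_one[of v] assms by simp
  also have "\<dots> = \<zero>"
    using smult_l_null[of v] assms by simp
  finally show "(- 1) \<odot> v = \<ominus> v"
    using assms smult_closed[of "-1" v] by (simp add: M.minus_equality)
qed

lemma scale_add_right:
  "v \<in> carrier V \<Longrightarrow> w \<in> carrier V \<Longrightarrow> c \<odot> (v \<oplus> w) = c \<odot> v \<oplus> c \<odot> w"
  using smult_r_distr[of c v w] by simp

lemma scale_zero_right [simp]: "c \<odot> \<zero> = \<zero>"
  using smult_r_null[of c] by simp

lemma scale_eq_zero_iff:
  assumes "v \<in> carrier V"
  shows "c \<odot> v = \<zero> \<longleftrightarrow> c = 0 \<or> v = \<zero>"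
proof -
  have "v = \<zero>" if "c \<odot> v = \<zero>" "c \<noteq> 0"
  proof -
    have "v = (inverse c * c) \<odot> v"
      using assms that by simp
    also have "\<dots> = inverse c \<odot> (c \<odot> v)"
      using assms by (simp del: scale_scale add: scale_scale[symmetric])
    finally show ?thesis
      using that by simp
  qed
  then show ?thesis
    using assms by auto
qed

lemma scale_minus_left: "v \<in> carrier V \<Longrightarrow> (- c) \<odot> v = \<ominus> (c \<odot> v)"
  using scale_minus_one[OF scale_closed] scale_scale[of v "- 1" c] by simp

lemma scale_diff: "v \<in> carrier V \<Longrightarrow> (a - b) \<odot> v = a \<odot> v \<ominus> b \<odot> v"
  using scale_add[of v a "- b"] by (simp add: scale_minus_left M.minus_eq)

lemma scale_diff_right:
  "v \<in> carrier V \<Longrightarrow> w \<in> carrier V \<Longrightarrow> c \<odot> (v \<ominus> w) = c \<odot> v \<ominus> c \<odot> w"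
  using smult_r_minus[of c w] by (simp add: M.minus_eq scale_add_right)


subsection \<open>Subspaces\<close>

abbreviation sub :: "'v set \<Rightarrow> bool"
  where "sub U \<equiv> submodule U complex_field V"

lemma subI:
  assumes "U \<subseteq> carrier V" "\<zero> \<in> U" "\<And>u w. u \<in> U \<Longrightarrow> w \<in> U \<Longrightarrow> u \<oplus> w \<in> U"
    and "\<And>c u. u \<in> U \<Longrightarrow> c \<odot> u \<in> U"
  shows "sub U"
proof (rule submoduleI)
  show "\<ominus> u \<in> U" if "u \<in> U" for u
    using that assms(1) assms(4)[of u "-1"] scale_minus_one[of u] by (auto dest: subsetD)
qed (use assms in auto)

lemma subD:
  assumes "sub U"
  shows sub_subset: "U \<subseteq> carrier V"
    and sub_carrier: "\<And>u. u \<in> U \<Longrightarrow> u \<in> carrier V"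
    and sub_zero: "\<zero> \<in> U"
    and sub_add: "\<And>u w. u \<in> U \<Longrightarrow> w \<in> U \<Longrightarrow> u \<oplus> w \<in> U"
    and sub_scale: "\<And>c u. u \<in> U \<Longrightarrow> c \<odot> u \<in> U"
    and sub_neg: "\<And>u. u \<in> U \<Longrightarrow> \<ominus> u \<in> U"
    and sub_diff: "\<And>u w. u \<in> U \<Longrightarrow> w \<in> U \<Longrightarrow> u \<ominus> w \<in> U"
proof -
  note E = submoduleE[OF assms]
  show "U \<subseteq> carrier V" "\<And>u. u \<in> U \<Longrightarrow> u \<in> carrier V"
    using E(1) by auto
  show a: "u \<oplus> w \<in> U" if "u \<in> U" "w \<in> U" for u w
    using E(5) that by auto
  show s: "c \<odot> u \<in> U" if "u \<in> U" for c u
    using E(4) that by auto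
  show n: "\<ominus> u \<in> U" if "u \<in> U" for u
    using E(3) that by auto
  show "u \<ominus> w \<in> U" if "u \<in> U" "w \<in> U" for u w
    using a n that by (simp add: M.minus_eq)
  obtain u where u: "u \<in> U"
    using E(2) by auto
  have "0 \<odot> u = \<zero>"
    using E(1) u by (intro scale_zero) auto
  then show "\<zero> \<in> U"
    using s[OF u, of 0] by simp
qed

lemma sub_carrier_self: "sub (carrier V)"
  by (rule subI) auto

lemma sub_singleton_zero: "sub {\<zero>}"
  by (rule subI) auto

lemma sub_scaleD:
  assumes "sub U" "v \<in> carrier V" "c \<noteq> 0" "c \<odot> v \<in> U"
  shows "v \<in> U"
proof -
  have "inverse c \<odot> (c \<odot> v) \<in> U"
    using assms by (simp only: sub_scale)
  then show ?thesis
    using assms by simp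
qed

text \<open>The intersection makes minimality immediate; for \<open>S\<close> not inside
  \<open>carrier V\<close> it ranges over the empty family and is the whole type, hence the
  hypothesis of \<open>sub_lspan\<close>. Finite combinations come back in
  \<open>finite_span_combination\<close>.\<close>

definition lspan :: "'v set \<Rightarrow> 'v set"
  where "lspan S = \<Inter>{U. sub U \<and> S \<subseteq> U}"

lemma sub_Inter:
  assumes "\<And>U. U \<in> \<U> \<Longrightarrow> sub U" "\<U> \<noteq> {}"
  shows "sub (\<Inter>\<U>)"
  by (rule subI)
    (use assms in \<open>auto dest: sub_carrier sub_zero intro: sub_add sub_scale\<close>)

lemma sub_lspan: "S \<subseteq> carrier V \<Longrightarrow> sub (lspan S)"
  unfolding lspan_def by (rule sub_Inter) (use sub_carrier_self in auto)

lemma lspan_superset: "S \<subseteq> lspan S"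
  unfolding lspan_def by auto

lemma lspan_minimal: "sub U \<Longrightarrow> S \<subseteq> U \<Longrightarrow> lspan S \<subseteq> U"
  unfolding lspan_def by auto

lemma sub_combinations:
  assumes "B \<subseteq> carrier V"
  shows "sub {\<Oplus>b\<in>B. c b \<odot> b | c. True}"
proof (rule subI)
  have cl: "(\<lambda>b. c b \<odot> b) \<in> B \<rightarrow> carrier V" for c
    using assms by auto
  show "{\<Oplus>b\<in>B. c b \<odot> b | c. True} \<subseteq> carrier V"
    using cl by auto
  have "(\<Oplus>b\<in>B. 0 \<odot> b) = (\<Oplus>b\<in>B. \<zero>)"
    using assms by (intro M.finsum_cong') auto
  then show "\<zero> \<in> {\<Oplus>b\<in>B. c b \<odot> b | c. True}"
    by (force intro!: exI[of _ "\<lambda>_. 0"])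
  show "u \<oplus> w \<in> {\<Oplus>b\<in>B. c b \<odot> b | c. True}"
    if uw: "u \<in> {\<Oplus>b\<in>B. c b \<odot> b | c. True}" "w \<in> {\<Oplus>b\<in>B. c b \<odot> b | c. True}" for u w
  proof -
    obtain c d where "u = (\<Oplus>b\<in>B. c b \<odot> b)" "w = (\<Oplus>b\<in>B. d b \<odot> b)"
      using uw by auto
    then have "u \<oplus> w = (\<Oplus>b\<in>B. c b \<odot> b \<oplus> d b \<odot> b)"
      using cl by (simp add: M.finsum_addf)
    also have "\<dots> = (\<Oplus>b\<in>B. (c b + d b) \<odot> b)"
      using assms cl by (intro M.finsum_cong') (auto simp: scale_add subset_eq)
    finally show ?thesis
      by auto
  qed
  show "a \<odot> u \<in> {\<Oplus>b\<in>B. c b \<odot> b | c. True}" if u: "u \<in> {\<Oplus>b\<in>B. c b \<odot> b | c. True}" for a u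
  proof -
    obtain c where c: "u = (\<Oplus>b\<in>B. c b \<odot> b)"
      using u by auto
    have "a \<odot> u = (\<Oplus>b\<in>B. (a * c b) \<odot> b)"
    \<comment> \<open>Over an infinite index set \<open>\<Oplus>\<close> is zero by convention, so
      both sides vanish there.\<close>
    proof (cases "finite B")
      case True
      have "a \<odot> u = (\<Oplus>b\<in>B. a \<odot> (c b \<odot> b))"
        unfolding c using finsum_smult_ldistr[OF True, of a "\<lambda>b. c b \<odot> b"] cl by simp
      also have "\<dots> = (\<Oplus>b\<in>B. (a * c b) \<odot> b)"
        using assms by (intro M.finsum_cong') auto
      finally show ?thesis .
    qed (simp add: c)
    then show ?thesis
      by auto
  qed
qed

lemma finite_span_combination:
  assumes "finite B" "B \<subseteq> carrier V" "v \<in> lspan B"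
  shows "\<exists>c. v = (\<Oplus>b\<in>B. c b \<odot> b)"
proof -
  have "b \<in> {\<Oplus>b\<in>B. c b \<odot> b | c. True}" if "b \<in> B" for b
  proof -
    have "(\<Oplus>x\<in>B. (if b = x then 1 else 0) \<odot> x) = (\<Oplus>x\<in>B. if b = x then x else \<zero>)"
      using assms by (intro M.finsum_cong') auto
    also have "\<dots> = b"
      using M.finsum_singleton[of b B "\<lambda>x. x"] that assms by auto
    finally show ?thesis
      by (auto intro!: exI[of _ "\<lambda>x. if b = x then 1 else 0"])
  qed
  then have "lspan B \<subseteq> {\<Oplus>b\<in>B. c b \<odot> b | c. True}"
    using assms by (intro lspan_minimal sub_combinations) auto
  then show ?thesis
    using assms by auto
qed


subsection \<open>Sums of finitely supported families\<close>

text \<open>A sum over exactly the support is the form used in \<open>weight_module\<close>, so a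
  decomposition found with \<open>fsum\<close> can be handed over unchanged.\<close>

definition fsum :: "('i \<Rightarrow> 'v) \<Rightarrow> 'v"
  where "fsum f = (\<Oplus>i\<in>{i. f i \<noteq> \<zero>}. f i)"

definition family :: "('i \<Rightarrow> 'v) \<Rightarrow> bool"
  where "family f \<longleftrightarrow> (\<forall>i. f i \<in> carrier V) \<and> finite {i. f i \<noteq> \<zero>}"

lemma familyD: "family f \<Longrightarrow> f i \<in> carrier V" "family f \<Longrightarrow> finite {i. f i \<noteq> \<zero>}"
  by (simp_all add: family_def)

lemma fsum_eq:
  assumes "family f" "finite F" "{i. f i \<noteq> \<zero>} \<subseteq> F"
  shows "fsum f = (\<Oplus>i\<in>F. f i)"
  unfolding fsum_def
  by (rule M.add.finprod_mono_neutral_cong_left) (use assms in \<open>auto simp: family_def\<close>)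

lemma fsum_closed [simp]: "family f \<Longrightarrow> fsum f \<in> carrier V"
  unfolding fsum_def family_def by (intro M.finsum_closed) auto

lemma
  assumes "family f" "family g"
  shows family_add: "family (\<lambda>i. f i \<oplus> g i)"
    and fsum_add: "fsum (\<lambda>i. f i \<oplus> g i) = fsum f \<oplus> fsum g"
proof -
  let ?F = "{i. f i \<noteq> \<zero>} \<union> {i. g i \<noteq> \<zero>}"
  have F: "finite ?F" "{i. f i \<oplus> g i \<noteq> \<zero>} \<subseteq> ?F"
    using assms by (auto simp: family_def)
  then show fam: "family (\<lambda>i. f i \<oplus> g i)"
    using assms finite_subset[OF F(2,1)] by (auto simp: family_def)
  have "fsum (\<lambda>i. f i \<oplus> g i) = (\<Oplus>i\<in>?F. f i \<oplus> g i)"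
    by (rule fsum_eq) (use fam F in auto)
  also have "\<dots> = (\<Oplus>i\<in>?F. f i) \<oplus> (\<Oplus>i\<in>?F. g i)"
    using assms by (intro M.finsum_addf) (auto simp: family_def)
  also have "\<dots> = fsum f \<oplus> fsum g"
    using fsum_eq[of f ?F] fsum_eq[of g ?F] assms F by auto
  finally show "fsum (\<lambda>i. f i \<oplus> g i) = fsum f \<oplus> fsum g" .
qed

lemma family_zero: "family (\<lambda>_. \<zero>)" and fsum_zero: "fsum (\<lambda>_. \<zero>) = \<zero>"
  by (simp_all add: family_def fsum_def)

lemma
  assumes "v \<in> carrier V"
  shows family_single: "family (\<lambda>j. if j = i then v else \<zero>)"
    and fsum_single: "fsum (\<lambda>j. if j = i then v else \<zero>) = v"
proof -
  show fam: "family (\<lambda>j. if j = i then v else \<zero>)"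
    using assms by (auto simp: family_def)
  have "fsum (\<lambda>j. if j = i then v else \<zero>) = (\<Oplus>j\<in>{i}. if j = i then v else \<zero>)"
    by (rule fsum_eq) (use fam in auto)
  then show "fsum (\<lambda>j. if j = i then v else \<zero>) = v"
    using assms by simp
qed

lemma sub_finsum:
  assumes "sub U" "\<And>i. i \<in> F \<Longrightarrow> f i \<in> U"
  shows "(\<Oplus>i\<in>F. f i) \<in> U"
  using assms(2)
proof (induction F rule: infinite_finite_induct)
  case (insert x F)
  then show ?case
    using assms(1) sub_carrier[OF assms(1)] by (simp add: sub_add Pi_def)
qed (use assms(1) in \<open>simp_all add: sub_zero\<close>)

section \<open>Linear operators on the carrier\<close>

definition endo :: "('v \<Rightarrow> 'v) \<Rightarrow> bool"
  where "endo T \<longleftrightarrow> (\<forall>v\<in>carrier V. T v \<in> carrier V) \<and>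
    (\<forall>v\<in>carrier V. \<forall>w\<in>carrier V. T (v \<oplus> w) = T v \<oplus> T w) \<and>
    (\<forall>c. \<forall>v\<in>carrier V. T (c \<odot> v) = c \<odot> T v)"

lemma endoD:
  assumes "endo T" "v \<in> carrier V"
  shows endo_closed: "T v \<in> carrier V"
    and endo_add: "w \<in> carrier V \<Longrightarrow> T (v \<oplus> w) = T v \<oplus> T w"
    and endo_scale: "T (c \<odot> v) = c \<odot> T v"
  using assms by (auto simp: endo_def)

lemma endo_zero: "endo T \<Longrightarrow> T \<zero> = \<zero>"
  using endo_scale[of T "\<zero>" 0] endo_closed[of T "\<zero>"] by simp

lemma endo_diff:
  assumes "endo T" "v \<in> carrier V" "w \<in> carrier V"
  shows "T (v \<ominus> w) = T v \<ominus> T w"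
proof -
  have "T (\<ominus> w) = \<ominus> (T w)"
    using endo_scale[OF assms(1,3), of "-1"] assms by (simp add: scale_minus_one endo_closed)
  then show ?thesis
    using assms by (simp add: M.minus_eq endo_add)
qed

lemma
  assumes "endo T" "family f"
  shows family_endo: "family (\<lambda>i. T (f i))"
    and fsum_endo: "fsum (\<lambda>i. T (f i)) = T (fsum f)"
proof -
  let ?F = "{i. f i \<noteq> \<zero>}"
  have F: "finite ?F" "{i. T (f i) \<noteq> \<zero>} \<subseteq> ?F" and cl: "\<And>i. f i \<in> carrier V"
    using assms endo_zero by (auto simp: family_def)
  show fam: "family (\<lambda>i. T (f i))"
    using finite_subset[OF F(2,1)] assms endo_closed by (auto simp: family_def)
  have "finite F \<Longrightarrow> (\<Oplus>i\<in>F. T (f i)) = T (\<Oplus>i\<in>F. f i)" for F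
    by (induction F rule: finite_induct)
      (use assms cl in \<open>simp_all add: endo_zero endo_add endo_closed Pi_def\<close>)
  then show "fsum (\<lambda>i. T (f i)) = T (fsum f)"
    using fsum_eq[OF fam F] F(1) by (simp add: fsum_def)
qed

lemma endo_scaling: "endo (\<lambda>v. c \<odot> v)"
  by (auto simp: endo_def scale_add_right mult.commute)

lemma
  assumes "family f"
  shows family_scale: "family (\<lambda>i. c \<odot> f i)"
    and fsum_scale: "fsum (\<lambda>i. c \<odot> f i) = c \<odot> fsum f"
  using family_endo[OF endo_scaling assms] fsum_endo[OF endo_scaling assms] by auto

lemma
  assumes "family f" "family g"
  shows family_diff: "family (\<lambda>i. f i \<ominus> g i)"
    and fsum_diff: "fsum (\<lambda>i. f i \<ominus> g i) = fsum f \<ominus> fsum g"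
proof -
  have eq: "x \<ominus> y = x \<oplus> (- 1) \<odot> y" if "x \<in> carrier V" "y \<in> carrier V" for x y
    using that by (simp add: scale_minus_one M.minus_eq)
  have *: "(\<lambda>i. f i \<ominus> g i) = (\<lambda>i. f i \<oplus> (- 1) \<odot> g i)"
    using assms by (simp add: eq familyD)
  show "family (\<lambda>i. f i \<ominus> g i)" "fsum (\<lambda>i. f i \<ominus> g i) = fsum f \<ominus> fsum g"
    unfolding * using assms eq[of "fsum f" "fsum g"]
    by (simp_all add: family_add fsum_add family_scale fsum_scale)
qed

text \<open>Translations of the index are the case in mind: an operator that raises eigenvalues by a
  constant moves the component at \<open>c\<close> to \<open>c\<close> plus that constant.\<close>

lemma
  assumes "family f" "bij s"
  shows family_reindex: "family (\<lambda>i. f (s i))"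
    and fsum_reindex: "fsum (\<lambda>i. f (s i)) = fsum f"
proof -
  have "s ` (s -` {j. f j \<noteq> \<zero>}) = {j. f j \<noteq> \<zero>}"
    using assms(2) by (intro surj_image_vimage_eq) (simp add: bij_def)
  then have img: "{j. f j \<noteq> \<zero>} = s ` {i. f (s i) \<noteq> \<zero>}"
    unfolding vimage_def by simp
  have inj: "inj_on s A" for A
    using assms(2) by (auto simp: bij_def inj_on_def)
  show "family (\<lambda>i. f (s i))"
    using assms(1) finite_imageD[OF _ inj, of "{i. f (s i) \<noteq> \<zero>}"] img
    by (simp add: family_def)
  show "fsum (\<lambda>i. f (s i)) = fsum f"
    unfolding fsum_def img
    by (rule M.add.finprod_reindex[symmetric]) (use assms inj in \<open>auto simp: family_def\<close>)
qed

section \<open>Simultaneous eigenvectors\<close>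

lemma diff_zero: "v \<in> carrier V \<Longrightarrow> v \<ominus> \<zero> = v"
  using scale_minus_one[of "\<zero>"] by (simp add: M.minus_eq)

lemma diff_eq_zero_iff:
  assumes "u \<in> carrier V" "v \<in> carrier V"
  shows "u \<ominus> v = \<zero> \<longleftrightarrow> u = v"
proof
  assume "u \<ominus> v = \<zero>"
  then have "\<ominus> (\<ominus> v) = u"
    using assms by (intro M.minus_equality) (simp_all add: M.minus_eq)
  then show "u = v"
    using assms by simp
qed (use assms in \<open>simp add: M.minus_eq M.r_neg\<close>)

text \<open>Induction on the size of the support. If components \<open>i\<close> and
  \<open>j\<close> are non-zero and \<open>h\<close> separates them, \<open>T h\<close> minus
  \<open>e j h\<close> keeps the sum in \<open>U\<close>, kills component \<open>j\<close> and
  rescales component \<open>i\<close> by a non-zero factor. For \<open>U = {\<zero>}\<close> this is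
  linear independence; for a larger stable \<open>U\<close> it is independence modulo
  \<open>U\<close> without forming a quotient.\<close>

lemma eigenvectors_independent:
  fixes T :: "'h \<Rightarrow> 'v \<Rightarrow> 'v" and e :: "'i \<Rightarrow> 'h \<Rightarrow> complex"
  assumes "sub U"
    and endo: "\<And>h. h \<in> H \<Longrightarrow> endo (T h)"
    and stable: "\<And>h u. h \<in> H \<Longrightarrow> u \<in> U \<Longrightarrow> T h u \<in> U"
    and "family f"
    and "\<And>i h. h \<in> H \<Longrightarrow> T h (f i) = e i h \<odot> f i"
    and "\<And>i j. f i \<noteq> \<zero> \<Longrightarrow> f j \<noteq> \<zero> \<Longrightarrow> i \<noteq> j \<Longrightarrow> \<exists>h\<in>H. e i h \<noteq> e j h"
    and "fsum f \<in> U"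
  shows "f i \<in> U"
  using assms(4-)
proof (induction "card {i. f i \<noteq> \<zero>}" arbitrary: f i rule: less_induct)
  case less
  consider "f i = \<zero>" | "f i \<noteq> \<zero>" "\<And>j. f j \<noteq> \<zero> \<Longrightarrow> j = i"
    | j where "f i \<noteq> \<zero>" "f j \<noteq> \<zero>" "j \<noteq> i"
    by metis
  then show ?case
  proof cases
    case 1
    then show ?thesis
      using sub_zero[OF assms(1)] by simp
  next
    case 2
    then have "{i. f i \<noteq> \<zero>} = {i}"
      by blast
    then have "fsum f = f i"
      using less.prems(1) by (simp add: fsum_def familyD)
    then show ?thesis
      using less.prems(4) by simp
  next
    case 3
    then obtain h where h: "h \<in> H" "e i h \<noteq> e j h"
      using less.prems(3) by blast
    let ?g = "\<lambda>l. (e l h - e j h) \<odot> f l"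
    have cl: "f l \<in> carrier V" for l
      using less.prems(1) by (simp add: familyD)
    have g: "?g = (\<lambda>l. T h (f l) \<ominus> e j h \<odot> f l)"
      using less.prems(2)[OF h(1)] cl by (simp add: scale_diff)
    have fam: "family ?g" and fs: "fsum ?g = T h (fsum f) \<ominus> e j h \<odot> fsum f"
      unfolding g using less.prems(1) endo[OF h(1)]
      by (simp_all add: family_diff fsum_diff family_endo fsum_endo family_scale fsum_scale)
    have "{l. ?g l \<noteq> \<zero>} \<subset> {l. f l \<noteq> \<zero>}"
    proof (rule psubsetI)
      show "{l. ?g l \<noteq> \<zero>} \<subseteq> {l. f l \<noteq> \<zero>}"
        by auto
      have "?g j = \<zero>"
        using cl by simp
      then show "{l. ?g l \<noteq> \<zero>} \<noteq> {l. f l \<noteq> \<zero>}"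
        using 3(2) by blast
    qed
    then have "card {l. ?g l \<noteq> \<zero>} < card {l. f l \<noteq> \<zero>}"
      using less.prems(1) by (intro psubset_card_mono) (auto simp: family_def)
    moreover have "fsum ?g \<in> U"
      unfolding fs using less.prems(4) h(1) assms(1) stable
      by (intro sub_diff sub_scale) auto
    moreover have "T h' (?g l) = e l h' \<odot> ?g l" if "h' \<in> H" for l h'
      using that endo cl less.prems(2) by (simp add: endo_scale mult.commute)
    moreover have "\<exists>h\<in>H. e l h \<noteq> e l' h" if "?g l \<noteq> \<zero>" "?g l' \<noteq> \<zero>" "l \<noteq> l'" for l l'
      using that less.prems(3)[of l l'] cl by (auto simp: scale_eq_zero_iff)
    ultimately have "?g i \<in> U"
      using fam by (intro less.hyps[of ?g]) auto
    then show ?thesis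
      using h(2) cl assms(1) sub_scaleD[of U "f i" "e i h - e j h"] by simp
  qed
qed

text \<open>The differences form an eigenvector family with sum zero. The set \<open>I\<close> marks
  where \<open>e\<close> separates indices; for weights it is the dual space, since arbitrary
  functions may agree on \<open>H\<close> and still be different.\<close>

lemma eigenvectors_unique:
  fixes T :: "'h \<Rightarrow> 'v \<Rightarrow> 'v" and e :: "'i \<Rightarrow> 'h \<Rightarrow> complex"
  assumes endo: "\<And>h. h \<in> H \<Longrightarrow> endo (T h)"
    and separated: "\<And>i j. i \<in> I \<Longrightarrow> j \<in> I \<Longrightarrow> i \<noteq> j \<Longrightarrow> \<exists>h\<in>H. e i h \<noteq> e j h"
    and f: "family f" "\<And>i h. h \<in> H \<Longrightarrow> T h (f i) = e i h \<odot> f i" "\<And>i. i \<notin> I \<Longrightarrow> f i = \<zero>"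
    and g: "family g" "\<And>i h. h \<in> H \<Longrightarrow> T h (g i) = e i h \<odot> g i" "\<And>i. i \<notin> I \<Longrightarrow> g i = \<zero>"
    and eq: "fsum f = fsum g"
  shows "f = g"
proof
  fix i
  let ?d = "\<lambda>i. f i \<ominus> g i"
  have cl: "f i \<in> carrier V" "g i \<in> carrier V" for i
    using f(1) g(1) by (simp_all add: familyD)
  have diff_outside: "?d i = \<zero>" if "i \<notin> I" for i
    using that f(3) g(3) by (simp add: M.minus_eq)
  have "?d i \<in> {\<zero>}"
  proof (rule eigenvectors_independent[where H = H and T = T and e = e, OF sub_singleton_zero])
    show "family ?d"
      using f(1) g(1) by (rule family_diff)
    show "T h (?d i) = e i h \<odot> ?d i" if "h \<in> H" for i h
      using that cl by (simp add: endo endo_diff f(2) g(2) scale_diff_right)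
    show "\<exists>h\<in>H. e i h \<noteq> e j h" if "?d i \<noteq> \<zero>" "?d j \<noteq> \<zero>" "i \<noteq> j" for i j
    proof (rule separated)
      show "i \<in> I" "j \<in> I"
        using that(1,2) diff_outside by blast+
    qed fact
    show "fsum ?d \<in> {\<zero>}"
      unfolding fsum_diff[OF f(1) g(1)] using eq g(1) by (simp add: M.minus_eq M.r_neg)
  qed (use endo endo_zero in auto)
  then show "f i = g i"
    using cl by (simp add: diff_eq_zero_iff)
qed

text \<open>Uniqueness is applied to \<open>f\<close> and the family whose only component is
  \<open>fsum f\<close> at \<open>j\<close>.\<close>

lemma eigenvector_component:
  fixes T :: "'h \<Rightarrow> 'v \<Rightarrow> 'v" and e :: "'i \<Rightarrow> 'h \<Rightarrow> complex"
  assumes endo: "\<And>h. h \<in> H \<Longrightarrow> endo (T h)"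
    and separated: "\<And>i j. i \<in> I \<Longrightarrow> j \<in> I \<Longrightarrow> i \<noteq> j \<Longrightarrow> \<exists>h\<in>H. e i h \<noteq> e j h"
    and f: "family f" "\<And>i h. h \<in> H \<Longrightarrow> T h (f i) = e i h \<odot> f i" "\<And>i. i \<notin> I \<Longrightarrow> f i = \<zero>"
    and j: "j \<in> I" "\<And>h. h \<in> H \<Longrightarrow> T h (fsum f) = e j h \<odot> fsum f"
  shows "fsum f = f j"
proof -
  have "f = (\<lambda>i. if i = j then fsum f else \<zero>)"
  proof (rule eigenvectors_unique[where H = H and T = T and e = e and I = I])
    show "family (\<lambda>i. if i = j then fsum f else \<zero>)"
      using f(1) by (intro family_single) simp
    show "fsum f = fsum (\<lambda>i. if i = j then fsum f else \<zero>)"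
      using f(1) by (simp add: fsum_single)
  qed (use f j endo endo_zero separated in auto)
  then show ?thesis
    by metis
qed

section \<open>Sums of subspaces and unions of chains\<close>

definition family_sums :: "('i \<Rightarrow> 'v set) \<Rightarrow> 'v set"
  where "family_sums Q = {fsum f | f. family f \<and> (\<forall>i. f i \<in> Q i)}"

lemma family_sumsE:
  assumes "v \<in> family_sums Q"
  obtains f where "family f" "\<And>i. f i \<in> Q i" "v = fsum f"
  using assms by (auto simp: family_sums_def)

lemma family_sumsI: "family f \<Longrightarrow> (\<And>i. f i \<in> Q i) \<Longrightarrow> fsum f \<in> family_sums Q"
  by (auto simp: family_sums_def)

lemma sub_family_sums:
  assumes "\<And>i. sub (Q i)"
  shows "sub (family_sums Q)"
proof (rule subI)
  show "family_sums Q \<subseteq> carrier V"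
    by (auto simp: family_sums_def)
  show "\<zero> \<in> family_sums Q"
    using family_sumsI[of "\<lambda>_. \<zero>" Q] by (simp add: family_zero fsum_zero sub_zero[OF assms])
  show "u \<oplus> w \<in> family_sums Q" if uw: "u \<in> family_sums Q" "w \<in> family_sums Q" for u w
  proof -
    obtain f g where fg: "family f" "\<And>i. f i \<in> Q i" "u = fsum f"
      "family g" "\<And>i. g i \<in> Q i" "w = fsum g"
      using uw by (auto elim!: family_sumsE)
    then show ?thesis
      unfolding family_sums_def using sub_add[OF assms]
      by (auto simp: fsum_add family_add intro!: exI[of _ "\<lambda>i. f i \<oplus> g i"])
  qed
  show "c \<odot> u \<in> family_sums Q" if u: "u \<in> family_sums Q" for c u
  proof -
    obtain f where f: "family f" "\<And>i. f i \<in> Q i" "u = fsum f"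
      using u by (auto elim!: family_sumsE)
    then show ?thesis
      unfolding family_sums_def using sub_scale[OF assms]
      by (auto simp: fsum_scale family_scale intro!: exI[of _ "\<lambda>i. c \<odot> f i"])
  qed
qed

lemma family_sums_superset:
  assumes "\<And>i. sub (Q i)" "v \<in> Q i"
  shows "v \<in> family_sums Q"
proof -
  have "v \<in> carrier V"
    using assms sub_carrier by blast
  then show ?thesis
    unfolding family_sums_def using assms sub_zero[OF assms(1)]
    by (auto simp: family_single fsum_single intro!: exI[of _ "\<lambda>j. if j = i then v else \<zero>"])
qed

lemma sub_Union_chain:
  assumes "\<C> \<noteq> {}" "\<And>U. U \<in> \<C> \<Longrightarrow> sub U" "\<And>U U'. U \<in> \<C> \<Longrightarrow> U' \<in> \<C> \<Longrightarrow> U \<subseteq> U' \<or> U' \<subseteq> U"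
  shows "sub (\<Union>\<C>)"
proof (rule subI)
  show "\<Union>\<C> \<subseteq> carrier V" "\<zero> \<in> \<Union>\<C>"
    using assms(1,2) sub_carrier sub_zero by blast+
  show "u \<oplus> w \<in> \<Union>\<C>" if "u \<in> \<Union>\<C>" "w \<in> \<Union>\<C>" for u w
  proof -
    obtain U U' where "U \<in> \<C>" "U' \<in> \<C>" "u \<in> U" "w \<in> U'"
      using \<open>u \<in> \<Union>\<C>\<close> \<open>w \<in> \<Union>\<C>\<close> by blast
    then show ?thesis
      using assms(2,3) sub_add by blast
  qed
  show "c \<odot> u \<in> \<Union>\<C>" if "u \<in> \<Union>\<C>" for c u
    using that assms(2) sub_scale by blast
qed


subsection \<open>Cosets\<close>

lemma coset_eq_iff:
  assumes "sub W" "u \<in> carrier V" "v \<in> carrier V"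
  shows "W +> u = W +> v \<longleftrightarrow> u \<ominus> v \<in> W"
proof
  assume "W +> u = W +> v"
  moreover have "u = \<zero> \<oplus> u"
    using assms by simp
  then have "u \<in> W +> u"
    using sub_zero[OF assms(1)] unfolding a_r_coset_def' by blast
  ultimately obtain w where "w \<in> W" "u = w \<oplus> v"
    by (auto simp: a_r_coset_def')
  moreover from this have "u \<ominus> v = w"
    using assms sub_carrier by (auto simp: M.minus_eq M.a_assoc M.r_neg)
  ultimately show "u \<ominus> v \<in> W"
    by simp
next
  have *: "W +> u \<subseteq> W +> v" if "u \<ominus> v \<in> W" "u \<in> carrier V" "v \<in> carrier V" for u v
  proof
    fix x assume "x \<in> W +> u"
    then obtain w where w: "w \<in> W" "x = w \<oplus> u"
      by (auto simp: a_r_coset_def')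
    have "w \<in> carrier V"
      using w assms sub_carrier by blast
    then have "x = (w \<oplus> (u \<ominus> v)) \<oplus> v"
      using w that by (simp add: M.minus_eq M.a_assoc M.l_neg)
    moreover have "w \<oplus> (u \<ominus> v) \<in> W"
      using w that assms by (simp add: sub_add)
    ultimately show "x \<in> W +> v"
      by (auto simp: a_r_coset_def')
  qed
  assume a: "u \<ominus> v \<in> W"
  have "v \<ominus> u = \<ominus> (u \<ominus> v)"
    using assms by (simp add: M.minus_eq M.minus_add M.a_comm)
  then have "v \<ominus> u \<in> W"
    using sub_neg[OF assms(1) a] by simp
  then show "W +> u = W +> v"
    using *[of u v] *[of v u] a assms by auto
qed

lemma coset_elem:
  assumes "sub W" "u \<in> carrier V" "x \<in> W +> u"
  shows "x \<in> carrier V" "W +> x = W +> u"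
proof -
  obtain w where w: "w \<in> W" "x = w \<oplus> u"
    using assms by (auto simp: a_r_coset_def')
  have "w \<in> carrier V"
    using w assms sub_carrier by blast
  then have "x \<ominus> u = w"
    using w assms by (simp add: M.minus_eq M.a_assoc M.r_neg)
  then show "x \<in> carrier V" "W +> x = W +> u"
    using w assms \<open>w \<in> carrier V\<close> by (simp_all add: coset_eq_iff)
qed

lemma coset_self:
  assumes "sub W" "u \<in> carrier V"
  shows "u \<in> W +> u"
proof -
  have "u = \<zero> \<oplus> u"
    using assms by simp
  then show ?thesis
    using sub_zero[OF assms(1)] unfolding a_r_coset_def' by blast
qed

text \<open>In \<open>quotient_lie_mod\<close> an operator acts on a coset by a union over its
  representatives. If the operator preserves \<open>W\<close>, all representatives yield the same
  coset and the union collapses.\<close>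

lemma coset_Union:
  assumes "sub W" "u \<in> carrier V" "endo T" "\<And>w. w \<in> W \<Longrightarrow> T w \<in> W"
  shows "(\<Union>x\<in>W +> u. W +> T x) = W +> T u"
proof -
  have "W +> T x = W +> T u" if "x \<in> W +> u" for x
  proof -
    have x: "x \<in> carrier V" "x \<ominus> u \<in> W"
      using coset_elem[OF assms(1,2) that] coset_eq_iff assms by auto
    then have "T x \<ominus> T u \<in> W"
      using assms(4)[of "x \<ominus> u"] assms(2,3) by (simp add: endo_diff)
    then show ?thesis
      using x assms by (simp add: coset_eq_iff endo_closed)
  qed
  then show ?thesis
    using coset_self[OF assms(1,2)] by blast
qed

lemma coset_add:
  assumes "sub W" "u \<in> carrier V" "v \<in> carrier V"
  shows "set_add V (W +> u) (W +> v) = W +> (u \<oplus> v)"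
proof -
  have "subgroup W (add_monoid V)"
    using assms(1) by (simp add: submodule_def)
  then have "additive_subgroup W V"
    by (rule additive_subgroup.intro)
  then have "abelian_subgroup W V"
    by (intro abelian_subgroupI3 M.abelian_group_axioms)
  then show ?thesis
    using assms(2,3) by (rule abelian_subgroup.a_rcos_sum)
qed

end

section \<open>Quotients of Lie modules\<close>

locale quotient_space = cspace V for V :: "('l, 'v) lie_mod" (structure) +
  fixes W :: "'v set"
  assumes sub_W: "sub W"
begin

abbreviation proj :: "'v \<Rightarrow> 'v set"
  where "proj v \<equiv> W +> v"

abbreviation Q :: "('l, 'v set) lie_mod"
  where "Q \<equiv> quotient_lie_mod V W"

lemma carrier_Q: "carrier Q = proj ` carrier V"
  by (auto simp: quotient_lie_mod_def A_RCOSETS_def')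

lemma proj_in_Q [simp]: "v \<in> carrier V \<Longrightarrow> proj v \<in> carrier Q"
  by (simp add: carrier_Q)

lemma zero_Q: "zero Q = proj \<zero>"
proof -
  have "W +> \<zero> = W"
    using sub_subset[OF sub_W] by (rule M.a_coset_add_zero)
  then show ?thesis
    by (simp add: quotient_lie_mod_def)
qed

lemma add_Q: "u \<in> carrier V \<Longrightarrow> v \<in> carrier V \<Longrightarrow> proj u \<oplus>\<^bsub>Q\<^esub> proj v = proj (u \<oplus> v)"
  using coset_add[OF sub_W] by (simp add: quotient_lie_mod_def)

lemma scale_Q: "v \<in> carrier V \<Longrightarrow> c \<odot>\<^bsub>Q\<^esub> proj v = proj (c \<odot> v)"
  using coset_Union[OF sub_W _ endo_scaling, of v c] sub_scale[OF sub_W]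
  by (simp add: quotient_lie_mod_def)

lemma act_Q:
  assumes "endo (act V x)" "\<And>w. w \<in> W \<Longrightarrow> act V x w \<in> W" "v \<in> carrier V"
  shows "act Q x (proj v) = proj (act V x v)"
  using coset_Union[OF sub_W assms(3,1,2)] by (simp add: quotient_lie_mod_def)

lemma proj_eq_iff:
  "u \<in> carrier V \<Longrightarrow> v \<in> carrier V \<Longrightarrow> proj u = proj v \<longleftrightarrow> u \<ominus> v \<in> W"
  using coset_eq_iff[OF sub_W] .

lemma proj_eq_zero_iff: "v \<in> carrier V \<Longrightarrow> proj v = zero Q \<longleftrightarrow> v \<in> W"
  using proj_eq_iff[of v "\<zero>"] by (simp add: zero_Q diff_zero)

lemma abelian_group_Q: "abelian_group Q"
proof (rule abelian_groupI)
  show "\<zero>\<^bsub>Q\<^esub> \<in> carrier Q"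
    by (simp add: zero_Q)
  fix x y z assume "x \<in> carrier Q" "y \<in> carrier Q" "z \<in> carrier Q"
  then obtain u v w where
    "u \<in> carrier V" "x = proj u" "v \<in> carrier V" "y = proj v" "w \<in> carrier V" "z = proj w"
    by (auto simp: carrier_Q)
  then show "x \<oplus>\<^bsub>Q\<^esub> y \<in> carrier Q" "(x \<oplus>\<^bsub>Q\<^esub> y) \<oplus>\<^bsub>Q\<^esub> z = x \<oplus>\<^bsub>Q\<^esub> (y \<oplus>\<^bsub>Q\<^esub> z)"
    "x \<oplus>\<^bsub>Q\<^esub> y = y \<oplus>\<^bsub>Q\<^esub> x" "\<zero>\<^bsub>Q\<^esub> \<oplus>\<^bsub>Q\<^esub> x = x"
    by (simp_all add: add_Q zero_Q M.a_ac)
next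
  fix x assume "x \<in> carrier Q"
  then obtain u where u: "u \<in> carrier V" "x = proj u"
    by (auto simp: carrier_Q)
  show "\<exists>y\<in>carrier Q. y \<oplus>\<^bsub>Q\<^esub> x = \<zero>\<^bsub>Q\<^esub>"
    by (rule bexI[of _ "proj (\<ominus> u)"]) (use u in \<open>simp_all add: add_Q zero_Q M.l_neg\<close>)
qed

lemma module_Q: "module complex_field Q"
proof (rule moduleI[OF _ abelian_group_Q])
  show "cring complex_field"
    by (rule cring_from_type_algebra)
  fix a b x y assume "x \<in> carrier Q" "y \<in> carrier Q"
  then obtain u v where
    "u \<in> carrier V" "x = proj u" "v \<in> carrier V" "y = proj v"
    by (auto simp: carrier_Q)
  then show "a \<odot>\<^bsub>Q\<^esub> x \<in> carrier Q"
    and "(a \<oplus>\<^bsub>complex_field\<^esub> b) \<odot>\<^bsub>Q\<^esub> x = a \<odot>\<^bsub>Q\<^esub> x \<oplus>\<^bsub>Q\<^esub> b \<odot>\<^bsub>Q\<^esub> x"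
    and "a \<odot>\<^bsub>Q\<^esub> (x \<oplus>\<^bsub>Q\<^esub> y) = a \<odot>\<^bsub>Q\<^esub> x \<oplus>\<^bsub>Q\<^esub> a \<odot>\<^bsub>Q\<^esub> y"
    and "(a \<otimes>\<^bsub>complex_field\<^esub> b) \<odot>\<^bsub>Q\<^esub> x = a \<odot>\<^bsub>Q\<^esub> (b \<odot>\<^bsub>Q\<^esub> x)"
    and "\<one>\<^bsub>complex_field\<^esub> \<odot>\<^bsub>Q\<^esub> x = x"
    by (simp_all add: scale_Q add_Q scale_add scale_add_right)
qed

sublocale Q: cspace Q
  by (rule cspace.intro) (rule module_Q)

lemma diff_Q:
  assumes "u \<in> carrier V" "v \<in> carrier V"
  shows "proj u \<ominus>\<^bsub>Q\<^esub> proj v = proj (u \<ominus> v)"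
proof -
  have "\<ominus>\<^bsub>Q\<^esub> proj v = proj (\<ominus> v)"
    using assms Q.scale_minus_one[of "proj v"] by (simp add: scale_Q scale_minus_one)
  then show ?thesis
    using assms by (simp add: add_Q Q.M.minus_eq M.minus_eq)
qed

lemma sub_proj_vimage:
  assumes "Q.sub N"
  shows "sub {v \<in> carrier V. proj v \<in> N}"
  by (rule subI) (use assms Q.sub_zero Q.sub_add Q.sub_scale in
      \<open>auto simp: zero_Q[symmetric] add_Q[symmetric] scale_Q[symmetric]\<close>)

end

section \<open>Lie submodules and quotient modules\<close>

lemma endo_act:
  assumes "lie_module sc br L V" "x \<in> L"
  shows "cspace.endo V (act V x)"
proof -
  interpret cspace V
    by (rule cspace.intro) (use assms(1) in \<open>simp add: lie_module_def\<close>)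
  show ?thesis
    using assms unfolding endo_def lie_module_def by blast
qed

lemma lie_submodule_sub: "lie_submodule L W V \<Longrightarrow> submodule W complex_field V"
  by (simp add: lie_submodule_def)

lemma lie_submodule_act: "lie_submodule L W V \<Longrightarrow> x \<in> L \<Longrightarrow> w \<in> W \<Longrightarrow> act V x w \<in> W"
  by (simp add: lie_submodule_def)

lemma lie_module_subset:
  "lie_module sc br L V \<Longrightarrow> L' \<subseteq> L \<Longrightarrow> lie_module sc br L' V"
  unfolding lie_module_def by blast

lemma act_in_quotient:
  assumes "lie_module sc br L V" "lie_submodule L W V" "x \<in> L" "v \<in> carrier V"
  shows "act (quotient_lie_mod V W) x (W +>\<^bsub>V\<^esub> v) = W +>\<^bsub>V\<^esub> act V x v"
proof -
  interpret cspace V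
    by (rule cspace.intro) (use assms(1) in \<open>simp add: lie_module_def\<close>)
  interpret quotient_space V W
    by (intro quotient_space.intro quotient_space_axioms.intro cspace_axioms lie_submodule_sub[OF assms(2)])
  show ?thesis
    using endo_act[OF assms(1,3)] lie_submodule_act[OF assms(2,3)] assms(4) by (rule act_Q)
qed

lemma lie_module_quotient:
  assumes V: "lie_module sc br L V" and W: "lie_submodule L W V"
    and closed: "\<And>x y. x \<in> L \<Longrightarrow> y \<in> L \<Longrightarrow> x + y \<in> L" "\<And>c x. x \<in> L \<Longrightarrow> sc c x \<in> L"
      "\<And>x y. x \<in> L \<Longrightarrow> y \<in> L \<Longrightarrow> br x y \<in> L"
  shows "lie_module sc br L (quotient_lie_mod V W)"
proof -
  interpret cspace V
    by (rule cspace.intro) (use V in \<open>simp add: lie_module_def\<close>)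
  interpret quotient_space V W
    by (intro quotient_space.intro quotient_space_axioms.intro cspace_axioms lie_submodule_sub[OF W])
  note act = act_in_quotient[OF V W]
  have cl: "act V x v \<in> carrier V" if "x \<in> L" "v \<in> carrier V" for x v
    using endo_act[OF V] that endo_closed by blast
  show ?thesis
    unfolding lie_module_def
  proof (intro conjI ballI allI)
    show "module complex_field Q"
      by (rule module_Q)
    fix x C assume x: "x \<in> L" and C: "C \<in> carrier Q"
    obtain v where v: "v \<in> carrier V" "C = proj v"
      using C by (auto simp: carrier_Q)
    show "act Q x C \<in> carrier Q"
      using x v by (simp add: act cl)
    show "act Q x (C \<oplus>\<^bsub>Q\<^esub> C') = act Q x C \<oplus>\<^bsub>Q\<^esub> act Q x C'" if "C' \<in> carrier Q" for C'
      using x v that endo_act[OF V x] cl by (auto simp: carrier_Q act add_Q endo_add)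
    show "act Q x (c \<odot>\<^bsub>Q\<^esub> C) = c \<odot>\<^bsub>Q\<^esub> act Q x C" for c
      using x v endo_act[OF V x] cl by (auto simp: act scale_Q endo_scale)
    show "act Q (sc c x) C = c \<odot>\<^bsub>Q\<^esub> act Q x C" for c
    proof -
      have "act V (sc c x) v = c \<odot>\<^bsub>V\<^esub> act V x v"
        using V x v(1) unfolding lie_module_def by blast
      then show ?thesis
        using x v closed(2) cl by (simp add: act scale_Q)
    qed
    fix y assume y: "y \<in> L"
    have *: "act V (x + y) v = act V x v \<oplus>\<^bsub>V\<^esub> act V y v"
      "act V (br x y) v = act V x (act V y v) \<ominus>\<^bsub>V\<^esub> act V y (act V x v)"
      using V x y v(1) unfolding lie_module_def by blast+
    show "act Q (x + y) C = act Q x C \<oplus>\<^bsub>Q\<^esub> act Q y C"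
      using x y v closed(1) cl * by (simp add: act add_Q)
    show "act Q (br x y) C = act Q x (act Q y C) \<ominus>\<^bsub>Q\<^esub> act Q y (act Q x C)"
      using x y v closed(3) cl * by (simp add: act diff_Q)
  qed
qed

text \<open>Preimages turn submodules of the quotient into submodules between \<open>W\<close> and
  \<open>carrier V\<close>, and maximality leaves only the two ends.\<close>

lemma irreducible_quotient:
  assumes V: "lie_module sc br L V" and W: "maximal_lie_submodule L W V"
    and closed: "\<And>x y. x \<in> L \<Longrightarrow> y \<in> L \<Longrightarrow> x + y \<in> L" "\<And>c x. x \<in> L \<Longrightarrow> sc c x \<in> L"
      "\<And>x y. x \<in> L \<Longrightarrow> y \<in> L \<Longrightarrow> br x y \<in> L"
  shows "irreducible_lie_module sc br L (quotient_lie_mod V W)"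
proof -
  have LW: "lie_submodule L W V" and neq: "W \<noteq> carrier V"
    and max: "\<And>U. lie_submodule L U V \<Longrightarrow> W \<subseteq> U \<Longrightarrow> U = W \<or> U = carrier V"
    using W unfolding maximal_lie_submodule_def by blast+
  interpret cspace V
    by (rule cspace.intro) (use V in \<open>simp add: lie_module_def\<close>)
  interpret quotient_space V W
    by (intro quotient_space.intro quotient_space_axioms.intro cspace_axioms lie_submodule_sub[OF LW])
  note act = act_in_quotient[OF V LW]
  have W_sub: "W \<subseteq> carrier V"
    using sub_subset[OF sub_W] .
  have "carrier Q \<noteq> {zero Q}"
  proof
    assume *: "carrier Q = {zero Q}"
    have "v \<in> W" if "v \<in> carrier V" for v
      using proj_in_Q[OF that] proj_eq_zero_iff[OF that] unfolding * by simp
    then show False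
      using neq W_sub by blast
  qed
  moreover have "N = {zero Q} \<or> N = carrier Q" if N: "lie_submodule L N Q" for N
  proof -
    let ?U = "{v \<in> carrier V. proj v \<in> N}"
    have subN: "Q.sub N"
      using lie_submodule_sub[OF N] .
    have NQ: "N \<subseteq> carrier Q"
      using Q.sub_subset[OF subN] .
    have N_eq: "N = proj ` ?U"
      using NQ by (auto simp: carrier_Q)
    have "act V x u \<in> ?U" if "x \<in> L" "u \<in> ?U" for x u
      using that endo_act[OF V that(1)] lie_submodule_act[OF N that(1), of "proj u"]
      by (auto simp: act endo_closed)
    then have "lie_submodule L ?U V"
      using sub_proj_vimage[OF subN] by (simp add: lie_submodule_def)
    moreover have "W \<subseteq> ?U"
    proof
      fix w assume "w \<in> W"
      then have "w \<in> carrier V" "proj w = zero Q"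
        using W_sub proj_eq_zero_iff by auto
      then show "w \<in> ?U"
        using Q.sub_zero[OF subN] by simp
    qed
    ultimately consider "?U = W" | "?U = carrier V"
      using max by blast
    then show ?thesis
    proof cases
      case 1
      have "proj w = zero Q" if "w \<in> W" for w
        using that W_sub proj_eq_zero_iff by auto
      then have "N = {zero Q}"
        using N_eq[unfolded 1] sub_zero[OF sub_W] by auto
      then show ?thesis ..
    next
      case 2
      show ?thesis
        using N_eq[unfolded 2] carrier_Q by simp
    qed
  qed
  ultimately show ?thesis
    using lie_module_quotient[OF V LW closed] by (simp add: irreducible_lie_module_def)
qed

section \<open>The Lie algebra \<open>J \<oplus> D\<close>\<close>

subsection \<open>Closure properties\<close>

definition J_part :: "nat \<Rightarrow> 'g::ab_group_add loop set"
  where "J_part n = {F. Poly_Mapping.keys F \<subseteq> A_expo n}"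

lemma JD_eq: "JD n k = J_part n \<times> D_part n k"
  by (simp add: JD_def J_part_def)

lemma A_expo_add: "m \<in> A_expo n \<Longrightarrow> l \<in> A_expo n \<Longrightarrow> m + l \<in> A_expo n"
  using keys_add[of m l] by (auto simp: A_expo_def)

lemma zero_A_expo: "0 \<in> A_expo n"
  by (simp add: A_expo_def)

lemma J_part_zero: "0 \<in> J_part n"
  by (simp add: J_part_def)

lemma J_part_add: "F \<in> J_part n \<Longrightarrow> G \<in> J_part n \<Longrightarrow> F + G \<in> J_part n"
  using keys_add[of F G] by (auto simp: J_part_def)

lemma J_part_diff: "F \<in> J_part n \<Longrightarrow> G \<in> J_part n \<Longrightarrow> F - G \<in> J_part n"
  by (auto simp: J_part_def in_keys_iff lookup_minus) (metis diff_zero in_keys_iff subsetD)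

lemma J_part_sum: "(\<And>i. i \<in> A \<Longrightarrow> f i \<in> J_part n) \<Longrightarrow> sum f A \<in> J_part n"
  by (induction A rule: infinite_finite_induct) (auto simp: J_part_zero J_part_add)

lemma J_part_single: "m \<in> A_expo n \<Longrightarrow> Poly_Mapping.single m G \<in> J_part n"
  by (simp add: J_part_def)

lemma keys_map_subset: "Poly_Mapping.keys (Poly_Mapping.map f F) \<subseteq> Poly_Mapping.keys F"
  by (auto simp: in_keys_iff map.rep_eq when_def split: if_splits)

lemma J_part_scale: "F \<in> J_part n \<Longrightarrow> loop_scale sc c F \<in> J_part n"
  using keys_map_subset[of "aff_scale sc c" F] by (auto simp: J_part_def loop_scale_def)

lemma J_part_bracket:
  "F \<in> J_part n \<Longrightarrow> G \<in> J_part n \<Longrightarrow> loop_bracket br form F G \<in> J_part n"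
  unfolding loop_bracket_def
  by (intro J_part_sum J_part_single A_expo_add) (auto simp: J_part_def)

lemma J_part_D_action: "F \<in> J_part n \<Longrightarrow> D_action N sc d F \<in> J_part n"
  unfolding D_action_def loop_deriv_def
  by (intro J_part_sum J_part_scale J_part_single) (auto simp: J_part_def)

lemma D_part_zero: "0 \<in> D_part n k"
  by (simp add: D_part_def)

lemma D_part_add: "d \<in> D_part n k \<Longrightarrow> e \<in> D_part n k \<Longrightarrow> d + e \<in> D_part n k"
  using keys_add[of d e] by (auto simp: D_part_def)

lemma D_part_scale: "d \<in> D_part n k \<Longrightarrow> Poly_Mapping.map ((*) c) d \<in> D_part n k"
  using keys_map_subset[of "(*) c" d] by (auto simp: D_part_def)

lemma JD_add: "x \<in> JD n k \<Longrightarrow> y \<in> JD n k \<Longrightarrow> x + y \<in> JD n k"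
  by (auto simp: JD_eq J_part_add D_part_add)

lemma JD_scale_closed: "x \<in> JD n k \<Longrightarrow> JD_scale sc c x \<in> JD n k"
  by (auto simp: JD_eq JD_scale_def J_part_scale D_part_scale)

lemma JD_bracket_closed:
  "x \<in> JD n k \<Longrightarrow> y \<in> JD n k \<Longrightarrow> JD_bracket N sc br form x y \<in> JD n k"
  by (auto simp: JD_eq JD_bracket_def J_part_add J_part_diff J_part_bracket J_part_D_action
      D_part_zero)

lemma JD_mono: "k \<le> l \<Longrightarrow> JD n l \<subseteq> JD n k"
  by (fastforce simp: JD_def D_part_def)

lemma JD_loop: "F \<in> J_part n \<Longrightarrow> (F, 0) \<in> JD n k"
  by (simp add: JD_eq D_part_zero)

lemma d_elt_JD: "i \<in> {k+1..n} \<Longrightarrow> d_elt i \<in> JD n k"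
  by (simp add: JD_eq d_elt_def J_part_zero D_part_def)

lemma K_elt_JD: "m \<in> A_expo n \<Longrightarrow> K_elt m \<in> JD n k"
  unfolding K_elt_def by (intro JD_loop J_part_single)


subsection \<open>Generators\<close>

lemma poly_mapping_sum_single:
  "(\<Sum>a\<in>Poly_Mapping.keys p. Poly_Mapping.single a (Poly_Mapping.lookup p a)) = p"
proof (rule poly_mapping_eqI)
  fix b
  have "Poly_Mapping.lookup (\<Sum>a\<in>A. Poly_Mapping.single a (Poly_Mapping.lookup p a)) b =
      (\<Sum>a\<in>A. if a = b then Poly_Mapping.lookup p a else 0)" for A
    by (induction A rule: infinite_finite_induct) (auto simp: lookup_add lookup_single when_def)
  then show "Poly_Mapping.lookup (\<Sum>a\<in>Poly_Mapping.keys p.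
      Poly_Mapping.single a (Poly_Mapping.lookup p a)) b = Poly_Mapping.lookup p b"
    by (simp add: in_keys_iff)
qed

lemma map_zero [simp]: "Poly_Mapping.map f 0 = 0"
  by (rule poly_mapping_eqI) (simp add: map.rep_eq)

lemma loop_scale_zero [simp]: "loop_scale sc c 0 = 0"
  by (simp add: loop_scale_def)

lemma JD_scale_d_elt: "JD_scale sc c (d_elt i) = (0, Poly_Mapping.single i c)"
proof -
  have "Poly_Mapping.map ((*) c) (Poly_Mapping.single i 1) = Poly_Mapping.single i c"
    by (rule poly_mapping_eqI) (auto simp: map.rep_eq lookup_single when_def)
  then show ?thesis
    by (simp add: JD_scale_def d_elt_def)
qed

lemma sum_induct_closed:
  assumes "P 0" "\<And>x y. P x \<Longrightarrow> P y \<Longrightarrow> P (x + y)" "\<And>i. i \<in> A \<Longrightarrow> P (f i)"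
  shows "P (sum f A)"
  using assms(3) by (induction A rule: infinite_finite_induct) (auto simp: assms(1,2))

text \<open>The brackets are known on monomials and on the \<open>d_elt i\<close>; statements that
  are additive in the Lie algebra element reduce to these.\<close>

lemma JD_induct [consumes 1, case_names loop d add]:
  assumes x: "x \<in> JD n k"
    and loop: "\<And>m G. m \<in> A_expo n \<Longrightarrow> P (Poly_Mapping.single m G, 0)"
    and d: "\<And>c i. i \<in> {k+1..n} \<Longrightarrow> P (JD_scale sc c (d_elt i))"
    and add: "\<And>x y. x \<in> JD n k \<Longrightarrow> y \<in> JD n k \<Longrightarrow> P x \<Longrightarrow> P y \<Longrightarrow> P (x + y)"
  shows "P x"
proof -
  \<comment> \<open>Membership is carried along because \<open>add\<close> asks for it in both
    summands.\<close>
  let ?P = "\<lambda>x. x \<in> JD n k \<and> P x"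
  obtain F e where Fe: "x = (F, e)" "F \<in> J_part n" "e \<in> D_part n k"
    using x by (auto simp: JD_eq)
  have "?P 0"
    using loop[OF zero_A_expo, of 0] JD_loop[OF J_part_zero, of n k]
    by (simp flip: zero_prod_def)
  have F: "?P (\<Sum>m\<in>Poly_Mapping.keys F. Poly_Mapping.single m (Poly_Mapping.lookup F m), 0)"
  proof (rule sum_induct_closed[where P = "\<lambda>F. ?P (F, 0)"])
    show "?P (0, 0)"
      using \<open>?P 0\<close> by (simp add: zero_prod_def)
    show "?P (F + G, 0)" if "?P (F, 0)" "?P (G, 0)" for F G
      using that add[of "(F, 0)" "(G, 0)"] JD_add[of "(F, 0)" n k "(G, 0)"] by simp
    show "?P (Poly_Mapping.single m (Poly_Mapping.lookup F m), 0)" if "m \<in> Poly_Mapping.keys F" for m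
    proof -
      have "m \<in> A_expo n"
        using that Fe(2) by (auto simp: J_part_def)
      then show ?thesis
        using loop JD_loop J_part_single by blast
    qed
  qed
  have e: "?P (0, \<Sum>i\<in>Poly_Mapping.keys e. Poly_Mapping.single i (Poly_Mapping.lookup e i))"
  proof (rule sum_induct_closed[where P = "\<lambda>e. ?P (0, e)"])
    show "?P (0, 0)"
      using \<open>?P 0\<close> by (simp add: zero_prod_def)
    show "?P (0, d + e)" if "?P (0, d)" "?P (0, e)" for d e
    proof -
      have "?P ((0, d) + (0, e))"
        using that add JD_add by blast
      then show ?thesis
        by simp
    qed
    show "?P (0, Poly_Mapping.single i (Poly_Mapping.lookup e i))" if "i \<in> Poly_Mapping.keys e" for i
    proof -
      have "i \<in> {k+1..n}"
        using that Fe(3) unfolding D_part_def by blast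
      then show ?thesis
        using d[of i] d_elt_JD[of i k n] JD_scale_closed[of "d_elt i" n k sc]
        unfolding JD_scale_d_elt by blast
    qed
  qed
  have "P ((F, 0) + (0, e))"
    using F e add unfolding poly_mapping_sum_single by blast
  then show ?thesis
    by (simp add: Fe)
qed


subsection \<open>Brackets\<close>

lemma bracket_K_elt_loop: "JD_bracket n sc br form (F, 0) (K_elt m) = 0"
proof -
  have "aff_bracket br form G (0, 1) = 0" for G
    by (simp add: aff_bracket_def)
  then have "loop_bracket br form F (Poly_Mapping.single m (0, 1)) = 0"
    by (simp add: loop_bracket_def)
  then show ?thesis
    by (simp add: JD_bracket_def K_elt_def D_action_def zero_prod_def)
qed

lemma bracket_d_d: "JD_bracket n sc br form (0, d) (0, e) = 0"
proof -
  have "D_action n sc a 0 = 0" for a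
    by (simp add: D_action_def loop_deriv_def)
  then show ?thesis
    by (simp add: JD_bracket_def loop_bracket_def zero_prod_def)
qed

lemma bracket_d_loop:
  "JD_bracket n sc br form (d_elt i) (F, 0) = (D_action n sc (Poly_Mapping.single i 1) F, 0)"
  by (simp add: JD_bracket_def d_elt_def loop_bracket_def D_action_def)

lemma D_action_single:
  assumes "lie_algebra sc br"
  shows "D_action n sc (Poly_Mapping.single i 1) F = loop_deriv n sc i F"
proof -
  interpret lie_algebra sc br by fact
  have "Poly_Mapping.map (sc 1) G = G" for G
    by (rule poly_mapping_eqI) (simp add: map.rep_eq when_def)
  then have "aff_scale sc 1 G = G" for G
    by (simp add: aff_scale_def prod_eq_iff)
  then have "loop_scale sc 1 F = F" for F
    unfolding loop_scale_def by (intro poly_mapping_eqI) (simp add: map.rep_eq when_def)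
  then show ?thesis
    by (simp add: D_action_def)
qed

lemma loop_scale_single:
  "loop_scale sc c (Poly_Mapping.single m G) = Poly_Mapping.single m (aff_scale sc c G)"
proof -
  have "aff_scale sc c 0 = 0"
    by (simp add: aff_scale_def zero_prod_def)
  then show ?thesis
    unfolding loop_scale_def
    by (intro poly_mapping_eqI) (auto simp: map.rep_eq lookup_single when_def)
qed

text \<open>For \<open>i = n\<close> the derivation acts inside the coefficient \<open>G\<close>,
  which need not be homogeneous; the other derivations see only the exponent
  \<open>m\<close>.\<close>

lemma bracket_d_single:
  assumes "lie_algebra sc br" "i \<noteq> n"
  shows "JD_bracket n sc br form (d_elt i) (Poly_Mapping.single m G, 0) =
    JD_scale sc (of_int (Poly_Mapping.lookup m i)) (Poly_Mapping.single m G, 0)"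
proof -
  have "loop_deriv n sc i (Poly_Mapping.single m G) =
      loop_scale sc (of_int (Poly_Mapping.lookup m i)) (Poly_Mapping.single m G)"
  proof (cases "G = 0")
    case True
    then show ?thesis
      by (simp add: loop_deriv_def)
  next
    case False
    then show ?thesis
      using assms(2) by (simp add: loop_deriv_def loop_scale_single)
  qed
  then show ?thesis
    by (simp add: bracket_d_loop D_action_single[OF assms(1)] JD_scale_def)
qed

lemma bracket_d_K_elt:
  assumes "lie_algebra sc br"
  shows "JD_bracket n sc br form (d_elt i) (K_elt m) =
    JD_scale sc (if i = n then 0 else of_int (Poly_Mapping.lookup m i)) (K_elt m)"
proof (cases "i = n")
  case True
  have "aff_scale sc 0 (0, 1) = 0"
    by (simp add: aff_scale_def zero_prod_def)
  moreover have "loop_deriv n sc n (Poly_Mapping.single m (0, 1)) = 0"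
    by (simp add: loop_deriv_def aff_deriv_def zero_prod_def[symmetric])
  ultimately show ?thesis
    using True
    by (simp add: K_elt_def bracket_d_loop D_action_single[OF assms] JD_scale_def
        loop_scale_single)
next
  case False
  then show ?thesis
    unfolding K_elt_def using bracket_d_single[OF assms False] by simp
qed


section \<open>Operators that shift eigenvalues\<close>

context cspace
begin

lemma eigenspace_sub:
  assumes "endo T"
  shows "sub {v \<in> carrier V. T v = c \<odot> v}"
  by (rule subI) (use assms in
      \<open>auto simp: endo_zero endo_add endo_scale scale_add_right mult.commute\<close>)

lemma sub_endo_image:
  assumes T: "endo T" and U: "sub U"
  shows "sub (T ` U)"
proof (rule subI)
  have cl: "u \<in> carrier V" if "u \<in> U" for u
    using that sub_carrier[OF U] by blast
  show "T ` U \<subseteq> carrier V"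
    using T cl endo_closed by blast
  show "\<zero> \<in> T ` U"
    using endo_zero[OF T] sub_zero[OF U] by force
  show "u \<oplus> w \<in> T ` U" if "u \<in> T ` U" "w \<in> T ` U" for u w
    using that cl sub_add[OF U] by (auto simp flip: endo_add[OF T])
  show "c \<odot> u \<in> T ` U" if "u \<in> T ` U" for c u
    using that cl sub_scale[OF U] by (auto simp flip: endo_scale[OF T])
qed

text \<open>Modulo \<open>U\<close>, the component of \<open>z w - w\<close> at the largest shifted eigenvalue comes from
  \<open>z w\<close> alone and the one at the smallest eigenvalue from \<open>w\<close> alone, so that \<open>z w - w\<close> can
  only be an eigenvector if it vanishes.\<close>

lemma eigenvector_in_shift_image:
  assumes d: "endo d" and z: "endo z" and \<kappa>: "Re \<kappa> > 0"
    and shift: "\<And>v. v \<in> carrier V \<Longrightarrow> d (z v) = z (d v) \<oplus> \<kappa> \<odot> z v"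
    and U: "sub U" "\<And>u. u \<in> U \<Longrightarrow> d u \<in> U" "\<And>u. u \<in> U \<Longrightarrow> z u \<in> U"
      "\<And>u. u \<in> carrier V \<Longrightarrow> z u \<in> U \<Longrightarrow> u \<in> U"
    and w: "w \<in> family_sums (\<lambda>c. {v \<in> carrier V. d v = c \<odot> v})"
    and v: "v \<in> carrier V" "d v = b \<odot> v" "v \<ominus> (z w \<ominus> w) \<in> U"
  shows "v \<in> U"
proof -
  obtain f where f: "family f" "\<And>c. d (f c) = c \<odot> f c" "w = fsum f"
    using w by (auto elim!: family_sumsE)
  have cl: "f c \<in> carrier V" "z (f c) \<in> carrier V" for c
    using f(1) z by (simp_all add: familyD endo_closed)
  have wcl: "w \<in> carrier V" "z w \<in> carrier V"
    using f z by (simp_all add: endo_closed)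
  have bij: "bij (\<lambda>c. c - \<kappa>)"
    by (rule bij_betw_byWitness[where f' = "\<lambda>c. c + \<kappa>"]) auto
  have fz: "family (\<lambda>c. z (f (c - \<kappa>)))" "fsum (\<lambda>c. z (f (c - \<kappa>))) = z w"
    using family_endo[OF z family_reindex[OF f(1) bij]] fsum_endo[OF z family_reindex[OF f(1) bij]]
      fsum_reindex[OF f(1) bij] f(3) by simp_all
  have dz: "d (z (f (c - \<kappa>))) = c \<odot> z (f (c - \<kappa>))" for c
  proof -
    have "d (z (f (c - \<kappa>))) = (c - \<kappa>) \<odot> z (f (c - \<kappa>)) \<oplus> \<kappa> \<odot> z (f (c - \<kappa>))"
      using shift[OF cl(1)] f(2) z cl by (simp add: endo_scale)
    also have "\<dots> = c \<odot> z (f (c - \<kappa>))"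
      using scale_add[OF cl(2), of "c - \<kappa>" \<kappa> "c - \<kappa>"] by simp
    finally show ?thesis .
  qed
  define e where "e c = (if c = b then v else \<zero>)" for c
  have e: "family e" "fsum e = v" "e c \<in> carrier V" "d (e c) = c \<odot> e c" for c
    unfolding e_def using v d by (auto simp: family_single fsum_single endo_zero)
  \<comment> \<open>\<open>g c\<close> is the component of
    \<open>v \<ominus> (z w \<ominus> w)\<close> at the eigenvalue \<open>c\<close>. Since that
    vector lies in the \<open>d\<close>-stable subspace \<open>U\<close>, so does every
    \<open>g c\<close>.\<close>
  define g where "g c = e c \<ominus> (z (f (c - \<kappa>)) \<ominus> f c)" for c
  have g: "family g" "fsum g = v \<ominus> (z w \<ominus> w)"
    unfolding g_def using e f fz by (simp_all add: family_diff fsum_diff)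
  have gU: "g c \<in> U" for c
  proof (rule eigenvectors_independent[where H = UNIV and T = "\<lambda>_::unit. d" and e = "\<lambda>c _. c"])
    show "d (g c) = c \<odot> g c" for c
      unfolding g_def using d e cl dz f(2) by (simp add: endo_diff scale_diff_right)
  qed (use U d g v in auto)
  let ?F = "{c. f c \<notin> U}"
  have "?F \<subseteq> {c. f c \<noteq> \<zero>}"
    using sub_zero[OF U(1)] by auto
  then have fin: "finite ?F"
    using f(1) finite_subset by (auto simp: family_def)
  \<comment> \<open>As \<open>g c\<close> lies in \<open>U\<close>, any two of \<open>e c\<close>,
    \<open>z (f (c - \<kappa>))\<close> and \<open>f c\<close> in \<open>U\<close> force the third
    into \<open>U\<close>. In the first case \<open>z\<close> is then cancelled, using that
    \<open>z u \<in> U\<close> implies \<open>u \<in> U\<close>.\<close>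
  have split: "e c \<in> U \<and> f c \<in> U \<Longrightarrow> f (c - \<kappa>) \<in> U"
    "e c \<in> U \<and> f (c - \<kappa>) \<in> U \<Longrightarrow> f c \<in> U"
    "f (c - \<kappa>) \<in> U \<and> f c \<in> U \<Longrightarrow> e c \<in> U" for c
  proof -
    let ?z = "z (f (c - \<kappa>))"
    note cls = e(3)[of c] cl[of c] cl(2)[of "c - \<kappa>"]
    have eqs: "?z = (e c \<oplus> f c) \<ominus> g c" "f c = (?z \<ominus> e c) \<oplus> g c" "e c = g c \<oplus> (?z \<ominus> f c)"
      unfolding g_def using cls M.a_lcomm[of "e c" "f c" "\<ominus> e c"]
      by (simp_all add: M.minus_eq M.minus_add M.a_ac M.r_neg M.r_neg2 M.r_neg1)
    show "f (c - \<kappa>) \<in> U" if "e c \<in> U \<and> f c \<in> U"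
      using that eqs(1) gU[of c] U(4)[OF cl(1)] sub_diff[OF U(1)] sub_add[OF U(1)] by metis
    show "f c \<in> U" if "e c \<in> U \<and> f (c - \<kappa>) \<in> U"
      using that eqs(2) gU[of c] U(3) sub_diff[OF U(1)] sub_add[OF U(1)] by metis
    show "e c \<in> U" if "f (c - \<kappa>) \<in> U \<and> f c \<in> U"
      using that eqs(3) gU[of c] U(3) sub_diff[OF U(1)] sub_add[OF U(1)] by metis
  qed
  have "?F = {}"
  \<comment> \<open>Real parts order the finitely many eigenvalues in \<open>?F\<close>. At
    \<open>c1 + \<kappa>\<close>, above the largest, and at the smallest one \<open>c2\<close>, only
    one of the two \<open>f\<close>-terms is outside \<open>U\<close>, so \<open>e\<close> must be
    non-zero there. This forces \<open>c1 + \<kappa> = b = c2\<close>, although the real part of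
    \<open>c2\<close> is at most that of \<open>c1\<close>.\<close>
  proof (rule ccontr)
    assume ne: "?F \<noteq> {}"
    have ReF: "finite (Re ` ?F)" "Re ` ?F \<noteq> {}"
      using fin ne by auto
    obtain c1 where c1: "c1 \<in> ?F" "Re c1 = Max (Re ` ?F)"
      using Max_in[OF ReF] by (elim imageE) (blast intro: that[OF _ sym])
    have c1_max: "Re c \<le> Re c1" if "c \<in> ?F" for c
      unfolding c1(2) using ReF(1) that by (intro Max_ge imageI)
    obtain c2 where c2: "c2 \<in> ?F" "Re c2 = Min (Re ` ?F)"
      using Min_in[OF ReF] by (elim imageE) (blast intro: that[OF _ sym])
    have c2_min: "Re c2 \<le> Re c" if "c \<in> ?F" for c
      unfolding c2(2) using ReF(1) that by (intro Min_le imageI)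
    have "f (c1 + \<kappa>) \<in> U"
      using c1_max[of "c1 + \<kappa>"] \<kappa> by auto
    then have "e (c1 + \<kappa>) \<notin> U"
      using split(1)[of "c1 + \<kappa>"] c1(1) by auto
    then have "c1 + \<kappa> = b"
      using sub_zero[OF U(1)] by (auto simp: e_def split: if_splits)
    have "f (c2 - \<kappa>) \<in> U"
      using c2_min[of "c2 - \<kappa>"] \<kappa> by auto
    then have "e c2 \<notin> U"
      using split(2)[of c2] c2(1) by auto
    then have "c2 = b"
      using sub_zero[OF U(1)] by (auto simp: e_def split: if_splits)
    then show False
      using \<open>c1 + \<kappa> = b\<close> c2_min[OF c1(1)] \<kappa> by auto
  qed
  then have "e b \<in> U"
    using split(3)[of b] by auto
  then show ?thesis
    by (simp add: e_def)
qed

end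


section \<open>Irreducible \<open>J \<oplus> D\<close>-modules\<close>

locale irreducible_JD_module = cspace V
  for V :: "('g::ab_group_add loopD, 'v) lie_mod" (structure) +
  fixes sc :: "complex \<Rightarrow> 'g \<Rightarrow> 'g" and br :: "'g \<Rightarrow> 'g \<Rightarrow> 'g"
    and form :: "'g \<Rightarrow> 'g \<Rightarrow> complex" and n :: nat
  assumes lie: "lie_algebra sc br"
    and irreducible: "irreducible_lie_module (JD_scale sc) (JD_bracket n sc br form) (JD n 0) V"
begin

lemma lie_module_JD: "lie_module (JD_scale sc) (JD_bracket n sc br form) (JD n 0) V"
  using irreducible by (simp add: irreducible_lie_module_def)

lemma submodule_cases:
  assumes "lie_submodule (JD n 0) U V"
  shows "U = {\<zero>} \<or> U = carrier V"
  using irreducible assms by (simp add: irreducible_lie_module_def)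

lemma endo_JD: "x \<in> JD n 0 \<Longrightarrow> endo (act V x)"
  by (rule endo_act[OF lie_module_JD])

lemma act_add: "x \<in> JD n 0 \<Longrightarrow> y \<in> JD n 0 \<Longrightarrow> v \<in> carrier V \<Longrightarrow>
    act V (x + y) v = act V x v \<oplus> act V y v"
  using lie_module_JD unfolding lie_module_def by blast

lemma act_scale: "x \<in> JD n 0 \<Longrightarrow> v \<in> carrier V \<Longrightarrow> act V (JD_scale sc c x) v = c \<odot> act V x v"
  using lie_module_JD unfolding lie_module_def by blast

lemma act_commute:
  assumes "x \<in> JD n 0" "y \<in> JD n 0" "v \<in> carrier V"
  shows "act V x (act V y v) = act V y (act V x v) \<oplus> act V (JD_bracket n sc br form x y) v"
proof -
  have "act V (JD_bracket n sc br form x y) v = act V x (act V y v) \<ominus> act V y (act V x v)"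
    using lie_module_JD assms unfolding lie_module_def by blast
  then show ?thesis
    using assms endo_JD endo_closed
    by (simp add: M.minus_eq M.a_lcomm[of "act V y (act V x v)"] M.r_neg)
qed

lemma zero_JD: "0 \<in> JD n k"
  using JD_loop[OF J_part_zero] by (simp flip: zero_prod_def)

lemma act_zero: "v \<in> carrier V \<Longrightarrow> act V 0 v = \<zero>"
  using act_add[OF zero_JD zero_JD, of v] endo_closed[OF endo_JD[OF zero_JD], of v]
  by (simp add: M.add.l_cancel_one')

lemma d_JD: "i \<in> {1..n} \<Longrightarrow> d_elt i \<in> JD n 0"
  using d_elt_JD[of i 0 n] by simp

lemma act_loop_K:
  assumes "F \<in> J_part n" "m \<in> A_expo n" "v \<in> carrier V"
  shows "act V (F, 0) (act V (K_elt m) v) = act V (K_elt m) (act V (F, 0) v)"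
  using act_commute[OF JD_loop[OF assms(1)] K_elt_JD[OF assms(2)] assms(3)] assms
    endo_closed[OF endo_JD[OF K_elt_JD] endo_closed[OF endo_JD[OF JD_loop]]]
  by (simp add: bracket_K_elt_loop act_zero)

lemma act_K_K:
  assumes "m \<in> A_expo n" "l \<in> A_expo n" "v \<in> carrier V"
  shows "act V (K_elt m) (act V (K_elt l) v) = act V (K_elt l) (act V (K_elt m) v)"
  using act_loop_K[OF J_part_single assms(2,3)] assms(1) unfolding K_elt_def by blast

lemma act_d_K:
  assumes "i \<in> {1..n}" "m \<in> A_expo n" "v \<in> carrier V"
  shows "act V (d_elt i) (act V (K_elt m) v) = act V (K_elt m) (act V (d_elt i) v) \<oplus>
    (if i = n then 0 else of_int (Poly_Mapping.lookup m i)) \<odot> act V (K_elt m) v"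
  using act_commute[OF d_JD[OF assms(1)] K_elt_JD[OF assms(2)] assms(3)] assms
  by (simp add: bracket_d_K_elt[OF lie] act_scale K_elt_JD)

lemma act_d_single:
  assumes "i \<in> {1..<n}" "m \<in> A_expo n" "v \<in> carrier V"
  shows "act V (d_elt i) (act V (Poly_Mapping.single m G, 0) v) =
    act V (Poly_Mapping.single m G, 0) (act V (d_elt i) v) \<oplus>
    of_int (Poly_Mapping.lookup m i) \<odot> act V (Poly_Mapping.single m G, 0) v"
  using act_commute[OF d_JD JD_loop[OF J_part_single[OF assms(2)]] assms(3), of i G] assms
  by (simp add: bracket_d_single[OF lie] act_scale JD_loop J_part_single)

lemma act_d_d:
  assumes "i \<in> {1..n}" "j \<in> {1..n}" "v \<in> carrier V"
  shows "act V (d_elt i) (act V (d_elt j) v) = act V (d_elt j) (act V (d_elt i) v)"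
proof -
  have "act V (d_elt j) (act V (d_elt i) v) \<in> carrier V"
    using assms d_JD endo_JD endo_closed by metis
  moreover have "JD_bracket n sc br form (d_elt i) (d_elt j) = 0"
    unfolding d_elt_def by (rule bracket_d_d)
  ultimately show ?thesis
    using act_commute[OF d_JD[OF assms(1)] d_JD[OF assms(2)] assms(3)] assms(3)
    by (simp add: act_zero)
qed

lemma lie_submoduleI:
  assumes U: "sub U"
    and loop: "\<And>m G u. m \<in> A_expo n \<Longrightarrow> u \<in> U \<Longrightarrow> act V (Poly_Mapping.single m G, 0) u \<in> U"
    and d: "\<And>i u. i \<in> {k+1..n} \<Longrightarrow> u \<in> U \<Longrightarrow> act V (d_elt i) u \<in> U"
  shows "lie_submodule (JD n k) U V"
proof -
  have le: "JD n k \<subseteq> JD n 0"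
    by (rule JD_mono) simp
  have "act V x u \<in> U" if "x \<in> JD n k" "u \<in> U" for x u
    using that(1)
  proof (induction rule: JD_induct[where sc = sc])
    case (loop m G)
    then show ?case
      using assms(2) that(2) by blast
  next
    case (d c i)
    then have "act V (JD_scale sc c (d_elt i)) u = c \<odot> act V (d_elt i) u"
      using d_JD[of i] that(2) sub_carrier[OF U] by (intro act_scale) auto
    then show ?case
      using assms(3)[OF d that(2)] sub_scale[OF U] by simp
  next
    case (add x y)
    then have "act V (x + y) u = act V x u \<oplus> act V y u"
      using le that(2) sub_carrier[OF U] by (intro act_add) auto
    then show ?case
      using add.IH sub_add[OF U] by simp
  qed
  then show ?thesis
    using U by (simp add: lie_submodule_def)
qed

lemma bij_K:
  assumes m: "m \<in> A_expo n" and v: "v \<in> carrier V" "act V (K_elt m) v \<noteq> \<zero>"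
  shows "bij_betw (act V (K_elt m)) (carrier V) (carrier V)"
proof -
  let ?T = "act V (K_elt m)"
  have T: "endo ?T"
    by (rule endo_JD[OF K_elt_JD[OF m]])
  let ?c = "\<lambda>i. if i = n then 0 else of_int (Poly_Mapping.lookup m i) :: complex"
  have cl: "act V x u \<in> carrier V" if "x \<in> JD n 0" "u \<in> carrier V" for x u
    using endo_closed[OF endo_JD] that by blast
  have loop_JD: "(Poly_Mapping.single l G, 0) \<in> JD n 0" if "l \<in> A_expo n" for l G
    using that by (intro JD_loop J_part_single)
  let ?N = "{u \<in> carrier V. ?T u = \<zero>}"
  have "lie_submodule (JD n 0) ?N V"
  proof (rule lie_submoduleI)
    show "sub ?N"
      by (rule subI) (use T in \<open>auto simp: endo_zero endo_add endo_scale\<close>)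
    show "act V (Poly_Mapping.single l G, 0) u \<in> ?N" if "l \<in> A_expo n" "u \<in> ?N" for l G u
      using that act_loop_K[OF J_part_single[OF that(1)] m, of u G, symmetric]
        endo_zero[OF endo_JD[OF loop_JD[OF that(1)]]] cl[OF loop_JD] by simp
    show "act V (d_elt i) u \<in> ?N" if "i \<in> {0+1..n}" "u \<in> ?N" for i u
    proof -
      have i: "i \<in> {1..n}" and u: "u \<in> carrier V" "?T u = \<zero>"
        using that by auto
      have "?T (act V (d_elt i) u) = \<zero>"
        using act_d_K[OF i m u(1)] endo_zero[OF endo_JD[OF d_JD[OF i]]] cl[OF K_elt_JD[OF m]]
          cl[OF d_JD[OF i] u(1)] u(2) by simp
      then show ?thesis
        using cl[OF d_JD[OF i] u(1)] by simp
    qed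
  qed
  then have N: "?N = {\<zero>}"
    using submodule_cases v by blast
  have "inj_on ?T (carrier V)"
  proof (rule inj_onI)
    fix u w assume uw: "u \<in> carrier V" "w \<in> carrier V" "?T u = ?T w"
    then have "u \<ominus> w \<in> ?N"
      using T by (simp add: endo_diff endo_closed diff_eq_zero_iff)
    then show "u = w"
      using uw unfolding N by (simp add: diff_eq_zero_iff)
  qed
  moreover have "lie_submodule (JD n 0) (?T ` carrier V) V"
  proof (rule lie_submoduleI)
    show "sub (?T ` carrier V)"
      using sub_endo_image[OF T sub_carrier_self] .
    show "act V (Poly_Mapping.single l G, 0) u \<in> ?T ` carrier V"
      if l: "l \<in> A_expo n" and u: "u \<in> ?T ` carrier V" for l G u
    proof -
      obtain w where w: "w \<in> carrier V" "u = ?T w"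
        using u by (elim imageE) (rule that)
      show ?thesis
        unfolding w(2) act_loop_K[OF J_part_single[OF l] m w(1)]
        using cl[OF loop_JD[OF l] w(1)] by (rule imageI)
    qed
    show "act V (d_elt i) u \<in> ?T ` carrier V" if i: "i \<in> {0+1..n}" and u: "u \<in> ?T ` carrier V" for i u
    proof -
      have i: "i \<in> {1..n}"
        using i by simp
      obtain w where w: "w \<in> carrier V" "u = ?T w"
        using u by (elim imageE) (rule that)
      \<comment> \<open>Homogeneity lets the degree shift be absorbed into the argument of
        \<open>?T\<close>, so the result is again in the image.\<close>
      have "act V (d_elt i) u = ?T (act V (d_elt i) w \<oplus> ?c i \<odot> w)"
        using act_d_K[OF i m w(1)] w T cl[OF d_JD[OF i] w(1)] by (simp add: endo_add endo_scale)
      then show ?thesis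
        using w cl[OF d_JD[OF i] w(1)] by blast
    qed
  qed
  then have "?T ` carrier V = carrier V"
    using submodule_cases v by blast
  ultimately show ?thesis
    by (simp add: bij_betw_def)
qed

subsection \<open>Central operators\<close>

text \<open>These are the test operators for centrality: they include the action of \<open>J\<close>
  and of every \<open>K_elt m\<close>.\<close>

definition commutes_K :: "('v \<Rightarrow> 'v) \<Rightarrow> bool"
  where "commutes_K S \<longleftrightarrow> endo S \<and>
    (\<forall>m\<in>A_expo n. \<forall>v\<in>carrier V. S (act V (K_elt m) v) = act V (K_elt m) (S v))"

text \<open>A double commutant condition. It passes to compositions and inverses, so checking the
  generators suffices; and since such operators themselves satisfy \<open>commutes_K\<close>, they
  commute with each other as well as with \<open>J\<close>.\<close>

definition central_auto :: "('v \<Rightarrow> 'v) \<Rightarrow> bool"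
  where "central_auto T \<longleftrightarrow> endo T \<and> bij_betw T (carrier V) (carrier V) \<and>
    (\<forall>S. commutes_K S \<longrightarrow> (\<forall>v\<in>carrier V. S (T v) = T (S v)))"

lemma
  assumes "central_auto T"
  shows central_auto_endo: "endo T"
    and central_auto_bij: "bij_betw T (carrier V) (carrier V)"
    and central_auto_commute: "\<And>S v. commutes_K S \<Longrightarrow> v \<in> carrier V \<Longrightarrow> S (T v) = T (S v)"
  using assms by (auto simp: central_auto_def)

lemma commutes_K_loop: "F \<in> J_part n \<Longrightarrow> commutes_K (act V (F, 0))"
  by (auto simp: commutes_K_def endo_JD JD_loop act_loop_K)

lemma commutes_K_K: "m \<in> A_expo n \<Longrightarrow> commutes_K (act V (K_elt m))"
  by (auto simp: commutes_K_def endo_JD K_elt_JD act_K_K)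

lemma central_auto_commutes_K: "central_auto T \<Longrightarrow> commutes_K T"
  by (simp add: commutes_K_def central_auto_endo central_auto_commute[OF _ commutes_K_K])

lemma central_auto_act:
  assumes "m \<in> A_expo n" "\<exists>v\<in>carrier V. act V (K_elt m) v \<noteq> \<zero>"
  shows "central_auto (act V (K_elt m))"
  using assms bij_K by (auto simp: central_auto_def commutes_K_def endo_JD K_elt_JD)

text \<open>\<open>central_operator\<close> prescribes an operator on the carrier only, so the
  property has to be insensitive to values elsewhere.\<close>

lemma central_auto_cong:
  assumes "central_auto T" "\<And>v. v \<in> carrier V \<Longrightarrow> T' v = T v"
  shows "central_auto T'"
proof -
  have "S (T' v) = T' (S v)" if "commutes_K S" "v \<in> carrier V" for S v
    using that assms central_auto_commute[OF assms(1), of S v] endo_closed[of S v]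
    by (simp add: commutes_K_def)
  moreover have "bij_betw T' (carrier V) (carrier V)"
    using bij_betw_cong[of "carrier V" T' T] assms central_auto_bij by blast
  moreover have "endo T'"
    using central_auto_endo[OF assms(1)] assms(2) by (auto simp: endo_def)
  ultimately show ?thesis
    by (simp add: central_auto_def)
qed

text \<open>Every vector of the carrier is some \<open>T v\<close>, so linearity and commutation of
  the inverse are read off from those of \<open>T\<close>.\<close>

lemma central_auto_inv:
  assumes T: "central_auto T"
  shows "central_auto (inv_into (carrier V) T)"
proof -
  let ?I = "inv_into (carrier V) T"
  note bij = central_auto_bij[OF T] and endoT = central_auto_endo[OF T]
  have I: "?I (T v) = v" if "v \<in> carrier V" for v
    using bij that by (rule bij_betw_inv_into_left)
  have ex: "\<exists>v\<in>carrier V. w = T v" if "w \<in> carrier V" for w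
    using bij that by (auto simp: bij_betw_def)
  have comm: "S (?I w) = ?I (S w)" if S: "commutes_K S" and w: "w \<in> carrier V" for S w
  proof -
    obtain v where v: "v \<in> carrier V" "w = T v"
      using ex[OF w] by blast
    have "S v \<in> carrier V"
      using S v(1) endo_closed by (auto simp: commutes_K_def)
    then show ?thesis
      using v central_auto_commute[OF T S v(1)] I by simp
  qed
  have "endo ?I"
    unfolding endo_def
  proof (intro conjI ballI allI)
    fix w assume w: "w \<in> carrier V"
    obtain v where v: "v \<in> carrier V" "w = T v"
      using ex[OF w] by blast
    show "?I w \<in> carrier V"
      using v I by simp
    show "?I (c \<odot> w) = c \<odot> ?I w" for c
      using v I endoT by (simp flip: endo_scale)
    show "?I (w \<oplus> w') = ?I w \<oplus> ?I w'" if w': "w' \<in> carrier V" for w'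
    proof -
      obtain v' where "v' \<in> carrier V" "w' = T v'"
        using ex[OF w'] by blast
      then show ?thesis
        using v I endoT by (simp flip: endo_add)
    qed
  qed
  then show ?thesis
    using comm bij_betw_inv_into[OF bij] by (simp add: central_auto_def)
qed

lemma central_auto_comp:
  assumes "central_auto T" "central_auto T'"
  shows "central_auto (T \<circ> T')"
proof -
  note e = central_auto_endo[OF assms(1)] central_auto_endo[OF assms(2)]
  have "endo (T \<circ> T')"
    using e unfolding endo_def by simp
  moreover have "bij_betw (T \<circ> T') (carrier V) (carrier V)"
    using central_auto_bij[OF assms(2)] central_auto_bij[OF assms(1)] by (rule bij_betw_trans)
  moreover have "S (T (T' v)) = T (T' (S v))" if "commutes_K S" "v \<in> carrier V" for S v
    using that central_auto_commute[OF assms(1)] central_auto_commute[OF assms(2)]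
      endo_closed[OF e(2)] by simp
  ultimately show ?thesis
    by (simp add: central_auto_def)
qed

lemma central_auto_id: "central_auto id"
  by (simp add: central_auto_def endo_def)

lemma central_auto_scale:
  assumes "c \<noteq> 0"
  shows "central_auto (\<lambda>v. c \<odot> v)"
proof -
  have "bij_betw (\<lambda>v. c \<odot> v) (carrier V) (carrier V)"
    by (rule bij_betw_byWitness[where f' = "\<lambda>v. inverse c \<odot> v"]) (use assms in auto)
  then show ?thesis
    by (auto simp: central_auto_def endo_scaling commutes_K_def endo_scale)
qed

lemma central_auto_operator:
  assumes "central_operator n V T" "nonzero_operator V T"
  shows "central_auto T"
proof -
  obtain c fs where fs: "set fs \<subseteq> central_generators n V"
    and T: "\<And>v. v \<in> carrier V \<Longrightarrow> T v = c \<odot> foldr (\<circ>) fs id v"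
    using assms(1) by (auto simp: central_operator_def)
  have "central_auto f" if "f \<in> central_generators n V" for f
    using that central_auto_act central_auto_inv by (auto simp: central_generators_def)
  then have fold: "central_auto (foldr (\<circ>) fs id)"
    using fs by (induction fs) (auto intro: central_auto_comp simp: central_auto_id)
  obtain v where "v \<in> carrier V" "T v \<noteq> \<zero>"
    using assms(2) by (auto simp: nonzero_operator_def)
  then have "c \<noteq> 0"
    using T[of v] endo_closed[OF central_auto_endo[OF fold], of v] by auto
  then have "central_auto ((\<lambda>v. c \<odot> v) \<circ> foldr (\<circ>) fs id)"
    by (intro central_auto_comp central_auto_scale fold)
  then show ?thesis
    by (rule central_auto_cong) (simp add: T)
qed

end


section \<open>The submodule spanned by the vectors \<open>z\<^sub>i v - v\<close>\<close>

locale central_JD_module = irreducible_JD_module V sc br form n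
  for V :: "('g::ab_group_add loopD, 'v) lie_mod" (structure) and sc br form n +
  fixes z :: "nat \<Rightarrow> 'v \<Rightarrow> 'v" and k :: "nat \<Rightarrow> int" and v0 :: 'v and c0 :: "nat \<Rightarrow> complex"
  assumes n_ge_2: "n \<ge> 2"
    and z: "\<And>i. i \<in> {1..n-1} \<Longrightarrow> central_auto (z i)"
    and k_pos: "\<And>i. i \<in> {1..n-1} \<Longrightarrow> k i > 0"
    and d_z: "\<And>i j v. i \<in> {1..n-1} \<Longrightarrow> j \<in> {1..n} \<Longrightarrow> v \<in> carrier V \<Longrightarrow>
      act V (d_elt j) (z i v) =
        z i (act V (d_elt j) v) \<oplus> (if j = i then of_int (k i) else 0) \<odot> z i v"
    and v0: "v0 \<in> carrier V" "v0 \<noteq> \<zero>"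
    and d_v0: "\<And>i. i \<in> {1..n} \<Longrightarrow> act V (d_elt i) v0 = c0 i \<odot> v0"
begin

section \<open>Commutation relations of the \<open>z i\<close> and eigenvalues of the
  \<open>d_elt i\<close>\<close>

lemma endo_z: "i \<in> {1..n-1} \<Longrightarrow> endo (z i)"
  using z central_auto_endo by blast

lemma z_closed: "i \<in> {1..n-1} \<Longrightarrow> v \<in> carrier V \<Longrightarrow> z i v \<in> carrier V"
  using endo_z endo_closed by blast

lemma z_commute:
  "i \<in> {1..n-1} \<Longrightarrow> j \<in> {1..n-1} \<Longrightarrow> v \<in> carrier V \<Longrightarrow> z i (z j v) = z j (z i v)"
  using central_auto_commute[OF z central_auto_commutes_K[OF z]] by blast

lemma loop_z:
  "i \<in> {1..n-1} \<Longrightarrow> F \<in> J_part n \<Longrightarrow> v \<in> carrier V \<Longrightarrow>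
    act V (F, 0) (z i v) = z i (act V (F, 0) v)"
  using central_auto_commute[OF z commutes_K_loop] by blast

lemma d_z_other:
  assumes "i \<in> {1..n-1}" "j \<in> {1..n}" "j \<noteq> i" "v \<in> carrier V"
  shows "act V (d_elt j) (z i v) = z i (act V (d_elt j) v)"
proof -
  have "act V (d_elt j) v \<in> carrier V"
    using assms endo_JD[OF d_JD] endo_closed by blast
  then show ?thesis
    using d_z[OF assms(1,2,4)] assms z_closed by simp
qed

text \<open>The sum of eigenspaces is a non-zero \<open>J \<oplus> D\<close>-submodule: it contains
  \<open>v0\<close>, monomials change the eigenvalue by an integer exponent, and the
  \<open>d_elt j\<close> keep it. Giving the zero space to eigenvalues outside the coset lets the
  families be indexed by all complex numbers.\<close>

lemma family_sums_eigenspaces: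
  assumes i: "i \<in> {1..n-1}" and v: "v \<in> carrier V"
  shows "v \<in> family_sums (\<lambda>c. if c - c0 i \<in> \<int> then {v \<in> carrier V. act V (d_elt i) v = c \<odot> v} else {\<zero>})"
    (is "v \<in> family_sums ?E")
proof -
  have i': "i \<in> {1..n}" "i \<in> {1..<n}"
    using i by auto
  have d: "endo (act V (d_elt i))"
    using i' by (intro endo_JD d_JD) simp
  have E: "sub (?E c)" for c
    using eigenspace_sub[OF d] sub_singleton_zero by simp
  \<comment> \<open>Common to both kinds of generators: a shift by an integer \<open>a\<close>
    permutes the coset of \<open>c0 i\<close>, so the components of \<open>u\<close> are transformed
    and reindexed.\<close>
  have map: "T u \<in> family_sums ?E" if T: "endo T" and u: "u \<in> family_sums ?E"
    and shift: "\<And>c v. v \<in> carrier V \<Longrightarrow> act V (d_elt i) v = c \<odot> v \<Longrightarrow>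
      act V (d_elt i) (T v) = (c + of_int a) \<odot> T v" for T u a
  proof -
    obtain f where f: "family f" "\<And>c. f c \<in> ?E c" "u = fsum f"
      using u by (auto elim!: family_sumsE)
    have bij: "bij (\<lambda>c::complex. c - of_int a)"
      by (rule bij_betw_byWitness[where f' = "\<lambda>c. c + of_int a"]) auto
    let ?g = "\<lambda>c. T (f (c - of_int a))"
    have g: "family ?g" "fsum ?g = T u"
      using family_endo[OF T family_reindex[OF f(1) bij]] fsum_endo[OF T family_reindex[OF f(1) bij]]
        fsum_reindex[OF f(1) bij] f(3) by simp_all
    have "?g c \<in> ?E c" for c
    proof (cases "c - c0 i \<in> \<int>")
      case True
      then have "c - of_int a - c0 i \<in> \<int>"
        using Ints_diff[OF True Ints_of_int[of a]] by (simp add: algebra_simps)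
      then have "f (c - of_int a) \<in> carrier V"
        "act V (d_elt i) (f (c - of_int a)) = (c - of_int a) \<odot> f (c - of_int a)"
        using f(2)[of "c - of_int a"] by auto
      then show ?thesis
        using True shift endo_closed[OF T] by simp
    next
      case False
      then have "c - of_int a - c0 i \<notin> \<int>"
        using Ints_add[OF _ Ints_of_int[of a], of "c - of_int a - c0 i"] by (auto simp: algebra_simps)
      then show ?thesis
        using False f(2)[of "c - of_int a"] endo_zero[OF T] by simp
    qed
    then show ?thesis
      using family_sumsI[OF g(1)] g(2) by simp
  qed
  have "lie_submodule (JD n 0) (family_sums ?E) V"
  proof (rule lie_submoduleI)
    show "sub (family_sums ?E)"
      using E by (rule sub_family_sums)
    show "act V (Poly_Mapping.single m G, 0) u \<in> family_sums ?E"
      if m: "m \<in> A_expo n" and u: "u \<in> family_sums ?E" for m G u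
    proof -
      let ?T = "act V (Poly_Mapping.single m G, 0)"
      have T: "endo ?T"
        using m by (intro endo_JD JD_loop J_part_single)
      have "act V (d_elt i) (?T v) = (c + of_int (Poly_Mapping.lookup m i)) \<odot> ?T v"
        if "v \<in> carrier V" "act V (d_elt i) v = c \<odot> v" for c v
        using act_d_single[OF i'(2) m that(1), of G] that T endo_closed[OF T that(1)]
        by (simp add: endo_scale scale_add)
      then show ?thesis
        by (rule map[OF T u])
    qed
    show "act V (d_elt j) u \<in> family_sums ?E"
      if j: "j \<in> {0+1..n}" and u: "u \<in> family_sums ?E" for j u
    proof -
      have j: "j \<in> {1..n}"
        using j by simp
      have T: "endo (act V (d_elt j))"
        using j by (intro endo_JD d_JD)
      have "act V (d_elt i) (act V (d_elt j) v) = (c + of_int 0) \<odot> act V (d_elt j) v"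
        if "v \<in> carrier V" "act V (d_elt i) v = c \<odot> v" for c v
        using act_d_d[OF i'(1) j that(1)] that T by (simp add: endo_scale)
      then show ?thesis
        by (rule map[OF T u])
    qed
  qed
  moreover have "v0 \<in> family_sums ?E"
    using E by (rule family_sums_superset[where i = "c0 i"]) (use v0 d_v0[OF i'(1)] in simp)
  ultimately show ?thesis
    using submodule_cases v0 v by blast
qed

text \<open>An eigenvector equals its own component in the decomposition, and components outside the
  coset are zero.\<close>

lemma eigenvalue_Ints:
  assumes i: "i \<in> {1..n-1}" and v: "v \<in> carrier V" "v \<noteq> \<zero>" "act V (d_elt i) v = c \<odot> v"
  shows "c - c0 i \<in> \<int>"
proof -
  let ?E = "\<lambda>c. if c - c0 i \<in> \<int> then {v \<in> carrier V. act V (d_elt i) v = c \<odot> v} else {\<zero>}"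
  obtain f where f: "family f" "\<And>c. f c \<in> ?E c" "v = fsum f"
    using family_sums_eigenspaces[OF i v(1)] by (rule family_sumsE) (rule that)
  have d: "endo (act V (d_elt i))"
    using i by (intro endo_JD d_JD) auto
  have "fsum f = f c"
  proof (rule eigenvector_component[where H = UNIV and T = "\<lambda>_::unit. act V (d_elt i)" and
        e = "\<lambda>c _. c" and I = UNIV])
    show "act V (d_elt i) (f c) = c \<odot> f c" for c
      using f(2)[of c] endo_zero[OF d] by (auto split: if_splits)
  qed (use d f v in auto)
  then show ?thesis
    using f(2)[of c] f(3) v(2) by (auto split: if_splits)
qed

text \<open>Partial sums of the images of \<open>z i\<close> minus the identity, for
  \<open>i \<le> j\<close>. The recursion adds one operator at a time, so that each can be treated
  modulo the previous stage; the full sum is \<open>shifts (n - 1)\<close>.\<close>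

primrec shifts :: "nat \<Rightarrow> 'v set"
  where
    "shifts 0 = {\<zero>}"
  | "shifts (Suc j) = {u \<oplus> (z (Suc j) w \<ominus> w) | u w. u \<in> shifts j \<and> w \<in> carrier V}"

lemma sub_shifts: "j \<le> n - 1 \<Longrightarrow> sub (shifts j)"
proof (induction j)
  case 0
  then show ?case
    by (simp add: sub_singleton_zero)
next
  case (Suc j)
  then have IH: "sub (shifts j)" and z: "endo (z (Suc j))"
    using endo_z by auto
  have cl: "u \<in> carrier V" if "u \<in> shifts j" for u
    using that sub_carrier[OF IH] by blast
  have zcl: "z (Suc j) w \<in> carrier V" if "w \<in> carrier V" for w
    using that endo_closed[OF z] by blast
  show ?case
  proof (rule subI)
    show "shifts (Suc j) \<subseteq> carrier V"
      using cl zcl by auto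
    have "\<zero> = \<zero> \<oplus> (z (Suc j) \<zero> \<ominus> \<zero>)"
      using endo_zero[OF z] by (simp add: diff_zero)
    then show "\<zero> \<in> shifts (Suc j)"
      using sub_zero[OF IH] by auto
    show "x \<oplus> y \<in> shifts (Suc j)" if xy: "x \<in> shifts (Suc j)" "y \<in> shifts (Suc j)" for x y
    proof -
      obtain u w where x: "u \<in> shifts j" "w \<in> carrier V" "x = u \<oplus> (z (Suc j) w \<ominus> w)"
        using xy(1) by auto
      obtain u' w' where y: "u' \<in> shifts j" "w' \<in> carrier V" "y = u' \<oplus> (z (Suc j) w' \<ominus> w')"
        using xy(2) by auto
      note * = x y
      then have "x \<oplus> y = (u \<oplus> u') \<oplus> (z (Suc j) (w \<oplus> w') \<ominus> (w \<oplus> w'))"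
        using cl zcl z by (simp add: endo_add M.minus_eq M.minus_add M.a_ac)
      then show ?thesis
        using * sub_add[OF IH] by auto
    qed
    show "c \<odot> x \<in> shifts (Suc j)" if x: "x \<in> shifts (Suc j)" for c x
    proof -
      obtain u w where *: "u \<in> shifts j" "w \<in> carrier V" "x = u \<oplus> (z (Suc j) w \<ominus> w)"
        using x by auto
      then have "c \<odot> x = c \<odot> u \<oplus> (z (Suc j) (c \<odot> w) \<ominus> c \<odot> w)"
        using cl zcl z by (simp add: endo_scale scale_add_right scale_diff_right)
      then show ?thesis
        using * sub_scale[OF IH] by auto
    qed
  qed
qed

text \<open>Used with \<open>J\<close> and \<open>d_elt n\<close> to make the full sum a submodule,
  and with \<open>d_elt (Suc j)\<close>, \<open>z (Suc j)\<close> and its inverse when the next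
  operator is added.\<close>

lemma shifts_stable:
  assumes T: "endo T" and "\<And>i v. i \<in> {1..j} \<Longrightarrow> v \<in> carrier V \<Longrightarrow> T (z i v) = z i (T v)"
    and "j \<le> n - 1" "u \<in> shifts j"
  shows "T u \<in> shifts j"
  using assms(2-)
proof (induction j arbitrary: u)
  case 0
  then show ?case
    using endo_zero[OF T] by simp
next
  case (Suc j)
  obtain u' w where *: "u' \<in> shifts j" "w \<in> carrier V" "u = u' \<oplus> (z (Suc j) w \<ominus> w)"
    using Suc.prems(3) by auto
  have cl: "u' \<in> carrier V" "z (Suc j) w \<in> carrier V"
    using sub_carrier[OF sub_shifts *(1)] z_closed[OF _ *(2)] Suc.prems(2) by simp_all
  have "T u = T u' \<oplus> (z (Suc j) (T w) \<ominus> T w)"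
    using * cl T Suc.prems(1)[of "Suc j" w] by (simp add: endo_add endo_diff)
  moreover have "T u' \<in> shifts j"
    by (rule Suc.IH) (use Suc.prems * in auto)
  ultimately show ?case
    using endo_closed[OF T *(2)] by auto
qed

lemma shifts_mono: "i \<le> j \<Longrightarrow> j \<le> n - 1 \<Longrightarrow> shifts i \<subseteq> shifts j"
proof (induction j rule: dec_induct)
  case (step j)
  have "u \<in> shifts (Suc j)" if "u \<in> shifts j" for u
  proof -
    have "u = u \<oplus> (z (Suc j) \<zero> \<ominus> \<zero>)"
      using that sub_carrier[OF sub_shifts, of j u] step.prems endo_zero[OF endo_z, of "Suc j"]
      by (simp add: diff_zero)
    then show ?thesis
      using that by auto
  qed
  then show ?case
    using step by auto
qed simp

lemma shift_in_shifts:
  assumes "i \<in> {1..n-1}" "v \<in> carrier V"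
  shows "z i v \<ominus> v \<in> shifts (n - 1)"
proof -
  obtain j where j: "i = Suc j"
    using assms(1) by (cases i) auto
  have "z i v \<ominus> v = \<zero> \<oplus> (z i v \<ominus> v)"
    using assms z_closed by simp
  then have "z i v \<ominus> v \<in> shifts i"
    using assms sub_zero[OF sub_shifts, of j] unfolding j by auto
  then show ?thesis
    using shifts_mono[of i "n - 1"] assms(1) by auto
qed

text \<open>Each induction step strips one summand: \<open>eigenvector_in_shift_image\<close>,
  applied to \<open>z (Suc j)\<close> modulo \<open>shifts j\<close>, pushes an eigenvector of
  \<open>d_elt (Suc j)\<close> down into \<open>shifts j\<close>. At the bottom only zero is
  left.\<close>

lemma eigenvector_in_shifts:
  assumes "j \<le> n - 1" "v \<in> shifts j" "\<And>i. i \<in> {1..j} \<Longrightarrow> \<exists>c. act V (d_elt i) v = c \<odot> v"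
  shows "v = \<zero>"
  using assms
proof (induction j)
  case (Suc j)
  let ?i = "Suc j"
  let ?d = "act V (d_elt ?i)"
  have i: "?i \<in> {1..n-1}" "?i \<in> {1..n}"
    using Suc.prems(1) by auto
  have d: "endo ?d"
    using i(2) by (intro endo_JD d_JD)
  have sub: "sub (shifts j)"
    using Suc.prems(1) by (intro sub_shifts) simp
  obtain u w where *: "u \<in> shifts j" "w \<in> carrier V" "v = u \<oplus> (z ?i w \<ominus> w)"
    using Suc.prems(2) by auto
  have cl: "u \<in> carrier V" "z ?i w \<in> carrier V"
    using * sub_carrier[OF sub] z_closed[OF i(1)] by auto
  obtain b where b: "?d v = b \<odot> v"
    using Suc.prems(3)[of ?i] by auto
  have commute: "z l (z ?i x) = z ?i (z l x)" if "l \<in> {1..j}" "x \<in> carrier V" for l x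
    using that i by (intro z_commute) auto
  \<comment> \<open>The inverse cancels \<open>z ?i\<close> inside \<open>shifts j\<close>: it
    commutes with the earlier operators and hence preserves that subspace.\<close>
  let ?inv = "inv_into (carrier V) (z ?i)"
  have inv: "central_auto ?inv"
    by (rule central_auto_inv[OF z[OF i(1)]])
  have "v \<in> shifts j"
  proof (rule eigenvector_in_shift_image[OF d endo_z[OF i(1)], where \<kappa> = "of_int (k ?i)" and
        w = w and b = b])
    show "Re (of_int (k ?i)) > 0"
      using k_pos[OF i(1)] by simp
    show "?d (z ?i x) = z ?i (?d x) \<oplus> of_int (k ?i) \<odot> z ?i x" if "x \<in> carrier V" for x
      using d_z[OF i that] by simp
    show "sub (shifts j)"
      by (rule sub)
    show "?d x \<in> shifts j" if "x \<in> shifts j" for x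
    proof (rule shifts_stable[OF d _ _ that])
      show "?d (z l y) = z l (?d y)" if "l \<in> {1..j}" "y \<in> carrier V" for l y
        using that i by (intro d_z_other) auto
    qed (use i in simp)
    show "z ?i x \<in> shifts j" if "x \<in> shifts j" for x
    proof (rule shifts_stable[OF endo_z[OF i(1)] _ _ that])
      show "z ?i (z l y) = z l (z ?i y)" if "l \<in> {1..j}" "y \<in> carrier V" for l y
        using commute[OF that] by simp
    qed (use i in simp)
    show "x \<in> shifts j" if x: "x \<in> carrier V" "z ?i x \<in> shifts j" for x
    proof -
      have "?inv (z ?i x) \<in> shifts j"
      proof (rule shifts_stable[OF central_auto_endo[OF inv] _ _ x(2)])
        show "?inv (z l y) = z l (?inv y)" if "l \<in> {1..j}" "y \<in> carrier V" for l y
        proof -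
          have "z l (?inv y) = ?inv (z l y)"
            using that i by (intro central_auto_commute[OF inv] central_auto_commutes_K z) auto
          then show ?thesis
            by simp
        qed
      qed (use i in simp)
      then show ?thesis
        using bij_betw_inv_into_left[OF central_auto_bij[OF z[OF i(1)]] x(1)] by simp
    qed
    show "w \<in> family_sums (\<lambda>c. {v \<in> carrier V. ?d v = c \<odot> v})"
    proof -
      obtain f where f: "family f" "w = fsum f" "\<And>c. f c \<in> (if c - c0 ?i \<in> \<int>
          then {v \<in> carrier V. ?d v = c \<odot> v} else {\<zero>})"
        using family_sums_eigenspaces[OF i(1) *(2)] by (rule family_sumsE) (rule that)
      have "f c \<in> {v \<in> carrier V. ?d v = c \<odot> v}" for c
        using f(3)[of c] endo_zero[OF d] by (auto split: if_splits)
      then show ?thesis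
        using family_sumsI[OF f(1)] f(2) by simp
    qed
    show "v \<in> carrier V" "?d v = b \<odot> v"
      using * cl b by auto
    show "v \<ominus> (z ?i w \<ominus> w) \<in> shifts j"
    proof -
      have "v \<ominus> (z ?i w \<ominus> w) = u"
        unfolding *(3) using cl *(2) by (simp add: M.minus_eq M.a_assoc M.r_neg)
      then show ?thesis
        using *(1) by simp
    qed
  qed
  then show ?case
    using Suc by auto
qed simp

section \<open>Generation by \<open>v0\<close> over \<open>J\<close>, and a maximal
  submodule\<close>

text \<open>The least \<open>J\<close>-stable subspace \<open>S\<close> containing \<open>v0\<close>
  is automatically stable under \<open>D\<close>, hence everything by irreducibility. The reason is
  that each \<open>d_elt i\<close> keeps \<open>v0\<close> in its own line and has its brackets with
  \<open>J\<close> again in \<open>J\<close>.\<close>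

lemma J_submodule_generated:
  assumes U: "sub U" "\<And>F u. F \<in> J_part n \<Longrightarrow> u \<in> U \<Longrightarrow> act V (F, 0) u \<in> U" "v0 \<in> U"
  shows "U = carrier V"
proof -
  let ?good = "\<lambda>S. sub S \<and> (\<forall>F\<in>J_part n. \<forall>u\<in>S. act V (F, 0) u \<in> S) \<and> v0 \<in> S"
  define S where "S = \<Inter>{S. ?good S}"
  have J_cl: "act V (F, 0) u \<in> carrier V" if "F \<in> J_part n" "u \<in> carrier V" for F u
    using that endo_closed[OF endo_JD[OF JD_loop]] by blast
  have good_carrier: "?good (carrier V)"
    using sub_carrier_self J_cl v0 by blast
  have sub: "sub S"
    unfolding S_def by (rule sub_Inter) (use good_carrier in blast)+
  have good: "?good S"
    using sub by (simp add: S_def)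
  have least: "S \<subseteq> S'" if "?good S'" for S'
    unfolding S_def using that by (intro Inter_lower) simp
  have "act V (d_elt i) u \<in> S" if i: "i \<in> {1..n}" and u: "u \<in> S" for i u
  proof -
    let ?d = "act V (d_elt i)"
    have d: "endo ?d"
      using i by (intro endo_JD d_JD)
    \<comment> \<open>This part of \<open>S\<close> is again \<open>J\<close>-stable and contains
      \<open>v0\<close>, so leastness makes it equal to \<open>S\<close>; that is the stability
      under \<open>?d\<close>.\<close>
    let ?S = "{w \<in> S. ?d w \<in> S}"
    have "sub ?S"
    proof (rule subI)
      show "?S \<subseteq> carrier V"
        using sub_subset[OF sub] by blast
    qed (use sub_carrier[OF sub] in
        \<open>auto simp: endo_zero[OF d] endo_add[OF d] endo_scale[OF d] sub_zero[OF sub]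
          sub_add[OF sub] sub_scale[OF sub]\<close>)
    moreover have "act V (F, 0) w \<in> ?S" if F: "F \<in> J_part n" and w: "w \<in> ?S" for F w
    proof -
      have w': "w \<in> S" "?d w \<in> S" "w \<in> carrier V"
        using w sub_carrier[OF sub] by auto
      let ?G = "D_action n sc (Poly_Mapping.single i 1) F"
      have "?d (act V (F, 0) w) = act V (F, 0) (?d w) \<oplus> act V (?G, 0) w"
        using act_commute[OF d_JD[OF i] JD_loop[OF F] w'(3)] by (simp add: bracket_d_loop)
      also have "\<dots> \<in> S"
        using good F w' J_part_D_action[OF F] by (intro sub_add[OF sub]) auto
      finally show ?thesis
        using good F w' by auto
    qed
    moreover have "v0 \<in> ?S"
      using good d_v0[OF i] sub_scale[OF sub] by auto
    ultimately have "S \<subseteq> ?S"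
      by (intro least conjI ballI)
    then show ?thesis
      using u by blast
  qed
  then have "lie_submodule (JD n 0) S V"
    using sub good by (intro lie_submoduleI) (simp_all add: J_part_single)
  then have "S = carrier V"
    using submodule_cases good v0 by blast
  moreover have "S \<subseteq> U"
    using U by (intro least) blast
  ultimately show ?thesis
    using sub_subset[OF U(1)] by blast
qed

lemma loop_in_submodule:
  "lie_submodule (JD n j) U V \<Longrightarrow> F \<in> J_part n \<Longrightarrow> u \<in> U \<Longrightarrow> act V (F, 0) u \<in> U"
  by (rule lie_submodule_act[OF _ JD_loop])

lemma lie_submodule_shifts: "lie_submodule (JD n (n - 1)) (shifts (n - 1)) V"
proof (rule lie_submoduleI)
  show "sub (shifts (n - 1))"
    by (rule sub_shifts) simp
  show "act V (Poly_Mapping.single m G, 0) u \<in> shifts (n - 1)"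
    if "m \<in> A_expo n" "u \<in> shifts (n - 1)" for m G u
  proof (rule shifts_stable[OF endo_JD[OF JD_loop[OF J_part_single[OF that(1)]]] _ _ that(2)])
    show "act V (Poly_Mapping.single m G, 0) (z i v) = z i (act V (Poly_Mapping.single m G, 0) v)"
      if "i \<in> {1..n-1}" "v \<in> carrier V" for i v
      using loop_z[OF that(1) J_part_single[OF \<open>m \<in> A_expo n\<close>] that(2)] .
  qed simp
  show "act V (d_elt i) u \<in> shifts (n - 1)"
    if "i \<in> {n - 1 + 1..n}" "u \<in> shifts (n - 1)" for i u
  proof -
    \<comment> \<open>The index range of the remaining degree operators is \<open>n\<close> alone,
      and every \<open>z i\<close> has degree zero in that coordinate.\<close>
    have i: "i = n"
      using that(1) n_ge_2 by simp
    have n: "n \<in> {1..n}"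
      using n_ge_2 by simp
    show ?thesis
      unfolding i
    proof (rule shifts_stable[OF endo_JD[OF d_JD[OF n]] _ _ that(2)])
      show "act V (d_elt n) (z i v) = z i (act V (d_elt n) v)"
        if "i \<in> {1..n-1}" "v \<in> carrier V" for i v
        using that n by (intro d_z_other) auto
    qed simp
  qed
qed

lemma v0_notin_shifts: "v0 \<notin> shifts (n - 1)"
proof
  assume "v0 \<in> shifts (n - 1)"
  then have "v0 = \<zero>"
  proof (rule eigenvector_in_shifts[OF order_refl])
    show "\<exists>c. act V (d_elt i) v0 = c \<odot> v0" if "i \<in> {1..n - 1}" for i
      using d_v0[of i] that by auto
  qed
  then show False
    using v0(2) by simp
qed

lemma maximal_submodule_exists:
  obtains W where "maximal_lie_submodule (JD n (n - 1)) W V" "shifts (n - 1) \<subseteq> W"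
proof -
  \<comment> \<open>Properness need not survive the union of a chain, while omitting the one vector
    \<open>v0\<close> does. For submodules the two conditions agree by
    \<open>J_submodule_generated\<close>.\<close>
  let ?A = "{U. lie_submodule (JD n (n - 1)) U V \<and> shifts (n - 1) \<subseteq> U \<and> v0 \<notin> U}"
  have "\<exists>W\<in>?A. \<forall>U\<in>?A. W \<subseteq> U \<longrightarrow> U = W"
  proof (rule subset_Zorn_nonempty)
    show "?A \<noteq> {}"
      using lie_submodule_shifts v0_notin_shifts by blast
    fix \<C> assume \<C>: "\<C> \<noteq> {}" "subset.chain ?A \<C>"
    have A: "U \<in> ?A" if "U \<in> \<C>" for U
      using \<C>(2) that by (auto simp: subset_chain_def)
    have "sub (\<Union>\<C>)"
    proof (rule sub_Union_chain[OF \<C>(1)])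
      show "sub U" if "U \<in> \<C>" for U
        using A[OF that] lie_submodule_sub by blast
      show "U \<subseteq> U' \<or> U' \<subseteq> U" if "U \<in> \<C>" "U' \<in> \<C>" for U U'
        using \<C>(2) that by (auto simp: subset_chain_def)
    qed
    moreover have "act V x w \<in> \<Union>\<C>" if x: "x \<in> JD n (n - 1)" and w: "w \<in> \<Union>\<C>" for x w
    proof -
      obtain U where U: "U \<in> \<C>" "w \<in> U"
        using w by blast
      have "act V x w \<in> U"
        using A[OF U(1)] x U(2) by (intro lie_submodule_act[OF _ x]) auto
      then show ?thesis
        using U(1) by blast
    qed
    ultimately have "lie_submodule (JD n (n - 1)) (\<Union>\<C>) V"
      by (simp add: lie_submodule_def)
    then show "\<Union>\<C> \<in> ?A"
      using A \<C>(1) by blast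
  qed
  then obtain W where W: "W \<in> ?A" "\<forall>U\<in>?A. W \<subseteq> U \<longrightarrow> U = W"
    by (rule bexE)
  have "maximal_lie_submodule (JD n (n - 1)) W V"
    unfolding maximal_lie_submodule_def
  proof (intro conjI allI impI)
    show "lie_submodule (JD n (n - 1)) W V" "W \<noteq> carrier V"
      using W(1) v0 by auto
    show "U = W \<or> U = carrier V" if U: "lie_submodule (JD n (n - 1)) U V \<and> W \<subseteq> U" for U
    proof (cases "v0 \<in> U")
      case True
      have "U = carrier V"
        using lie_submodule_sub loop_in_submodule U True by (intro J_submodule_generated) auto
      then show ?thesis ..
    next
      case False
      then have "U \<in> ?A"
        using U W(1) by auto
      then show ?thesis
        using W(2) U by simp
    qed
  qed
  then show ?thesis
    using that W(1) by blast
qed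

text \<open>Both sides are linear in \<open>x\<close>, so the monomials, which commute with
  \<open>z i\<close>, and the \<open>d_elt j\<close> suffice. On the Cartan part the formula says
  that \<open>z i\<close> adds \<open>k i\<close> times the coordinate functional of
  \<open>d_elt i\<close> to a weight.\<close>

lemma act_z:
  assumes i: "i \<in> {1..n-1}" and x: "x \<in> JD n 0" and v: "v \<in> carrier V"
  shows "act V x (z i v) =
    z i (act V x v) \<oplus> (of_int (k i) * Poly_Mapping.lookup (snd x) i) \<odot> z i v"
  using x
proof (induction rule: JD_induct[where sc = sc])
  case (loop m G)
  then show ?case
    using loop_z[OF i J_part_single[OF loop] v] z_closed[OF i v]
      z_closed[OF i endo_closed[OF endo_JD[OF JD_loop[OF J_part_single[OF loop]]] v]]
    by simp
next
  case (d c j)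
  then have j: "j \<in> {1..n}"
    by simp
  have cl: "z i v \<in> carrier V" "act V (d_elt j) v \<in> carrier V"
    using z_closed[OF i v] endo_closed[OF endo_JD[OF d_JD[OF j]] v] by auto
  have "act V (JD_scale sc c (d_elt j)) (z i v) = c \<odot> act V (d_elt j) (z i v)"
    using cl j by (intro act_scale d_JD)
  also have "\<dots> = z i (c \<odot> act V (d_elt j) v) \<oplus> (c * (if j = i then of_int (k i) else 0)) \<odot> z i v"
    using d_z[OF i j v] cl z_closed[OF i cl(2)]
    by (simp add: scale_add_right endo_scale[OF endo_z[OF i]])
  also have "c \<odot> act V (d_elt j) v = act V (JD_scale sc c (d_elt j)) v"
    using v j by (intro act_scale[symmetric] d_JD)
  also have "c * (if j = i then of_int (k i) else 0) =
      of_int (k i) * Poly_Mapping.lookup (snd (JD_scale sc c (d_elt j))) i"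
    by (simp add: JD_scale_d_elt lookup_single when_def)
  finally show ?case .
next
  case (add x y)
  have cl: "z i v \<in> carrier V" "act V x v \<in> carrier V" "act V y v \<in> carrier V"
    "z i (act V x v) \<in> carrier V" "z i (act V y v) \<in> carrier V"
    using z_closed[OF i] endo_closed[OF endo_JD _] add.hyps v by auto
  show ?case
    using add cl v
    by (simp add: act_add endo_add[OF endo_z[OF i]] lookup_add ring_distribs scale_add M.a_ac)
qed

end

section \<open>Weight modules\<close>

lemma cartan_part_JD: "x \<in> cartan_part n j H \<Longrightarrow> x \<in> JD n j"
  by (auto simp: cartan_part_def JD_eq J_part_single zero_A_expo)

lemma cartan_part_mono: "j \<le> l \<Longrightarrow> cartan_part n l H \<subseteq> cartan_part n j H"
  unfolding cartan_part_def D_part_def by fastforce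

lemma cartan_part_d:
  assumes "0 \<in> H" "d \<in> D_part n j"
  shows "(0, d) \<in> cartan_part n j H"
proof -
  have "(0, d) = (Poly_Mapping.single 0 (Poly_Mapping.single 0 0, 0), d)"
    by (simp flip: zero_prod_def)
  then show ?thesis
    unfolding cartan_part_def using assms by blast
qed

lemma cartan_part_d_elt: "0 \<in> H \<Longrightarrow> i \<in> {j+1..n} \<Longrightarrow> d_elt i \<in> cartan_part n j H"
  unfolding d_elt_def by (rule cartan_part_d) (auto simp: D_part_def)

section \<open>Weights of \<open>V\<close> and their shifts under the \<open>z i\<close>\<close>

locale weight_JD_module = central_JD_module V sc br form n z k v0 c0
  for V :: "('g::ab_group_add loopD, 'v) lie_mod" (structure) and sc br form n z k v0 c0 +
  fixes H :: "'g set"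
  assumes zero_H: "0 \<in> H"
    and H_add: "\<And>x y. x \<in> H \<Longrightarrow> y \<in> H \<Longrightarrow> x + y \<in> H"
    and H_scale: "\<And>c x. x \<in> H \<Longrightarrow> sc c x \<in> H"
    and weight: "weight_module (JD_scale sc) (cartan_part n 0 H) V"
    and fin_dim: "finite_dim_weight_spaces (JD_scale sc) (cartan_part n 0 H) V"
begin

abbreviation h :: "nat \<Rightarrow> 'g loopD set"
  where "h j \<equiv> cartan_part n j H"

abbreviation dual :: "nat \<Rightarrow> ('g loopD \<Rightarrow> complex) set"
  where "dual j \<equiv> dual_space (JD_scale sc) (h j)"

abbreviation wspace :: "('g loopD \<Rightarrow> complex) \<Rightarrow> 'v set"
  where "wspace \<equiv> weight_space (h 0) V"

lemma h_mono: "h (n - 1) \<subseteq> h 0"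
  by (rule cartan_part_mono) simp

lemma h_JD: "x \<in> h 0 \<Longrightarrow> x \<in> JD n 0"
  by (rule cartan_part_JD)

lemma h_add:
  assumes "x \<in> h j" "y \<in> h j"
  shows "x + y \<in> h j"
proof -
  obtain u c d where x: "u \<in> H" "d \<in> D_part n j"
    "x = (Poly_Mapping.single 0 (Poly_Mapping.single 0 u, c), d)"
    using assms(1) by (auto simp: cartan_part_def)
  obtain u' c' d' where y: "u' \<in> H" "d' \<in> D_part n j"
    "y = (Poly_Mapping.single 0 (Poly_Mapping.single 0 u', c'), d')"
    using assms(2) by (auto simp: cartan_part_def)
  have "x + y = (Poly_Mapping.single 0 (Poly_Mapping.single 0 (u + u'), c + c'), d + d')"
    by (simp add: x y single_add[symmetric])
  then show ?thesis
    unfolding cartan_part_def using x y H_add D_part_add by blast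
qed

lemma h_scale:
  assumes "x \<in> h j"
  shows "JD_scale sc c x \<in> h j"
proof -
  interpret lie_algebra sc br by (rule lie)
  obtain u a d where x: "u \<in> H" "d \<in> D_part n j"
    "x = (Poly_Mapping.single 0 (Poly_Mapping.single 0 u, a), d)"
    using assms(1) by (auto simp: cartan_part_def)
  have "Poly_Mapping.map (sc c) (Poly_Mapping.single 0 u) = Poly_Mapping.single 0 (sc c u)"
    by (rule poly_mapping_eqI) (auto simp: map.rep_eq lookup_single when_def)
  then have "JD_scale sc c x = (Poly_Mapping.single 0 (Poly_Mapping.single 0 (sc c u), c * a),
      Poly_Mapping.map ((*) c) d)"
    by (simp add: x JD_scale_def loop_scale_single aff_scale_def)
  then show ?thesis
    unfolding cartan_part_def using x H_scale D_part_scale by blast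
qed

lemma d_h: "i \<in> {1..n} \<Longrightarrow> d_elt i \<in> h 0"
  using zero_H by (intro cartan_part_d_elt) auto

lemma dualD:
  assumes "\<omega> \<in> dual j" "x \<in> h j"
  shows dual_add: "y \<in> h j \<Longrightarrow> \<omega> (x + y) = \<omega> x + \<omega> y"
    and dual_scale: "\<omega> (JD_scale sc c x) = c * \<omega> x"
  using assms by (auto simp: dual_space_def)

lemma restrict_dual: "\<omega> \<in> dual 0 \<Longrightarrow> restrict \<omega> (h (n - 1)) \<in> dual (n - 1)"
  using subsetD[OF h_mono] h_add[of _ "n - 1"] h_scale[of _ "n - 1"]
  by (simp add: dual_space_def)

lemma wspaceD:
  assumes "v \<in> wspace \<omega>"
  shows wspace_carrier: "v \<in> carrier V"
    and wspace_act: "x \<in> h 0 \<Longrightarrow> act V x v = \<omega> x \<odot> v"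
  using assms by (auto simp: weight_space_def)

lemma weight_spaces_span:
  assumes U: "sub U" "\<And>\<omega>. \<omega> \<in> dual 0 \<Longrightarrow> wspace \<omega> \<subseteq> U"
  shows "U = carrier V"
proof -
  have "v \<in> U" if v: "v \<in> carrier V" for v
  proof -
    obtain f where f: "\<And>\<mu>. \<mu> \<in> dual 0 \<Longrightarrow> f \<mu> \<in> wspace \<mu>" "\<And>\<mu>. \<mu> \<notin> dual 0 \<Longrightarrow> f \<mu> = \<zero>"
      "v = (\<Oplus>\<mu>\<in>{\<mu>. f \<mu> \<noteq> \<zero>}. f \<mu>)"
      using weight v unfolding weight_module_def by blast
    have "f \<mu> \<in> U" for \<mu>
      using f(1,2)[of \<mu>] U sub_zero[OF U(1)] by (cases "\<mu> \<in> dual 0") auto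
    then show ?thesis
      unfolding f(3) by (intro sub_finsum[OF U(1)])
  qed
  then show ?thesis
    using sub_subset[OF U(1)] by blast
qed

text \<open>The added term is \<open>a\<close> times the coordinate functional of
  \<open>d_elt i\<close>; the restriction keeps the result extensional, as \<open>dual_space\<close>
  requires.\<close>

definition shift_weight :: "nat \<Rightarrow> complex \<Rightarrow> ('g loopD \<Rightarrow> complex) \<Rightarrow> 'g loopD \<Rightarrow> complex"
  where "shift_weight i a \<omega> = restrict (\<lambda>x. \<omega> x + a * Poly_Mapping.lookup (snd x) i) (h 0)"

lemma shift_weight_dual: "\<omega> \<in> dual 0 \<Longrightarrow> shift_weight i a \<omega> \<in> dual 0"
proof -
  assume w: "\<omega> \<in> dual 0"
  have "Poly_Mapping.lookup (snd (JD_scale sc c x)) i = c * Poly_Mapping.lookup (snd x) i" for c x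
    by (simp add: JD_scale_def map.rep_eq when_def)
  then show ?thesis
    using w by (simp add: dual_space_def shift_weight_def h_add h_scale lookup_add algebra_simps)
qed

lemma shift_weight_shift_weight:
  "shift_weight i a (shift_weight i b \<omega>) = shift_weight i (b + a) \<omega>"
  by (auto simp: shift_weight_def restrict_def algebra_simps)

lemma shift_weight_zero: "\<omega> \<in> dual 0 \<Longrightarrow> shift_weight i 0 \<omega> = \<omega>"
  by (auto simp: shift_weight_def dual_space_def extensional_restrict)

lemma shift_weight_d_elt:
  "j \<in> {1..n} \<Longrightarrow> shift_weight i a \<omega> (d_elt j) = \<omega> (d_elt j) + (if j = i then a else 0)"
  using d_h by (simp add: shift_weight_def d_elt_def lookup_single when_def)

text \<open>Elements of \<open>h (n - 1)\<close> have no degree coordinate except the one of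
  \<open>d_elt n\<close>, so the added term vanishes on them. Thus applying \<open>z i\<close> does
  not leave the weight seen in the quotient.\<close>

lemma shift_weight_restrict:
  assumes "i \<in> {1..n-1}"
  shows "restrict (shift_weight i a \<omega>) (h (n - 1)) = restrict \<omega> (h (n - 1))"
proof (rule restrict_ext)
  fix x assume x: "x \<in> h (n - 1)"
  then have "Poly_Mapping.keys (snd x) \<subseteq> {n..n}"
    using n_ge_2 by (auto simp: cartan_part_def D_part_def)
  then have "Poly_Mapping.lookup (snd x) i = 0"
    using assms by (auto simp: in_keys_iff)
  then show "shift_weight i a \<omega> x = \<omega> x"
    using x h_mono by (auto simp: shift_weight_def)
qed

lemma z_wspace:
  assumes i: "i \<in> {1..n-1}" and v: "v \<in> wspace \<omega>"
  shows "z i v \<in> wspace (shift_weight i (of_int (k i)) \<omega>)"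
proof -
  have "act V x (z i v) = shift_weight i (of_int (k i)) \<omega> x \<odot> z i v" if x: "x \<in> h 0" for x
    using act_z[OF i h_JD[OF x] wspace_carrier[OF v]] x wspace_act[OF v x] wspace_carrier[OF v]
      z_closed[OF i wspace_carrier[OF v]]
    by (simp add: shift_weight_def endo_scale[OF endo_z[OF i]] scale_add)
  then show ?thesis
    using z_closed[OF i wspace_carrier[OF v]] by (simp add: weight_space_def)
qed

text \<open>Surjectivity provides the preimage. Solving \<open>act_z\<close> for
  \<open>z i (act V x u)\<close> and cancelling \<open>z i\<close> by injectivity determines its
  weight.\<close>

lemma z_wspace_inv:
  assumes i: "i \<in> {1..n-1}" and v: "v \<in> wspace \<omega>"
  obtains u where "u \<in> wspace (shift_weight i (- of_int (k i)) \<omega>)" "v = z i u"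
proof -
  have bij: "bij_betw (z i) (carrier V) (carrier V)"
    using central_auto_bij[OF z[OF i]] .
  obtain u where u: "u \<in> carrier V" "v = z i u"
    using bij wspace_carrier[OF v] by (auto simp: bij_betw_def)
  have vc: "v \<in> carrier V"
    using wspace_carrier[OF v] .
  have "act V x u = shift_weight i (- of_int (k i)) \<omega> x \<odot> u" if x: "x \<in> h 0" for x
  proof -
    let ?a = "of_int (k i) * Poly_Mapping.lookup (snd x) i"
    have xu: "act V x u \<in> carrier V"
      using endo_closed[OF endo_JD[OF h_JD[OF x]] u(1)] .
    have "\<omega> x \<odot> v = z i (act V x u) \<oplus> ?a \<odot> v"
      using act_z[OF i h_JD[OF x] u(1)] wspace_act[OF v x] u(2) by simp
    then have "z i (act V x u) = \<omega> x \<odot> v \<ominus> ?a \<odot> v"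
      using z_closed[OF i xu] vc by (simp add: M.minus_eq M.a_assoc M.r_neg)
    also have "\<dots> = z i ((\<omega> x - ?a) \<odot> u)"
      using u vc by (simp add: scale_diff endo_diff[OF endo_z[OF i]] endo_scale[OF endo_z[OF i]])
    finally have "act V x u = (\<omega> x - ?a) \<odot> u"
      using inj_onD[OF bij_betw_imp_inj_on[OF bij]] xu u(1) by simp
    then show ?thesis
      using x by (simp add: shift_weight_def)
  qed
  then have "u \<in> wspace (shift_weight i (- of_int (k i)) \<omega>)"
    using u(1) by (simp add: weight_space_def)
  then show ?thesis
    using that u(2) by blast
qed

text \<open>A fundamental domain for changing the \<open>d_elt i\<close>-eigenvalue by multiples of
  \<open>k i\<close>, imposed on the first \<open>j\<close> coordinates so that they can be reduced
  one after another.\<close>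

definition reduced :: "nat \<Rightarrow> ('g loopD \<Rightarrow> complex) \<Rightarrow> bool"
  where "reduced j \<omega> \<longleftrightarrow>
    (\<forall>i\<in>{1..j}. \<omega> (d_elt i) \<in> (\<lambda>m. c0 i + of_int m) ` {0..<k i})"

end

section \<open>Reduction of weights modulo \<open>W\<close>\<close>

locale shift_submodule = weight_JD_module V sc br form n z k v0 c0 H
  for V :: "('g::ab_group_add loopD, 'v) lie_mod" (structure) and sc br form n z k v0 c0 H +
  fixes W :: "'v set"
  assumes lie_W: "lie_submodule (JD n (n - 1)) W V"
    and shifts_W: "shifts (n - 1) \<subseteq> W"
begin

lemma sub_W: "sub W"
  by (rule lie_submodule_sub[OF lie_W])

lemma diff_trans:
  assumes "u \<in> carrier V" "v \<in> carrier V" "w \<in> carrier V" "u \<ominus> v \<in> W" "v \<ominus> w \<in> W"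
  shows "u \<ominus> w \<in> W"
proof -
  have "W +> u = W +> w"
    using assms coset_eq_iff[OF sub_W] by metis
  then show ?thesis
    using assms coset_eq_iff[OF sub_W] by metis
qed

text \<open>Each application of \<open>z i\<close> or of its inverse moves the weight by one period
  \<open>k i\<close> and changes the vector by an element of \<open>W\<close>; the integer induction
  walks in both directions.\<close>

lemma shift_weight_multiple:
  assumes i: "i \<in> {1..n-1}" and l: "\<omega> \<in> dual 0" and v: "v \<in> wspace \<omega>"
  shows "\<exists>u\<in>wspace (shift_weight i (of_int (a * k i)) \<omega>). v \<ominus> u \<in> W"
proof (induction a rule: int_induct[where k = 0])
  case base
  have "v \<ominus> v \<in> W"
    using sub_zero[OF sub_W] diff_eq_zero_iff[of v v] wspace_carrier[OF v] by simp
  then show ?case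
    using v l by (intro bexI[of _ v]) (simp_all add: shift_weight_zero)
next
  case (step1 a)
  then obtain u where u: "u \<in> wspace (shift_weight i (of_int (a * k i)) \<omega>)" "v \<ominus> u \<in> W"
    by blast
  have zu: "z i u \<in> wspace (shift_weight i (of_int ((a + 1) * k i)) \<omega>)"
    using z_wspace[OF i u(1)] by (simp add: shift_weight_shift_weight algebra_simps)
  have cl: "u \<in> carrier V" "z i u \<in> carrier V"
    using wspace_carrier u(1) zu by blast+
  have "z i u \<ominus> u \<in> W"
    using shift_in_shifts[OF i cl(1)] shifts_W by blast
  then have "u \<ominus> z i u \<in> W"
    using coset_eq_iff[OF sub_W] cl by metis
  then have "v \<ominus> z i u \<in> W"
    using diff_trans[OF wspace_carrier[OF v] cl] u(2) by blast
  then show ?case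
    using zu by blast
next
  case (step2 a)
  then obtain u where u: "u \<in> wspace (shift_weight i (of_int (a * k i)) \<omega>)" "v \<ominus> u \<in> W"
    by blast
  obtain w where w: "w \<in> wspace (shift_weight i (- of_int (k i)) (shift_weight i (of_int (a * k i)) \<omega>))"
    "u = z i w"
    by (rule z_wspace_inv[OF i u(1)])
  have w': "w \<in> wspace (shift_weight i (of_int ((a - 1) * k i)) \<omega>)"
    using w(1) by (simp add: shift_weight_shift_weight algebra_simps)
  have cl: "u \<in> carrier V" "w \<in> carrier V"
    using wspace_carrier u(1) w' by blast+
  have "u \<ominus> w \<in> W"
    unfolding w(2) using shift_in_shifts[OF i cl(2)] shifts_W by blast
  then have "v \<ominus> w \<in> W"
    using diff_trans[OF wspace_carrier[OF v] cl] u(2) by blast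
  then show ?case
    using w' by blast
qed

lemma reduce_weight:
  assumes l: "\<omega> \<in> dual 0" and v: "v \<in> wspace \<omega>" "v \<notin> W" and j: "j \<le> n - 1"
  shows "\<exists>\<mu>\<in>dual 0. restrict \<mu> (h (n - 1)) = restrict \<omega> (h (n - 1)) \<and> reduced j \<mu> \<and>
    (\<exists>u\<in>wspace \<mu>. v \<ominus> u \<in> W)"
  using j
proof (induction j)
  case 0
  have "v \<ominus> v \<in> W"
    using sub_zero[OF sub_W] wspace_carrier[OF v(1)] diff_eq_zero_iff[of v v] by simp
  then show ?case
    using l v(1) by (intro bexI[of _ \<omega>] conjI) (auto simp: reduced_def)
next
  case (Suc j)
  then have "j \<le> n - 1"
    by simp
  from Suc.IH[OF this] obtain \<mu> u where \<mu>: "\<mu> \<in> dual 0" "restrict \<mu> (h (n - 1)) = restrict \<omega> (h (n - 1))"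
    "reduced j \<mu>" "u \<in> wspace \<mu>" "v \<ominus> u \<in> W"
    by blast
  let ?i = "Suc j"
  have i: "?i \<in> {1..n-1}" "?i \<in> {1..n}"
    using Suc.prems by auto
  have vc: "v \<in> carrier V" and uc: "u \<in> carrier V"
    using v(1) \<mu>(4) wspace_carrier by blast+
  \<comment> \<open>A vector outside \<open>W\<close> is not congruent to zero. Only non-zero
    eigenvectors have their eigenvalue confined to the coset of \<open>c0 ?i\<close>.\<close>
  have "u \<noteq> \<zero>"
    using \<mu>(5) v(2) vc by (auto simp: diff_zero)
  then have "\<mu> (d_elt ?i) - c0 ?i \<in> \<int>"
    using eigenvalue_Ints[OF i(1) uc] wspace_act[OF \<mu>(4) d_h[OF i(2)]] by blast
  then obtain m where m: "\<mu> (d_elt ?i) - c0 ?i = of_int m"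
    by (auto elim: Ints_cases)
  \<comment> \<open>Removing \<open>m div k ?i\<close> periods leaves the remainder
    \<open>m mod k ?i\<close>, which lies in the fundamental domain because \<open>k ?i\<close> is
    positive.\<close>
  let ?a = "- (m div k ?i)"
  let ?\<nu> = "shift_weight ?i (of_int (?a * k ?i)) \<mu>"
  obtain w where w: "w \<in> wspace ?\<nu>" "u \<ominus> w \<in> W"
    using shift_weight_multiple[OF i(1) \<mu>(1,4), of ?a] by blast
  have "?\<nu> (d_elt ?i) = c0 ?i + of_int (m mod k ?i)"
  proof -
    have "m + ?a * k ?i = m mod k ?i"
      by (simp add: minus_div_mult_eq_mod)
    then have "of_int m + of_int (?a * k ?i) = (of_int (m mod k ?i) :: complex)"
      by (metis of_int_add)
    then show ?thesis
      using m shift_weight_d_elt[OF i(2), of ?i "of_int (?a * k ?i)" \<mu>] by (simp add: algebra_simps)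
  qed
  moreover have "m mod k ?i \<in> {0..<k ?i}"
    using k_pos[OF i(1)] by simp
  ultimately have "?\<nu> (d_elt ?i) \<in> (\<lambda>m. c0 ?i + of_int m) ` {0..<k ?i}"
    by blast
  moreover have "?\<nu> (d_elt l) = \<mu> (d_elt l)" if "l \<in> {1..j}" for l
    using that i by (subst shift_weight_d_elt) auto
  ultimately have "reduced ?i ?\<nu>"
    using \<mu>(3) unfolding reduced_def by (auto simp: atLeastAtMostSuc_conv)
  moreover have "v \<ominus> w \<in> W"
    using diff_trans[OF vc uc wspace_carrier[OF w(1)] \<mu>(5) w(2)] .
  ultimately show ?case
    using shift_weight_dual[OF \<mu>(1)] shift_weight_restrict[OF i(1)] \<mu>(2) w(1)
    by (intro bexI[of _ ?\<nu>]) auto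
qed

section \<open>Finiteness of the reduced weights over a given weight of the quotient\<close>

definition reduced_weights :: "('g loopD \<Rightarrow> complex) \<Rightarrow> ('g loopD \<Rightarrow> complex) set"
  where "reduced_weights \<nu> = {\<omega> \<in> dual 0. reduced (n - 1) \<omega> \<and> restrict \<omega> (h (n - 1)) = \<nu>}"

text \<open>\<open>h 0\<close> is spanned by \<open>h (n - 1)\<close> and the \<open>d_elt i\<close>
  with \<open>i < n\<close>.\<close>

lemma weight_determined:
  assumes l: "\<omega> \<in> dual 0" "\<mu> \<in> dual 0" and eq: "restrict \<omega> (h (n - 1)) = restrict \<mu> (h (n - 1))"
    and d: "\<And>i. i \<in> {1..n-1} \<Longrightarrow> \<omega> (d_elt i) = \<mu> (d_elt i)"
  shows "\<omega> = \<mu>"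
proof (rule extensionalityI[of _ "h 0"])
  show "\<omega> \<in> extensional (h 0)" "\<mu> \<in> extensional (h 0)"
    using l by (auto simp: dual_space_def)
  have eq': "\<omega> x = \<mu> x" if "x \<in> h (n - 1)" for x
    using fun_cong[OF eq, of x] that by simp
  have d': "\<omega> (d_elt i) = \<mu> (d_elt i)" if "i \<in> {1..n}" for i
  proof (cases "i = n")
    case True
    have "d_elt n \<in> h (n - 1)"
      using n_ge_2 zero_H by (intro cartan_part_d_elt) auto
    then show ?thesis
      using True eq' by simp
  next
    case False
    then show ?thesis
      using that by (intro d) auto
  qed
  fix x assume "x \<in> h 0"
  then obtain F e where x: "x = (F, e)" "(F, 0) \<in> h (n - 1)" "e \<in> D_part n 0"
    by (auto simp: cartan_part_def D_part_zero)
  \<comment> \<open>Membership in \<open>h 0\<close> is carried along because weights are known to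
    be additive only there.\<close>
  let ?P = "\<lambda>x. x \<in> h 0 \<and> \<omega> x = \<mu> x"
  have "?P (0, \<Sum>i\<in>Poly_Mapping.keys e. Poly_Mapping.single i (Poly_Mapping.lookup e i))"
  proof (rule sum_induct_closed[where P = "\<lambda>e. ?P (0, e)"])
    have z: "(0, 0) \<in> h j" for j
      by (rule cartan_part_d[OF zero_H D_part_zero])
    show "?P (0, 0)"
      using z eq' by simp
    show "?P (0, a + b)" if ab: "?P (0, a)" "?P (0, b)" for a b
    proof -
      have "(0, a) + (0, b) \<in> h 0"
        using ab by (intro h_add) auto
      moreover have "\<omega> ((0, a) + (0, b)) = \<mu> ((0, a) + (0, b))"
        using ab dual_add[OF l(1), of "(0, a)" "(0, b)"] dual_add[OF l(2), of "(0, a)" "(0, b)"]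
        by simp
      ultimately show ?thesis
        by simp
    qed
    show "?P (0, Poly_Mapping.single i (Poly_Mapping.lookup e i))" if "i \<in> Poly_Mapping.keys e" for i
    proof -
      have i: "i \<in> {1..n}"
        using that x(3) by (auto simp: D_part_def)
      show ?thesis
        unfolding JD_scale_d_elt[symmetric, of _ _ sc]
        using h_scale[OF d_h[OF i]] dual_scale[OF l(1) d_h[OF i]] dual_scale[OF l(2) d_h[OF i]] d'[OF i]
        by simp
    qed
  qed
  then have e: "?P (0, e)"
    by (simp add: poly_mapping_sum_single)
  have "\<omega> ((F, 0) + (0, e)) = \<mu> ((F, 0) + (0, e))"
    using e eq'[OF x(2)] subsetD[OF h_mono x(2)] dual_add[OF l(1), of "(F, 0)" "(0, e)"]
      dual_add[OF l(2), of "(F, 0)" "(0, e)"] by simp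
  then show "\<omega> x = \<mu> x"
    by (simp add: x(1))
qed

text \<open>By \<open>weight_determined\<close> such a weight is recovered from its tuple of values
  at the \<open>d_elt i\<close> with \<open>i < n\<close>, and being reduced leaves
  \<open>k i\<close> possibilities for each entry.\<close>

lemma finite_reduced_weights: "finite (reduced_weights \<nu>)"
proof -
  let ?c = "\<lambda>\<omega>. restrict (\<lambda>i. \<omega> (d_elt i)) {1..n-1}"
  have "?c ` reduced_weights \<nu> \<subseteq> (\<Pi>\<^sub>E i\<in>{1..n-1}. (\<lambda>m. c0 i + of_int m) ` {0..<k i})"
    by (auto simp: reduced_weights_def reduced_def)
  then have "finite (?c ` reduced_weights \<nu>)"
    by (rule finite_subset) (intro finite_PiE finite_imageI; simp)
  moreover have "inj_on ?c (reduced_weights \<nu>)"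
  proof (rule inj_onI)
    fix \<omega> \<mu> assume a: "\<omega> \<in> reduced_weights \<nu>" "\<mu> \<in> reduced_weights \<nu>" "?c \<omega> = ?c \<mu>"
    have d: "\<omega> (d_elt i) = \<mu> (d_elt i)" if "i \<in> {1..n-1}" for i
      using fun_cong[OF a(3), of i] that by (simp only: restrict_apply if_True)
    have eq: "\<omega> \<in> dual 0" "\<mu> \<in> dual 0" "restrict \<omega> (h (n - 1)) = restrict \<mu> (h (n - 1))"
      using a(1,2) by (simp_all only: reduced_weights_def mem_Collect_eq)
    show "\<omega> = \<mu>"
      by (rule weight_determined[OF eq d])
  qed
  ultimately show ?thesis
    by (rule finite_imageD)
qed

section \<open>Weight decomposition of the quotient\<close>

sublocale quotient_space V W
  by (intro quotient_space.intro quotient_space_axioms.intro cspace_axioms sub_W)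

lemma lie_module_sub: "lie_module (JD_scale sc) (JD_bracket n sc br form) (JD n (n - 1)) V"
  using lie_module_subset[OF lie_module_JD JD_mono] by simp

lemma lie_module_Q: "lie_module (JD_scale sc) (JD_bracket n sc br form) (JD n (n - 1)) Q"
  by (rule lie_module_quotient[OF lie_module_sub lie_W])
    (auto intro: JD_add JD_scale_closed JD_bracket_closed)

lemma endo_Q: "x \<in> h (n - 1) \<Longrightarrow> Q.endo (act Q x)"
  by (rule endo_act[OF lie_module_Q cartan_part_JD])

lemma act_Q_proj: "x \<in> h (n - 1) \<Longrightarrow> v \<in> carrier V \<Longrightarrow> act Q x (proj v) = proj (act V x v)"
  by (rule act_in_quotient[OF lie_module_sub lie_W cartan_part_JD])

abbreviation wspace_Q :: "('g loopD \<Rightarrow> complex) \<Rightarrow> 'v set set"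
  where "wspace_Q \<equiv> weight_space (h (n - 1)) Q"

lemma sub_wspace_Q: "Q.sub (wspace_Q \<nu>)"
proof (rule Q.subI)
  show "wspace_Q \<nu> \<subseteq> carrier Q" "\<zero>\<^bsub>Q\<^esub> \<in> wspace_Q \<nu>"
    using Q.endo_zero[OF endo_Q] by (auto simp: weight_space_def)
  show "C \<oplus>\<^bsub>Q\<^esub> C' \<in> wspace_Q \<nu>" if "C \<in> wspace_Q \<nu>" "C' \<in> wspace_Q \<nu>" for C C'
    using that Q.endo_add[OF endo_Q] by (auto simp: weight_space_def Q.scale_add_right)
  show "c \<odot>\<^bsub>Q\<^esub> C \<in> wspace_Q \<nu>" if "C \<in> wspace_Q \<nu>" for c C
    using that Q.endo_scale[OF endo_Q] by (auto simp: weight_space_def mult.commute)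
qed

text \<open>A chosen finite spanning set in the sense of \<open>finite_dim_subspace\<close>,
  meaningful for weights in \<open>dual 0\<close>.\<close>

definition wbasis :: "('g loopD \<Rightarrow> complex) \<Rightarrow> 'v set"
  where "wbasis \<omega> = (SOME B. finite B \<and> B \<subseteq> wspace \<omega> \<and>
    (\<forall>v\<in>wspace \<omega>. \<exists>c. v = (\<Oplus>b\<in>B. c b \<odot> b)))"

lemma
  assumes "\<omega> \<in> dual 0"
  shows finite_wbasis: "finite (wbasis \<omega>)"
    and wbasis_wspace: "wbasis \<omega> \<subseteq> wspace \<omega>"
    and wbasis_spans: "\<And>v. v \<in> wspace \<omega> \<Longrightarrow> \<exists>c. v = (\<Oplus>b\<in>wbasis \<omega>. c b \<odot> b)"
proof -
  have "\<exists>B. finite B \<and> B \<subseteq> wspace \<omega> \<and> (\<forall>v\<in>wspace \<omega>. \<exists>c. v = (\<Oplus>b\<in>B. c b \<odot> b))"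
    using fin_dim assms unfolding finite_dim_weight_spaces_def finite_dim_subspace_def by blast
  from someI_ex[OF this] show "finite (wbasis \<omega>)" "wbasis \<omega> \<subseteq> wspace \<omega>"
    and "\<And>v. v \<in> wspace \<omega> \<Longrightarrow> \<exists>c. v = (\<Oplus>b\<in>wbasis \<omega>. c b \<odot> b)"
    unfolding wbasis_def[symmetric] by blast+
qed

text \<open>All reduced weights over \<open>\<nu>\<close> contribute, since different weights of
  \<open>V\<close> may have the same restriction to \<open>h (n - 1)\<close>.\<close>

definition generators_Q :: "('g loopD \<Rightarrow> complex) \<Rightarrow> 'v set set"
  where "generators_Q \<nu> = (\<Union>\<omega>\<in>reduced_weights \<nu>. proj ` wbasis \<omega>)"

lemma reduced_weights_dual: "\<omega> \<in> reduced_weights \<nu> \<Longrightarrow> \<omega> \<in> dual 0"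
  by (simp add: reduced_weights_def)

lemma finite_generators_Q: "finite (generators_Q \<nu>)"
  unfolding generators_Q_def
  by (intro finite_UN_I finite_reduced_weights finite_imageI finite_wbasis reduced_weights_dual)

lemma proj_wspace:
  assumes "\<omega> \<in> reduced_weights \<nu>" "v \<in> wspace \<omega>"
  shows "proj v \<in> wspace_Q \<nu>"
proof -
  have vc: "v \<in> carrier V"
    using wspace_carrier[OF assms(2)] .
  have "act Q x (proj v) = \<nu> x \<odot>\<^bsub>Q\<^esub> proj v" if x: "x \<in> h (n - 1)" for x
  proof -
    have "restrict \<omega> (h (n - 1)) = \<nu>"
      using assms(1) by (simp only: reduced_weights_def mem_Collect_eq)
    then have "\<nu> x = \<omega> x"
      using x by (metis restrict_apply')
    then show ?thesis
      using wspace_act[OF assms(2) subsetD[OF h_mono x]] by (simp add: act_Q_proj[OF x vc] scale_Q vc)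
  qed
  then show ?thesis
    using vc by (simp add: weight_space_def)
qed

lemma generators_Q_wspace: "generators_Q \<nu> \<subseteq> wspace_Q \<nu>"
  using proj_wspace wbasis_wspace[OF reduced_weights_dual] unfolding generators_Q_def by blast

lemma generators_Q_carrier: "generators_Q \<nu> \<subseteq> carrier Q"
  using generators_Q_wspace Q.sub_subset[OF sub_wspace_Q] by blast

lemma span_generators_Q: "Q.lspan (generators_Q \<nu>) \<subseteq> wspace_Q \<nu>"
  by (rule Q.lspan_minimal[OF sub_wspace_Q generators_Q_wspace])

lemma sub_span_generators_Q: "Q.sub (Q.lspan (generators_Q \<nu>))"
  by (rule Q.sub_lspan[OF generators_Q_carrier])

text \<open>Restrictions of weights are functionals on \<open>h (n - 1)\<close>, so no reduced
  weight lies over any other \<open>\<nu>\<close>. This supplies the zero components that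
  \<open>weight_module\<close> demands off the dual space.\<close>

lemma span_generators_Q_outside:
  assumes "\<nu> \<notin> dual (n - 1)"
  shows "Q.lspan (generators_Q \<nu>) \<subseteq> {\<zero>\<^bsub>Q\<^esub>}"
proof (rule Q.lspan_minimal[OF Q.sub_singleton_zero])
  have "reduced_weights \<nu> = {}"
    using assms restrict_dual unfolding reduced_weights_def by blast
  then show "generators_Q \<nu> \<subseteq> {\<zero>\<^bsub>Q\<^esub>}"
    by (simp add: generators_Q_def)
qed

lemma proj_wspace_span:
  assumes \<omega>: "\<omega> \<in> reduced_weights \<nu>" and v: "v \<in> wspace \<omega>"
  shows "proj v \<in> Q.lspan (generators_Q \<nu>)"
proof -
  let ?U = "{u \<in> carrier V. proj u \<in> Q.lspan (generators_Q \<nu>)}"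
  have U: "sub ?U"
    by (rule sub_proj_vimage[OF sub_span_generators_Q])
  have "b \<in> ?U" if "b \<in> wbasis \<omega>" for b
  proof -
    have "proj b \<in> generators_Q \<nu>"
      using that \<omega> unfolding generators_Q_def by blast
    then have "proj b \<in> Q.lspan (generators_Q \<nu>)"
      using Q.lspan_superset by blast
    moreover have "b \<in> carrier V"
      using that wbasis_wspace[OF reduced_weights_dual[OF \<omega>]] wspace_carrier by blast
    ultimately show ?thesis
      by simp
  qed
  then have "(\<Oplus>b\<in>wbasis \<omega>. c b \<odot> b) \<in> ?U" for c
    by (intro sub_finsum[OF U] sub_scale[OF U])
  moreover obtain c where "v = (\<Oplus>b\<in>wbasis \<omega>. c b \<odot> b)"
    using wbasis_spans[OF reduced_weights_dual[OF \<omega>] v] by (rule exE)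
  ultimately have "v \<in> ?U"
    by simp
  then show ?thesis
    by simp
qed

text \<open>The preimage in \<open>V\<close> of the sum on the right is a subspace, so weight
  vectors of \<open>V\<close> suffice. Modulo \<open>W\<close> each of them is zero or congruent to
  a vector of reduced weight, whose image is in the span of the generators.\<close>

lemma carrier_Q_family_sums:
  assumes "C \<in> carrier Q"
  shows "C \<in> Q.family_sums (\<lambda>\<nu>. Q.lspan (generators_Q \<nu>))"
proof -
  let ?S = "Q.family_sums (\<lambda>\<nu>. Q.lspan (generators_Q \<nu>))"
  have S: "Q.sub ?S"
    by (rule Q.sub_family_sums[OF sub_span_generators_Q])
  have "{v \<in> carrier V. proj v \<in> ?S} = carrier V"
  proof (rule weight_spaces_span[OF sub_proj_vimage[OF S]])
    fix \<omega> assume \<omega>: "\<omega> \<in> dual 0"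
    show "wspace \<omega> \<subseteq> {v \<in> carrier V. proj v \<in> ?S}"
    proof
      fix v assume v: "v \<in> wspace \<omega>"
      have vc: "v \<in> carrier V"
        using wspace_carrier[OF v] .
      have "proj v \<in> ?S"
      proof (cases "v \<in> W")
        case True
        then show ?thesis
          using proj_eq_zero_iff[OF vc] Q.sub_zero[OF S] by simp
      next
        case False
        obtain \<mu> u where \<mu>: "\<mu> \<in> dual 0" "reduced (n - 1) \<mu>" "u \<in> wspace \<mu>" "v \<ominus> u \<in> W"
          using reduce_weight[OF \<omega> v False order_refl] by blast
        have "proj v = proj u"
          using proj_eq_iff[OF vc wspace_carrier[OF \<mu>(3)]] \<mu>(4) by blast
        also have "proj u \<in> Q.lspan (generators_Q (restrict \<mu> (h (n - 1))))"
          by (rule proj_wspace_span[OF _ \<mu>(3)]) (simp only: reduced_weights_def mem_Collect_eq \<mu>)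
        finally show ?thesis
          by (rule Q.family_sums_superset[where Q = "\<lambda>\<nu>. Q.lspan (generators_Q \<nu>)", OF sub_span_generators_Q])
      qed
      then show "v \<in> {v \<in> carrier V. proj v \<in> ?S}"
        using vc by simp
    qed
  qed
  moreover obtain v where "v \<in> carrier V" "C = proj v"
    using assms by (auto simp: carrier_Q)
  ultimately show ?thesis
    by blast
qed

lemma dual_separated:
  assumes "\<mu> \<in> dual (n - 1)" "\<nu> \<in> dual (n - 1)" "\<mu> \<noteq> \<nu>"
  shows "\<exists>x\<in>h (n - 1). \<mu> x \<noteq> \<nu> x"
  using assms extensionalityI[of \<mu> "h (n - 1)" \<nu>] by (auto simp: dual_space_def)

lemma generator_family:
  assumes "C \<in> carrier Q"
  obtains f where "Q.family f" "\<And>\<nu>. f \<nu> \<in> Q.lspan (generators_Q \<nu>)" "C = Q.fsum f"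
    "\<And>\<nu> x. x \<in> h (n - 1) \<Longrightarrow> act Q x (f \<nu>) = \<nu> x \<odot>\<^bsub>Q\<^esub> f \<nu>"
    "\<And>\<nu>. \<nu> \<notin> dual (n - 1) \<Longrightarrow> f \<nu> = \<zero>\<^bsub>Q\<^esub>"
proof -
  obtain f where f: "Q.family f" "\<And>\<nu>. f \<nu> \<in> Q.lspan (generators_Q \<nu>)" "C = Q.fsum f"
    using carrier_Q_family_sums[OF assms] by (rule Q.family_sumsE) (rule that)
  have "f \<nu> \<in> wspace_Q \<nu>" for \<nu>
    using f(2) span_generators_Q by blast
  then have "act Q x (f \<nu>) = \<nu> x \<odot>\<^bsub>Q\<^esub> f \<nu>" if "x \<in> h (n - 1)" for \<nu> x
    using that unfolding weight_space_def by blast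
  moreover have "f \<nu> = \<zero>\<^bsub>Q\<^esub>" if "\<nu> \<notin> dual (n - 1)" for \<nu>
    using f(2) span_generators_Q_outside[OF that] by blast
  ultimately show ?thesis
    using that[OF f] by blast
qed

text \<open>Existence is \<open>generator_family\<close>. Uniqueness holds because distinct
  functionals on \<open>h (n - 1)\<close> are separated by one of its elements.\<close>

lemma weight_module_Q: "weight_module (JD_scale sc) (h (n - 1)) Q"
  unfolding weight_module_def
proof (intro ballI ex_ex1I)
  fix C assume C: "C \<in> carrier Q"
  obtain f where f: "Q.family f" "\<And>\<nu>. f \<nu> \<in> Q.lspan (generators_Q \<nu>)" "C = Q.fsum f"
    "\<And>\<nu> x. x \<in> h (n - 1) \<Longrightarrow> act Q x (f \<nu>) = \<nu> x \<odot>\<^bsub>Q\<^esub> f \<nu>"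
    "\<And>\<nu>. \<nu> \<notin> dual (n - 1) \<Longrightarrow> f \<nu> = \<zero>\<^bsub>Q\<^esub>"
    by (rule generator_family[OF C]) (rule that)
  show "\<exists>f. (\<forall>\<mu>\<in>dual (n - 1). f \<mu> \<in> wspace_Q \<mu>) \<and> (\<forall>\<mu>. \<mu> \<notin> dual (n - 1) \<longrightarrow> f \<mu> = \<zero>\<^bsub>Q\<^esub>) \<and>
      finite {\<mu>. f \<mu> \<noteq> \<zero>\<^bsub>Q\<^esub>} \<and> C = (\<Oplus>\<^bsub>Q\<^esub>\<mu>\<in>{\<mu>. f \<mu> \<noteq> \<zero>\<^bsub>Q\<^esub>}. f \<mu>)"
  proof (intro exI conjI ballI allI impI)
    show "f \<mu> \<in> wspace_Q \<mu>" for \<mu>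
      using f(2) span_generators_Q by blast
    show "finite {\<mu>. f \<mu> \<noteq> \<zero>\<^bsub>Q\<^esub>}"
      using f(1) by (rule Q.familyD)
    show "C = (\<Oplus>\<^bsub>Q\<^esub>\<mu>\<in>{\<mu>. f \<mu> \<noteq> \<zero>\<^bsub>Q\<^esub>}. f \<mu>)"
      using f(3) unfolding Q.fsum_def .
  qed (rule f(5))
next
  fix C f g
  let ?dec = "\<lambda>f. (\<forall>\<mu>\<in>dual (n - 1). f \<mu> \<in> wspace_Q \<mu>) \<and> (\<forall>\<mu>. \<mu> \<notin> dual (n - 1) \<longrightarrow> f \<mu> = \<zero>\<^bsub>Q\<^esub>) \<and>
      finite {\<mu>. f \<mu> \<noteq> \<zero>\<^bsub>Q\<^esub>} \<and> C = (\<Oplus>\<^bsub>Q\<^esub>\<mu>\<in>{\<mu>. f \<mu> \<noteq> \<zero>\<^bsub>Q\<^esub>}. f \<mu>)"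
  assume f: "?dec f" and g: "?dec g"
  have eig: "x \<in> h (n - 1) \<Longrightarrow> act Q x (f \<mu>) = \<mu> x \<odot>\<^bsub>Q\<^esub> f \<mu>" and fam: "f \<mu> \<in> carrier Q"
    if "?dec f" for f \<mu> x
  proof -
    \<comment> \<open>Off the dual space the component is zero, which satisfies the weight equation
      for every \<open>\<mu>\<close>.\<close>
    have "f \<mu> \<in> wspace_Q \<mu>"
      using that Q.sub_zero[OF sub_wspace_Q] by metis
    then show "x \<in> h (n - 1) \<Longrightarrow> act Q x (f \<mu>) = \<mu> x \<odot>\<^bsub>Q\<^esub> f \<mu>" "f \<mu> \<in> carrier Q"
      unfolding weight_space_def by blast+
  qed
  show "f = g"
  proof (rule Q.eigenvectors_unique[where H = "h (n - 1)" and T = "act Q" and I = "dual (n - 1)"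
        and e = "\<lambda>\<mu>. \<mu>"])
    show "Q.family f" "Q.family g"
      using f g fam[OF f] fam[OF g] by (simp_all add: Q.family_def)
    show "Q.fsum f = Q.fsum g"
      using f g by (simp add: Q.fsum_def)
    show "act Q x (f \<mu>) = \<mu> x \<odot>\<^bsub>Q\<^esub> f \<mu>" "act Q x (g \<mu>) = \<mu> x \<odot>\<^bsub>Q\<^esub> g \<mu>" if "x \<in> h (n - 1)" for x \<mu>
      using eig[OF f that] eig[OF g that] .
    show "f \<mu> = \<zero>\<^bsub>Q\<^esub>" "g \<mu> = \<zero>\<^bsub>Q\<^esub>" if "\<mu> \<notin> dual (n - 1)" for \<mu>
      using f g that by blast+
  qed (use endo_Q dual_separated in blast)+
qed

text \<open>A weight vector of the quotient equals its own component in the decomposition of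
  \<open>generator_family\<close>, and that component is spanned by the finite set
  \<open>generators_Q \<nu>\<close>. So the quotient has no weight vectors beyond images of reduced
  ones.\<close>

lemma finite_dim_Q: "finite_dim_weight_spaces (JD_scale sc) (h (n - 1)) Q"
  unfolding finite_dim_weight_spaces_def finite_dim_subspace_def
proof (intro ballI, rule exI, intro conjI ballI)
  fix \<nu> assume \<nu>: "\<nu> \<in> dual (n - 1)"
  show "finite (generators_Q \<nu>)"
    by (rule finite_generators_Q)
  show "generators_Q \<nu> \<subseteq> wspace_Q \<nu>"
    by (rule generators_Q_wspace)
  fix C assume C: "C \<in> wspace_Q \<nu>"
  have "C \<in> carrier Q"
    using C by (simp add: weight_space_def)
  then obtain f where f: "Q.family f" "\<And>\<nu>. f \<nu> \<in> Q.lspan (generators_Q \<nu>)" "C = Q.fsum f"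
    "\<And>\<nu> x. x \<in> h (n - 1) \<Longrightarrow> act Q x (f \<nu>) = \<nu> x \<odot>\<^bsub>Q\<^esub> f \<nu>"
    "\<And>\<nu>. \<nu> \<notin> dual (n - 1) \<Longrightarrow> f \<nu> = \<zero>\<^bsub>Q\<^esub>"
    by (rule generator_family) (rule that)
  have "Q.fsum f = f \<nu>"
  proof (rule Q.eigenvector_component[where H = "h (n - 1)" and T = "act Q" and
        I = "dual (n - 1)" and e = "\<lambda>\<mu>. \<mu>"])
    show "act Q x (Q.fsum f) = \<nu> x \<odot>\<^bsub>Q\<^esub> Q.fsum f" if "x \<in> h (n - 1)" for x
      using C that unfolding f(3) weight_space_def by blast
  qed (use endo_Q dual_separated f \<nu> in blast)+
  then have "C \<in> Q.lspan (generators_Q \<nu>)"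
    using f(2)[of \<nu>] f(3) by simp
  then show "\<exists>c. C = (\<Oplus>\<^bsub>Q\<^esub>b\<in>generators_Q \<nu>. c b \<odot>\<^bsub>Q\<^esub> b)"
    by (rule Q.finite_span_combination[OF finite_generators_Q generators_Q_carrier])
qed

end

theorem mainTheorem6:
  fixes sc :: "complex \<Rightarrow> 'g::ab_group_add \<Rightarrow> 'g"
    and br :: "'g \<Rightarrow> 'g \<Rightarrow> 'g"
    and form :: "'g \<Rightarrow> 'g \<Rightarrow> complex"
    and H :: "'g set"
    and n :: nat
    and V :: "('g loopD, 'v) lie_mod"
    and z :: "nat \<Rightarrow> 'v \<Rightarrow> 'v"
    and k :: "nat \<Rightarrow> int"
  assumes "lie_algebra sc br"
    and "lie_algebra.finite_dimensional sc"
    and "lie_algebra.simple sc br"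
    and "lie_algebra.nondeg_invariant_form sc br form"
    and "lie_algebra.cartan_subalgebra sc br H"
    and "n \<ge> 2"
    and "irreducible_lie_module (JD_scale sc) (JD_bracket n sc br form) (JD n 0) V"
    and "weight_module (JD_scale sc) (cartan_part n 0 H) V"
    and "finite_dim_weight_spaces (JD_scale sc) (cartan_part n 0 H) V"
    and "\<And>i. i \<in> {1..n-1} \<Longrightarrow> k i > 0"
    and "\<And>i. i \<in> {1..n-1} \<Longrightarrow> central_operator n V (z i)"
    and "\<And>i. i \<in> {1..n-1} \<Longrightarrow> nonzero_operator V (z i)"
    and "\<And>i. i \<in> {1..n-1} \<Longrightarrow> has_degree n V (z i) (\<lambda>j. if j = i then k i else 0)"
  shows "\<exists>W. maximal_lie_submodule (JD n (n-1)) W V \<and>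
    irreducible_lie_module (JD_scale sc) (JD_bracket n sc br form) (JD n (n-1))
      (quotient_lie_mod V W) \<and>
    weight_module (JD_scale sc) (cartan_part n (n-1) H) (quotient_lie_mod V W) \<and>
    finite_dim_weight_spaces (JD_scale sc) (cartan_part n (n-1) H) (quotient_lie_mod V W) \<and>
    {z i v \<ominus>\<^bsub>V\<^esub> v | i v. i \<in> {1..n-1} \<and> v \<in> carrier V} \<subseteq> W"
proof -
  interpret lie_algebra sc br
    by fact
  have H: "subspace H"
    using assms(5) unfolding cartan_subalgebra_def subalgebra_def by blast
  interpret V: cspace V
    by (rule cspace.intro)
      (use assms(7) in \<open>simp add: irreducible_lie_module_def lie_module_def\<close>)
  interpret V: irreducible_JD_module V sc br form n
    by (intro irreducible_JD_module.intro irreducible_JD_module_axioms.intro V.cspace_axioms assms)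
  let ?h = "cartan_part n 0 H"
  \<comment> \<open>A non-zero vector exists by irreducibility, and one of its weight components is
    non-zero. It serves as the fixed weight vector \<open>v0\<close>.\<close>
  obtain v \<mu> where v: "v \<in> carrier V" "v \<noteq> \<zero>\<^bsub>V\<^esub>" "v \<in> weight_space ?h V \<mu>"
  proof -
    have "carrier V \<noteq> {\<zero>\<^bsub>V\<^esub>}"
      using assms(7) by (simp add: irreducible_lie_module_def)
    then obtain w where w: "w \<in> carrier V" "w \<noteq> \<zero>\<^bsub>V\<^esub>"
      using V.sub_zero[OF V.sub_carrier_self] by blast
    obtain f where f: "\<And>\<mu>. \<mu> \<in> dual_space (JD_scale sc) ?h \<Longrightarrow> f \<mu> \<in> weight_space ?h V \<mu>"
      "\<And>\<mu>. \<mu> \<notin> dual_space (JD_scale sc) ?h \<Longrightarrow> f \<mu> = \<zero>\<^bsub>V\<^esub>"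
      "w = (\<Oplus>\<^bsub>V\<^esub>\<mu>\<in>{\<mu>. f \<mu> \<noteq> \<zero>\<^bsub>V\<^esub>}. f \<mu>)"
      using assms(8) w(1) unfolding weight_module_def by blast
    have "{\<mu>. f \<mu> \<noteq> \<zero>\<^bsub>V\<^esub>} \<noteq> {}"
    proof
      assume "{\<mu>. f \<mu> \<noteq> \<zero>\<^bsub>V\<^esub>} = {}"
      then have "w = \<zero>\<^bsub>V\<^esub>"
        unfolding f(3) by (simp only: V.M.finsum_empty)
      then show False
        using w(2) by simp
    qed
    then obtain \<mu> where \<mu>: "f \<mu> \<noteq> \<zero>\<^bsub>V\<^esub>"
      by blast
    then have "f \<mu> \<in> weight_space ?h V \<mu>"
      using f(1,2) by blast
    moreover from this have "f \<mu> \<in> carrier V"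
      by (simp add: weight_space_def)
    ultimately show ?thesis
      using that \<mu> by blast
  qed
  have zero_H: "0 \<in> H"
    using H by (rule subspace_0)
  have z: "V.central_auto (z i)" if "i \<in> {1..n-1}" for i
    using assms(11,12)[OF that] by (rule V.central_auto_operator)
  \<comment> \<open>The reference eigenvalues \<open>c0\<close> are the values of the weight
    \<open>\<mu>\<close> of \<open>v\<close> at the \<open>d_elt i\<close>.\<close>
  interpret V: central_JD_module V sc br form n z k v "\<lambda>i. \<mu> (d_elt i)"
  proof (intro central_JD_module.intro central_JD_module_axioms.intro V.irreducible_JD_module_axioms)
    fix i j w assume i: "i \<in> {1..n-1}" and j: "j \<in> {1..n}" and w: "w \<in> carrier V"
    have cl: "z i w \<in> carrier V" "z i (act V (d_elt j) w) \<in> carrier V" "act V (d_elt j) (z i w) \<in> carrier V"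
      using V.endo_closed[OF V.central_auto_endo[OF z[OF i]]] V.endo_closed[OF V.endo_JD[OF V.d_JD[OF j]]] w
      by auto
    \<comment> \<open>The degree condition speaks of a commutator; adding the subtracted term back
      gives the form in which the locale states it.\<close>
    have "act V (d_elt j) (z i w) = z i (act V (d_elt j) w) \<oplus>\<^bsub>V\<^esub>
        (act V (d_elt j) (z i w) \<ominus>\<^bsub>V\<^esub> z i (act V (d_elt j) w))"
      using cl by (simp add: V.M.minus_eq V.M.a_lcomm[of "z i (act V (d_elt j) w)"] V.M.r_neg)
    also have "act V (d_elt j) (z i w) \<ominus>\<^bsub>V\<^esub> z i (act V (d_elt j) w) =
        of_int (if j = i then k i else 0) \<odot>\<^bsub>V\<^esub> z i w"
      using assms(13)[OF i] j w unfolding has_degree_def by blast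
    also have "of_int (if j = i then k i else 0) = (if j = i then of_int (k i) else (0 :: complex))"
      by simp
    finally show "act V (d_elt j) (z i w) = z i (act V (d_elt j) w) \<oplus>\<^bsub>V\<^esub>
        (if j = i then of_int (k i) else 0) \<odot>\<^bsub>V\<^esub> z i w" .
  next
    fix i assume "i \<in> {1..n}"
    then have "d_elt i \<in> ?h"
      using zero_H by (intro cartan_part_d_elt) auto
    then show "act V (d_elt i) v = \<mu> (d_elt i) \<odot>\<^bsub>V\<^esub> v"
      using v(3) by (simp add: weight_space_def)
  qed (fact assms z v)+
  interpret V: weight_JD_module V sc br form n z k v "\<lambda>i. \<mu> (d_elt i)" H
    by (intro weight_JD_module.intro weight_JD_module_axioms.intro V.central_JD_module_axioms
        subspace_0[OF H] subspace_add[OF H] subspace_scale[OF H] assms)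
  obtain W where W: "maximal_lie_submodule (JD n (n - 1)) W V" "V.shifts (n - 1) \<subseteq> W"
    by (rule V.maximal_submodule_exists)
  have lie_W: "lie_submodule (JD n (n - 1)) W V"
    using W(1) by (simp add: maximal_lie_submodule_def)
  interpret V: shift_submodule V sc br form n z k v "\<lambda>i. \<mu> (d_elt i)" H W
    by (intro shift_submodule.intro shift_submodule_axioms.intro V.weight_JD_module_axioms lie_W W(2))
  have "irreducible_lie_module (JD_scale sc) (JD_bracket n sc br form) (JD n (n - 1))
      (quotient_lie_mod V W)"
    by (rule irreducible_quotient[OF V.lie_module_sub W(1)])
      (auto intro: JD_add JD_scale_closed JD_bracket_closed)
  moreover have "{z i v \<ominus>\<^bsub>V\<^esub> v | i v. i \<in> {1..n-1} \<and> v \<in> carrier V} \<subseteq> W"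
    using V.shift_in_shifts W(2) by blast
  ultimately show ?thesis
    using W(1) V.weight_module_Q V.finite_dim_Q by blast
qed

end
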